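(* There is an absolute constant $C>0$ such that for all $r,s\in[2,\infty]$, all positive integers $m,n$ and every matrix $A=(a_{ij})_{i\le m,\,j\le n}$ with nonnegative entries, $$\gamma_{2,2}(K,\rho)\le C\,(H_r+H_s)\qquad\text{and}\qquad H_r+H_s\le C\,M,$$ where $K$, $\rho$, $H_r$, $H_s$, $M$ are the objects defined from $A,r,s$ in the context.
   Context: Set $K=B_{2,+}^m\times B_{2,+}^n$, where $B_{2,+}^d=\{x\in\mathbb R^d: x_i\ge0\ \forall i,\ \|x\|_2\le1\}$. Put $\alpha=2-2/s$, $\beta=2-2/r$ (with $2/\infty=0$), so $\alpha,\beta\in[1,2]$. Use the convention $t^0=1$ for all $t\ge0$, including $t=0$. For $z=(u,v)\in K$ define $$U_{ij}(z)=\alpha a_{ij}u_i^{\alpha-1}v_j^\beta,\qquad V_{ij}(z)=\beta a_{ij}u_i^\alpha v_j^{\beta-1},$$ and the pseudometric on $K$ $$\rho(z,z')=\max_{i\le m}\|(U_{ij}(z)-U_{ij}(z'))_{j\le n}\|_2+\max_{j\le n}\|(V_{ij}(z)-V_{ij}(z'))_{i\le m}\|_2.$$ Chaining functional: for a pseudometric space $(T,d)$, an admissible sequence is a sequence of nested partitions $(\mathcal A_k)_{k\ge0}$ of $T$ (each $\mathcal A_{k+1}$ refines $\mathcal A_k$) with $\mathcal A_0=\{T\}$ and $|\mathcal A_k|\le2^{2^k}$; $\mathcal A_k(x)$ is the cell of $\mathcal A_k$ containing $x$. Then $$\gamma_{2,2}(T,d)=\inf_{(\mathcal A_k)}\sup_{x\in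 T}\Big(\sum_{k\ge0}2^{k}\operatorname{diam}_d(\mathcal A_k(x))^2\Big)^{1/2}.$$ Gaussian moments: with $(g_i)_{i\le m}$, respectively $(g_j)_{j\le n}$, standard Gaussian vectors in $\mathbb R^m$, respectively $\mathbb R^n$, $$H_s=\Big(\mathbb E\big[\big(\max_{j\le n}\|(a_{ij}g_i)_{i\le m}\|_s\big)^2\big]\Big)^{1/2},\qquad H_r=\Big(\mathbb E\big[\big(\max_{i\le m}\|(a_{ij}g_j)_{j\le n}\|_r\big)^2\big]\Big)^{1/2}.$$ (The same Gaussian vector is used across all columns in $H_s$ and across all rows in $H_r$.) Finally, $D_r=\max_{i\le m}\|(a_{ij})_{j\le n}\|_r$, $D_s=\max_{j\le n}\|(a_{ij})_{i\le m}\|_s$, $S^*=\mathbb E\max_{i,j}|a_{ij}g_{ij}|$ with $g_{ij}$ independent standard Gaussians, and $$M=\sqrt{r\wedge\operatorname{Log} n}\,D_r+\sqrt{s\wedge\operatorname{Log} m}\,D_s+S^*,$$ with $\operatorname{Log} d=\max(1,\log d)$, $a\wedge b=\min(a,b)$. $\|\cdot\|_t$ is the $\ell_t$ norm ($\ell_\infty$ is the maximum norm). *)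

theory Defs
  imports "HOL-Probability.Probability"
begin

text \<open>The dimensions m and n vary under the existential quantifier over the constant, so index
  sets are initial segments of the naturals: a vector of length m is a function on \<open>{..<m}\<close> and
  an m by n matrix is a function \<open>nat \<Rightarrow> nat \<Rightarrow> real\<close> of which only the entries
  with \<open>i < m\<close>, \<open>j < n\<close> are used. The exponents r and s have type \<^typ>\<open>ereal\<close>.\<close>

definition lnorm :: "ereal \<Rightarrow> nat set \<Rightarrow> (nat \<Rightarrow> real) \<Rightarrow> real" where
  "lnorm t I x =
     (if t = \<infinity> then (MAX i\<in>I. \<bar>x i\<bar>)
      else (\<Sum>i\<in>I. \<bar>x i\<bar> powr real_of_ereal t) powr (1 / real_of_ereal t))"

text \<open>Library \<open>powr\<close> has \<open>0 powr 0 = 0\<close>; here the power with exponent 0 is 1 everywhere.\<close>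

definition rpow :: "real \<Rightarrow> real \<Rightarrow> real" where
  "rpow t p = (if p = 0 then 1 else t powr p)"

text \<open>In \<^typ>\<open>ereal\<close>, \<open>2 / \<infinity> = 0\<close>. This is used with \<open>t = s\<close> for \<open>\<alpha>\<close> and
  \<open>t = r\<close> for \<open>\<beta>\<close>.\<close>

definition expo :: "ereal \<Rightarrow> real" where
  "expo t = real_of_ereal (2 - 2 / t)"

definition B2plus :: "nat \<Rightarrow> (nat \<Rightarrow> real) set" where
  "B2plus d = {x \<in> {..<d} \<rightarrow>\<^sub>E UNIV. (\<forall>i<d. 0 \<le> x i) \<and> L2_set x {..<d} \<le> 1}"

definition Kset :: "nat \<Rightarrow> nat \<Rightarrow> ((nat \<Rightarrow> real) \<times> (nat \<Rightarrow> real)) set" where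
  "Kset m n = B2plus m \<times> B2plus n"

definition Umat ::
  "ereal \<Rightarrow> ereal \<Rightarrow> (nat \<Rightarrow> nat \<Rightarrow> real) \<Rightarrow>
   (nat \<Rightarrow> real) \<times> (nat \<Rightarrow> real) \<Rightarrow> nat \<Rightarrow> nat \<Rightarrow> real" where
  "Umat r s a z i j =
     (let \<alpha> = expo s; \<beta> = expo r; (u, v) = z
      in \<alpha> * a i j * rpow (u i) (\<alpha> - 1) * rpow (v j) \<beta>)"

definition Vmat ::
  "ereal \<Rightarrow> ereal \<Rightarrow> (nat \<Rightarrow> nat \<Rightarrow> real) \<Rightarrow>
   (nat \<Rightarrow> real) \<times> (nat \<Rightarrow> real) \<Rightarrow> nat \<Rightarrow> nat \<Rightarrow> real" where
  "Vmat r s a z i j =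
     (let \<alpha> = expo s; \<beta> = expo r; (u, v) = z
      in \<beta> * a i j * rpow (u i) \<alpha> * rpow (v j) (\<beta> - 1))"

definition rho ::
  "nat \<Rightarrow> nat \<Rightarrow> ereal \<Rightarrow> ereal \<Rightarrow> (nat \<Rightarrow> nat \<Rightarrow> real) \<Rightarrow>
   (nat \<Rightarrow> real) \<times> (nat \<Rightarrow> real) \<Rightarrow> (nat \<Rightarrow> real) \<times> (nat \<Rightarrow> real) \<Rightarrow> real" where
  "rho m n r s a z z' =
     (MAX i\<in>{..<m}. L2_set (\<lambda>j. Umat r s a z i j - Umat r s a z' i j) {..<n}) +
     (MAX j\<in>{..<n}. L2_set (\<lambda>i. Vmat r s a z i j - Vmat r s a z' i j) {..<m})"

text \<open>Diameters and the chaining functional take values in \<^typ>\<open>ennreal\<close>, so that suprema,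
  infima and infinite sums need no finiteness or convergence conditions.\<close>

definition ediam :: "('a \<Rightarrow> 'a \<Rightarrow> real) \<Rightarrow> 'a set \<Rightarrow> ennreal" where
  "ediam d S = (SUP x\<in>S. SUP y\<in>S. ennreal (d x y))"

definition esqrt :: "ennreal \<Rightarrow> ennreal" where
  "esqrt x = (if x = \<infinity> then \<infinity> else ennreal (sqrt (enn2real x)))"

definition admissible :: "'a set \<Rightarrow> (nat \<Rightarrow> 'a set set) \<Rightarrow> bool" where
  "admissible T P \<longleftrightarrow>
     P 0 = {T} \<and>
     (\<forall>k. partition_on T (P k) \<and> finite (P k) \<and> card (P k) \<le> 2 ^ 2 ^ k \<and>
          refines T (P (Suc k)) (P k))"

definition cell :: "'a set set \<Rightarrow> 'a \<Rightarrow> 'a set" where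
  "cell Q x = (THE S. S \<in> Q \<and> x \<in> S)"

definition gamma22 :: "'a set \<Rightarrow> ('a \<Rightarrow> 'a \<Rightarrow> real) \<Rightarrow> ennreal" where
  "gamma22 T d =
     (INF P\<in>{P. admissible T P}.
        SUP x\<in>T. esqrt (\<Sum>k. 2 ^ k * (ediam d (cell (P k) x))\<^sup>2))"

text \<open>The law of a family, indexed by \<open>I\<close>, of independent standard Gaussian variables.\<close>

definition gauss :: "'i set \<Rightarrow> ('i \<Rightarrow> real) measure" where
  "gauss I = Pi\<^sub>M I (\<lambda>_. std_normal_distribution)"

definition H_s :: "nat \<Rightarrow> nat \<Rightarrow> ereal \<Rightarrow> (nat \<Rightarrow> nat \<Rightarrow> real) \<Rightarrow> real" where
  "H_s m n s a =
     sqrt (\<integral>g. (MAX j\<in>{..<n}. lnorm s {..<m} (\<lambda>i. a i j * g i))\<^sup>2 \<partial>gauss {..<m})"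

definition H_r :: "nat \<Rightarrow> nat \<Rightarrow> ereal \<Rightarrow> (nat \<Rightarrow> nat \<Rightarrow> real) \<Rightarrow> real" where
  "H_r m n r a =
     sqrt (\<integral>g. (MAX i\<in>{..<m}. lnorm r {..<n} (\<lambda>j. a i j * g j))\<^sup>2 \<partial>gauss {..<n})"

definition D_r :: "nat \<Rightarrow> nat \<Rightarrow> ereal \<Rightarrow> (nat \<Rightarrow> nat \<Rightarrow> real) \<Rightarrow> real" where
  "D_r m n r a = (MAX i\<in>{..<m}. lnorm r {..<n} (\<lambda>j. a i j))"

definition D_s :: "nat \<Rightarrow> nat \<Rightarrow> ereal \<Rightarrow> (nat \<Rightarrow> nat \<Rightarrow> real) \<Rightarrow> real" where
  "D_s m n s a = (MAX j\<in>{..<n}. lnorm s {..<m} (\<lambda>i. a i j))"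

definition S_star :: "nat \<Rightarrow> nat \<Rightarrow> (nat \<Rightarrow> nat \<Rightarrow> real) \<Rightarrow> real" where
  "S_star m n a =
     (\<integral>g. (MAX (i, j)\<in>{..<m} \<times> {..<n}. \<bar>a i j * g (i, j)\<bar>) \<partial>gauss ({..<m} \<times> {..<n}))"

definition Log1 :: "nat \<Rightarrow> real" where
  "Log1 d = max 1 (ln (real d))"

definition Mbound ::
  "nat \<Rightarrow> nat \<Rightarrow> ereal \<Rightarrow> ereal \<Rightarrow> (nat \<Rightarrow> nat \<Rightarrow> real) \<Rightarrow> real" where
  "Mbound m n r s a =
     sqrt (real_of_ereal (min r (ereal (Log1 n)))) * D_r m n r a +
     sqrt (real_of_ereal (min s (ereal (Log1 m)))) * D_s m n s a +
     S_star m n a"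

end

theory Submission
  imports Defs
begin

text \<open>
  The functional \<open>\<gamma>\<^sub>2\<^sub>,\<^sub>2\<close> is bounded through codes: if at precision \<open>2\<^sup>-\<^sup>l\<close> the point \<open>z\<close>
  can be described, given its description at all coarser precisions, by \<open>L\<^sub>l z\<close> bits, then
  \<open>\<gamma>\<^sub>2\<^sub>,\<^sub>2\<^sup>2\<close> is at most a constant times the supremum over \<open>z\<close> of \<open>\<Sum>\<^sub>l 4\<^sup>-\<^sup>l L\<^sub>l z\<close>.  By Hoelder's
  inequality \<open>\<rho>\<close> is dominated by two kinds of terms.

  The first kind are the seminorms \<open>max\<^sub>j \<parallel>(a\<^sub>i\<^sub>j x\<^sub>i)\<^sub>i\<parallel>\<^sub>s\<close> and \<open>max\<^sub>i \<parallel>(a\<^sub>i\<^sub>j x\<^sub>j)\<^sub>j\<parallel>\<^sub>r\<close> of \<open>u - u'\<close> and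
  \<open>v - v'\<close>.  The Gaussian measure of translates of a ball of the seminorm (dual Sudakov inequality)
  gives a code whose length is governed by the distance to a nearly shortest vector of the previous
  cell, and by the parallelogram identity the squares of these distances telescope.

  The second kind are \<open>w\<^sub>i |u\<^sub>i\<^sup>\<alpha>\<^sup>-\<^sup>1 - u'\<^sub>i\<^sup>\<alpha>\<^sup>-\<^sup>1|\<close>, where the weight \<open>w\<^sub>i\<close> depends on \<open>v\<close> and is known
  up to the current precision.  The coordinates are coded independently.  The prior probability that
  the \<open>i\<close>-th one is not negligible at precision \<open>t\<close> is a power of \<open>\<sigma>\<^sub>i / t\<close>, where the scale
  \<open>\<sigma>\<^sub>i\<close> is computed from \<open>E min(1, (w\<^sub>i |g| / 4H)\<^sup>s)\<close>.  The sum over \<open>i\<close> of these expectations is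
  bounded because \<open>\<parallel>(w\<^sub>i g\<^sub>i)\<^sub>i\<parallel>\<^sub>s\<close> is at most the Gaussian seminorm above, and the lower bound for the
  Gaussian tail controls their logarithms.

  For the second inequality the \<open>j\<close>-th column norm is estimated in \<open>L\<^sub>q\<close> with \<open>q\<close> of order
  \<open>(S\<^sup>* / max\<^sub>i a\<^sub>i\<^sub>j)\<^sup>2\<close>, and \<open>\<Sum>\<^sub>j exp(-q)\<close> is bounded by the definition of \<open>S\<^sup>*\<close>.
\<close>

text \<open>Code lengths are allowed to depend on the point: at a single precision an individual
  \<open>z\<close> may be expensive, and only the sum over all precisions for that fixed
  \<open>z\<close> has to be bounded. The functional permits this because a bit spent at level l
  only delays the descent to later levels, where squared diameters have already decayed like 4^-l;
  up to a constant it is charged 4^-l.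

  The obstacle behind the second kind of terms is that x^(alpha-1) is not Lipschitz at 0 for 1 <
  alpha < 2, so small coordinates of u are not controlled by a seminorm of u - u'. Their weights
  depend on v, and a quantisation is only decodable if the weights are known to within half its
  step. This fixes the order of the four codes that make up one refinement: both seminorms, then the
  coordinates of u, then those of v.

  Exchanging rows and columns exchanges r with s and u with v. Hence every estimate is proved for
  columns and instantiated a second time for the transposed matrix.\<close>

section \<open>Chaining functionals from tree codes\<close>

text \<open>There is no prefix condition: every length b has its own supply of 2^b labels, and the
  length counts as known when the label is read. Labels live in the type of the points, so that
  \<open>split_code\<close> can quantify over them without a further type variable.\<close>

definition is_code ::
  "'a set \<Rightarrow> ('a \<Rightarrow> 'a \<Rightarrow> bool) \<Rightarrow> ('a \<Rightarrow> real) \<Rightarrow> ('a \<Rightarrow> nat) \<Rightarrow> ('a \<Rightarrow> 'a) \<Rightarrow> bool" where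
  "is_code A R bnd L lab \<longleftrightarrow>
     (\<forall>z\<in>A. 1 \<le> L z \<and> real (L z) \<le> bnd z) \<and>
     (\<forall>b. finite (lab ` {z\<in>A. L z = b}) \<and> card (lab ` {z\<in>A. L z = b}) \<le> 2 ^ b) \<and>
     (\<forall>z\<in>A. \<forall>z'\<in>A. L z = L z' \<longrightarrow> lab z = lab z' \<longrightarrow> R z z')"

definition split_code :: "'a set \<Rightarrow> ('a \<Rightarrow> 'a \<Rightarrow> bool) \<Rightarrow> ('a \<Rightarrow> real) \<Rightarrow> bool" where
  "split_code A R bnd \<longleftrightarrow> (\<exists>L lab. is_code A R bnd L lab)"

lemma is_codeD:
  assumes "is_code A R bnd L lab"
  shows "\<And>z. z \<in> A \<Longrightarrow> 1 \<le> L z" "\<And>z. z \<in> A \<Longrightarrow> real (L z) \<le> bnd z"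
    "\<And>b. finite (lab ` {z\<in>A. L z = b})" "\<And>b. card (lab ` {z\<in>A. L z = b}) \<le> 2 ^ b"
    "\<And>z z'. \<lbrakk>z \<in> A; z' \<in> A; L z = L z'; lab z = lab z'\<rbrakk> \<Longrightarrow> R z z'"
  using assms by (simp_all add: is_code_def)

text \<open>Keys of any type will do: each class of equal length and key is labelled by one chosen
  member, which brings the label back into the type of the points.\<close>

lemma split_codeI:
  fixes L :: "'a \<Rightarrow> nat" and key :: "'a \<Rightarrow> 'k"
  assumes L: "\<And>z. z \<in> A \<Longrightarrow> 1 \<le> L z" "\<And>z. z \<in> A \<Longrightarrow> real (L z) \<le> bnd z"
    and fin: "\<And>b. finite (key ` {z\<in>A. L z = b})"
    and card: "\<And>b. card (key ` {z\<in>A. L z = b}) \<le> 2 ^ b"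
    and R: "\<And>z z'. \<lbrakk>z \<in> A; z' \<in> A; L z = L z'; key z = key z'\<rbrakk> \<Longrightarrow> R z z'"
  shows "split_code A R bnd"
proof -
  define h where "h = (\<lambda>b k. SOME z. z \<in> A \<and> L z = b \<and> key z = k)"
  define lab where "lab = (\<lambda>z. h (L z) (key z))"
  have h: "lab z \<in> A \<and> L (lab z) = L z \<and> key (lab z) = key z" if "z \<in> A" for z
    unfolding lab_def h_def by (rule someI[of _ z]) (use that in auto)
  have im: "lab ` {z\<in>A. L z = b} = h b ` (key ` {z\<in>A. L z = b})" for b
    by (auto simp: lab_def image_iff)
  have "finite (lab ` {z\<in>A. L z = b})" for b
    unfolding im using fin by auto
  moreover have "card (lab ` {z\<in>A. L z = b}) \<le> 2 ^ b" for b
    unfolding im using card_image_le[OF fin] card order_trans by blast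
  moreover have "R z z'" if "z \<in> A" "z' \<in> A" "L z = L z'" "lab z = lab z'" for z z'
    using R[OF that(1-3)] h[OF that(1)] h[OF that(2)] that(4) by metis
  ultimately show ?thesis
    unfolding split_code_def is_code_def using L by (intro exI[of _ L] exI[of _ lab]) simp
qed

lemma split_code_mono:
  assumes "split_code A R bnd" "\<And>z z'. z \<in> A \<Longrightarrow> z' \<in> A \<Longrightarrow> R z z' \<Longrightarrow> R' z z'"
    "\<And>z. z \<in> A \<Longrightarrow> bnd z \<le> bnd' z"
  shows "split_code A R' bnd'"
proof -
  obtain L lab where *: "is_code A R bnd L lab" using assms(1) unfolding split_code_def by blast
  show ?thesis
  proof (rule split_codeI[where L = L and key = lab])
    fix z assume "z \<in> A"
    then show "1 \<le> L z" "real (L z) \<le> bnd' z"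
      using is_codeD(1,2)[OF *, of z] assms(3)[of z] by simp_all
  qed (use is_codeD(3-5)[OF *] assms(2) in simp_all)
qed

lemma split_code_vimage:
  fixes g :: "'a \<Rightarrow> 'b"
  assumes "split_code (g ` A) R bnd"
  shows "split_code A (\<lambda>z z'. R (g z) (g z')) (\<lambda>z. bnd (g z))"
proof -
  obtain L lab where *: "is_code (g ` A) R bnd L lab" using assms unfolding split_code_def by blast
  have im: "(\<lambda>z. lab (g z)) ` {z\<in>A. L (g z) = b} = lab ` {z\<in>g ` A. L z = b}" for b
    by auto
  show ?thesis
    by (rule split_codeI[where L = "\<lambda>z. L (g z)" and key = "\<lambda>z. lab (g z)"])
       (use is_codeD[OF *] in \<open>simp_all add: im\<close>)
qed

text \<open>The second code may be chosen afresh on each cell of the first. To read a pair of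
  codewords of total length B one must also know where the first one ends; the at most B <= 2^B
  possibilities are the origin of the factor 2.\<close>

lemma split_code_comp:
  assumes 1: "split_code A R1 b1"
    and 2: "\<And>A'. \<lbrakk>A' \<subseteq> A; \<forall>z\<in>A'. \<forall>z'\<in>A'. R1 z z'\<rbrakk> \<Longrightarrow> split_code A' R2 b2"
  shows "split_code A (\<lambda>z z'. R1 z z' \<and> R2 z z') (\<lambda>z. 2 * (b1 z + b2 z))"
proof -
  obtain L1 lab1 where "is_code A R1 b1 L1 lab1" using 1 unfolding split_code_def by blast
  note L1 = is_codeD[OF this]
  define C where "C = (\<lambda>b l. {z\<in>A. L1 z = b \<and> lab1 z = l})"
  have "split_code (C b l) R2 b2" for b l
    by (rule 2) (auto simp: C_def intro: L1(5))
  then obtain L2 lab2 where "is_code (C b l) R2 b2 (L2 b l) (lab2 b l)" for b l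
    unfolding split_code_def by metis
  note L2 = is_codeD[OF this]
  define M where "M = (\<lambda>z. L2 (L1 z) (lab1 z) z)"
  define key where "key = (\<lambda>z. (lab1 z, L1 z, lab2 (L1 z) (lab1 z) z))"
  define L where "L = (\<lambda>z. 2 * (L1 z + M z))"
  have C: "z \<in> C (L1 z) (lab1 z)" if "z \<in> A" for z using that by (simp add: C_def)
  define U where "U = (\<lambda>B. \<Union>b\<in>{1..B}. \<Union>l\<in>lab1 ` {z\<in>A. L1 z = b}.
      (\<lambda>x. (l, b, x)) ` (lab2 b l ` {z\<in>C b l. L2 b l z = B - b}))"
  have finU: "finite (U B)" for B unfolding U_def by (intro finite_UN_I finite_imageI L1(3) L2(3)) simp
  have cardU: "card (U B) \<le> 2 ^ (2 * B)" for B
  proof -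
    have "card (U B) \<le> (\<Sum>b\<in>{1..B}. card (\<Union>l\<in>lab1 ` {z\<in>A. L1 z = b}.
      (\<lambda>x. (l, b, x)) ` (lab2 b l ` {z\<in>C b l. L2 b l z = B - b})))"
      unfolding U_def by (rule card_UN_le) auto
    also have "\<dots> \<le> (\<Sum>b\<in>{1..B}. 2 ^ B)"
    proof (rule sum_mono)
      fix b assume b: "b \<in> {1..B}"
      have "card (\<Union>l\<in>lab1 ` {z\<in>A. L1 z = b}.
          (\<lambda>x. (l, b, x)) ` (lab2 b l ` {z\<in>C b l. L2 b l z = B - b}))
        \<le> (\<Sum>l\<in>lab1 ` {z\<in>A. L1 z = b}. card ((\<lambda>x. (l, b, x)) ` (lab2 b l ` {z\<in>C b l. L2 b l z = B - b})))"
        by (rule card_UN_le) (rule L1(3))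
      also have "\<dots> \<le> (\<Sum>l\<in>lab1 ` {z\<in>A. L1 z = b}. 2 ^ (B - b))"
        by (rule sum_mono) (rule order_trans[OF card_image_le[OF L2(3)] L2(4)])
      also have "\<dots> \<le> 2 ^ b * 2 ^ (B - b)" using L1(4)[of b] by simp
      also have "\<dots> = 2 ^ B" using b by (simp flip: power_add)
      finally show "card (\<Union>l\<in>lab1 ` {z\<in>A. L1 z = b}.
          (\<lambda>x. (l, b, x)) ` (lab2 b l ` {z\<in>C b l. L2 b l z = B - b})) \<le> 2 ^ B" .
    qed
    also have "\<dots> = B * 2 ^ B" by simp
    also have "\<dots> \<le> 2 ^ B * 2 ^ B" by (intro mult_right_mono) (auto intro: less_imp_le)
    also have "\<dots> = 2 ^ (2 * B)" by (simp add: mult_2 power_add)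
    finally show ?thesis .
  qed
  \<comment> \<open>\<open>L\<close> takes only even values, so for odd b there is no key at all and
    otherwise the bound 2^(2 * (b div 2)) is 2^b.\<close>
  have keyU: "key ` {z\<in>A. L z = b} \<subseteq> U (b div 2) \<and> (key ` {z\<in>A. L z = b} \<noteq> {} \<longrightarrow> b = 2 * (b div 2))" for b
  proof (intro conjI subsetI impI)
    fix k assume "k \<in> key ` {z\<in>A. L z = b}"
    then obtain z where z: "z \<in> A" "L z = b" "k = key z" by auto
    have b: "b div 2 = L1 z + M z" using z(2) by (simp add: L_def)
    have "lab2 (L1 z) (lab1 z) z \<in> lab2 (L1 z) (lab1 z) ` {y\<in>C (L1 z) (lab1 z). L2 (L1 z) (lab1 z) y = b div 2 - L1 z}"
      using C[OF z(1)] b by (auto simp: M_def)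
    moreover have "L1 z \<in> {1..b div 2}" using L1(1)[OF z(1)] b by simp
    ultimately show "k \<in> U (b div 2)"
      unfolding z(3) key_def U_def using z(1) by blast
  next
    assume "key ` {z\<in>A. L z = b} \<noteq> {}"
    then show "b = 2 * (b div 2)" by (auto simp: L_def)
  qed
  show ?thesis
  proof (rule split_codeI[where L = L and key = key])
    fix z assume z: "z \<in> A"
    show "1 \<le> L z" using L1(1)[OF z] by (simp add: L_def)
    show "real (L z) \<le> 2 * (b1 z + b2 z)"
      using L1(2)[OF z] L2(2)[OF C[OF z]] by (simp add: L_def M_def)
  next
    fix b show "finite (key ` {z\<in>A. L z = b})"
      by (rule finite_subset[OF conjunct1[OF keyU] finU])
    show "card (key ` {z\<in>A. L z = b}) \<le> 2 ^ b"
    proof (cases "key ` {z\<in>A. L z = b} = {}")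
      case False
      then have "2 ^ (2 * (b div 2)) = (2::nat) ^ b" using keyU[of b] by simp
      then show ?thesis
        using card_mono[OF finU conjunct1[OF keyU, of b]] cardU[of "b div 2"] by simp
    next
      case True
      then show ?thesis unfolding True by simp
    qed
  next
    fix z z' assume *: "z \<in> A" "z' \<in> A" "L z = L z'" "key z = key z'"
    then have "L1 z = L1 z'" "lab1 z = lab1 z'" "M z = M z'" by (auto simp: key_def L_def)
    moreover from this have "lab2 (L1 z) (lab1 z) z = lab2 (L1 z) (lab1 z) z'"
      using * by (simp add: key_def)
    ultimately have "R1 z z'" "R2 z z'"
      using L1(5)[of z z'] L2(5)[of z "L1 z" "lab1 z" z'] C[OF *(1)] C[OF *(2)] *(1,2)
      by (simp_all add: M_def)
    then show "R1 z z' \<and> R2 z z'" ..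
  qed
qed

section \<open>From codes to admissible sequences of partitions\<close>

lemma sum_two_powers_le:
  fixes X :: real
  assumes "finite S" "\<And>k. k \<in> S \<Longrightarrow> 2 ^ k < X" "0 \<le> X"
  shows "(\<Sum>k\<in>S. 2 ^ k) \<le> 2 * X"
proof (cases "S = {}")
  case False
  define m where "m = Max S"
  have "(\<Sum>k\<in>S. (2::real) ^ k) \<le> (\<Sum>k\<in>{..<Suc m}. 2 ^ k)"
    by (rule sum_mono2) (use assms Max_ge[of S] in \<open>auto simp: m_def less_Suc_eq_le\<close>)
  also have "\<dots> = 2 ^ Suc m - 1" by (subst geometric_sum) auto
  also have "\<dots> \<le> 2 * X" using assms(2)[of m] Max_in[of S] assms(1) False by (simp add: m_def)
  finally show ?thesis .
qed (use assms in auto)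

text \<open>\<open>G n A\<close> stands for "the points of A agree to precision 2^-n", and
  \<open>L n A\<close>, \<open>lab n A\<close> are the code that splits such a set. Iterating the
  splitting gives a tree whose nodes of depth n are good at level n.\<close>

locale code_tree =
  fixes T :: "'a set" and G :: "nat \<Rightarrow> 'a set \<Rightarrow> bool"
    and L :: "nat \<Rightarrow> 'a set \<Rightarrow> 'a \<Rightarrow> nat" and lab :: "nat \<Rightarrow> 'a set \<Rightarrow> 'a \<Rightarrow> 'a"
  assumes nonempty: "T \<noteq> {}"
    and G0: "G 0 T"
    and G_Suc: "\<And>n A z. \<lbrakk>G n A; A \<subseteq> T; z \<in> A\<rbrakk> \<Longrightarrow>
        G (Suc n) {y\<in>A. L n A y = L n A z \<and> lab n A y = lab n A z}"
    and L_pos: "\<And>n A z. \<lbrakk>G n A; A \<subseteq> T; z \<in> A\<rbrakk> \<Longrightarrow> 1 \<le> L n A z"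
    and fin: "\<And>n A b. \<lbrakk>G n A; A \<subseteq> T\<rbrakk> \<Longrightarrow> finite (lab n A ` {z\<in>A. L n A z = b})"
    and card: "\<And>n A b. \<lbrakk>G n A; A \<subseteq> T\<rbrakk> \<Longrightarrow> card (lab n A ` {z\<in>A. L n A z = b}) \<le> 2 ^ b"
begin

primrec node :: "nat \<Rightarrow> 'a \<Rightarrow> 'a set" where
  "node 0 z = T"
| "node (Suc n) z =
     {y\<in>node n z. L n (node n z) y = L n (node n z) z \<and> lab n (node n z) y = lab n (node n z) z}"

definition cost :: "nat \<Rightarrow> 'a \<Rightarrow> nat" where
  "cost n z = (\<Sum>l<n. L l (node l z) z)"

lemma node_self: "z \<in> T \<Longrightarrow> z \<in> node n z"
  by (induction n) auto

lemma node_antimono: "n \<le> n' \<Longrightarrow> node n' z \<subseteq> node n z"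
  by (induction n' rule: dec_induct) auto

lemma node_subset: "node n z \<subseteq> T"
  using node_antimono[of 0 n z] by simp

lemma node_eq: "y \<in> node n z \<Longrightarrow> node n y = node n z"
  by (induction n) auto

lemma good: "z \<in> T \<Longrightarrow> G n (node n z)"
  by (induction n) (simp_all add: G0 G_Suc node_self node_subset)

lemma cost_eq:
  assumes "y \<in> node n z" "k \<le> n"
  shows "cost k y = cost k z"
  unfolding cost_def
proof (rule sum.cong)
  fix l assume "l \<in> {..<k}"
  then have "y \<in> node (Suc l) z" using assms node_antimono[of "Suc l" n z] by auto
  then show "L l (node l y) y = L l (node l z) z" using node_eq[of y l z] by simp
qed simp

lemma cost_ge: "z \<in> T \<Longrightarrow> n \<le> cost n z"
proof (induction n)
  case (Suc n)
  then show ?case using L_pos[OF good node_subset node_self, of z n] by (simp add: cost_def)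
qed simp

lemma cost_mono: "n \<le> n' \<Longrightarrow> cost n z \<le> cost n' z"
  unfolding cost_def by (rule sum_mono2) auto

text \<open>The depth is recorded with the set because the code applied next depends on
  both.\<close>

definition nodes :: "nat \<Rightarrow> (nat \<times> 'a set) set" where
  "nodes B = {(n, node n z) |n z. z \<in> T \<and> cost n z = B}"

text \<open>A node of cost B arises from one of cost B - b by one of 2^b labels, with b >= 1 by
  \<open>L_pos\<close>. The sum of 4^(B-b) * 2^b over b is 2^B * (2^B - 1), which closes the
  induction; the base 4 instead of 2 pays for the choice of b.\<close>

lemma nodes_count: "finite (nodes B) \<and> card (nodes B) \<le> 4 ^ B"
proof (induction B rule: less_induct)
  case (less B)
  show ?case
  proof (cases "B = 0")
    case True
    have "nodes 0 \<subseteq> {(0, T)}"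
    proof
      fix q assume "q \<in> nodes 0"
      then obtain n z where q: "q = (n, node n z)" "z \<in> T" "cost n z = 0" by (auto simp: nodes_def)
      then have "n = 0" using cost_ge[of z n] by simp
      then show "q \<in> {(0, T)}" using q by simp
    qed
    then have "finite (nodes 0)" "card (nodes 0) \<le> 1"
      using card_mono[of "{(0::nat, T)}" "nodes 0"] finite_subset[of "nodes 0" "{(0::nat, T)}"] by simp_all
    then show ?thesis using True by simp
  next
    case False
    define F where "F = (\<lambda>b (n, A). (\<lambda>x. (Suc n, {y\<in>A. L n A y = b \<and> lab n A y = x})) ` (lab n A ` {z\<in>A. L n A z = b}))"
    have FF: "finite (F b p) \<and> card (F b p) \<le> 2 ^ b" if "p \<in> nodes c" for b c p
    proof -
      obtain n z where p: "p = (n, node n z)" "z \<in> T" using \<open>p \<in> nodes c\<close> by (auto simp: nodes_def)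
      note 1 = fin[OF good[OF p(2)] node_subset, of n b] and 2 = card[OF good[OF p(2)] node_subset, of n b]
      show ?thesis unfolding F_def p prod.case
        using 1 order_trans[OF card_image_le[OF 1] 2] by blast
    qed
    define U where "U = (\<Union>b\<in>{1..B}. \<Union>p\<in>nodes (B - b). F b p)"
    have "nodes B \<subseteq> U"
    proof
      fix q assume "q \<in> nodes B"
      then obtain n z where q: "q = (n, node n z)" "z \<in> T" "cost n z = B" by (auto simp: nodes_def)
      then obtain n' where n: "n = Suc n'" using False by (cases n) (auto simp: cost_def)
      define b where "b = L n' (node n' z) z"
      have b: "b \<ge> 1" using L_pos[OF good node_subset node_self, of z n'] q by (simp add: b_def)
      have c: "cost n' z + b = B" using q by (simp add: n cost_def b_def)
      have "(n', node n' z) \<in> nodes (B - b)" using c q by (auto simp: nodes_def)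
      moreover have "q \<in> F b (n', node n' z)"
        unfolding q n F_def b_def using node_self[OF q(2), of n'] by auto
      moreover have "b \<in> {1..B}" using b c by simp
      ultimately show "q \<in> U" unfolding U_def by blast
    qed
    moreover have finU: "finite U" 
      unfolding U_def
    proof (intro finite_UN_I)
      fix b p assume "b \<in> {1..B}"
      then show "finite (nodes (B - b))" using less[of "B - b"] False by simp
    qed (use FF in auto)
    moreover have "card U \<le> 4 ^ B"
    proof -
      have "card U \<le> (\<Sum>b\<in>{1..B}. card (\<Union>p\<in>nodes (B - b). F b p))"
        unfolding U_def by (rule card_UN_le) auto
      also have "\<dots> \<le> (\<Sum>b\<in>{1..B}. 4 ^ (B - b) * 2 ^ b)"
      proof (rule sum_mono)
        fix b assume b: "b \<in> {1..B}"
        have nd: "finite (nodes (B - b)) \<and> card (nodes (B - b)) \<le> 4 ^ (B - b)"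
          using less[of "B - b"] b False by simp
        have "card (\<Union>p\<in>nodes (B - b). F b p) \<le> (\<Sum>p\<in>nodes (B - b). card (F b p))"
          by (rule card_UN_le) (use nd in auto)
        also have "\<dots> \<le> (\<Sum>p\<in>nodes (B - b). 2 ^ b)" by (rule sum_mono) (use FF in auto)
        also have "\<dots> \<le> 4 ^ (B - b) * 2 ^ b" using nd by simp
        finally show "card (\<Union>p\<in>nodes (B - b). F b p) \<le> 4 ^ (B - b) * 2 ^ b" .
      qed
      also have "\<dots> = (\<Sum>b\<in>{1..B}. 2 ^ B * 2 ^ (B - b))"
      proof (rule sum.cong)
        fix b assume "b \<in> {1..B}"
        then have "(2::nat) ^ B = 2 ^ (B - b) * 2 ^ b" by (simp flip: power_add)
        moreover have "(4::nat) ^ (B - b) = 2 ^ (B - b) * 2 ^ (B - b)" by (simp flip: power_mult_distrib)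
        ultimately show "(4::nat) ^ (B - b) * 2 ^ b = 2 ^ B * 2 ^ (B - b)" by simp
      qed simp
      also have "\<dots> = 2 ^ B * (\<Sum>b<B. 2 ^ b)"
        unfolding sum_distrib_left
        by (rule sum.reindex_bij_witness[where i = "\<lambda>b. B - b" and j = "\<lambda>b. B - b"]) auto
      also have "\<dots> \<le> 2 ^ B * 2 ^ B"
        using sum_power2[of B] by (simp add: lessThan_atLeast0)
      also have "\<dots> = 4 ^ B" by (simp flip: power_mult_distrib)
      finally show ?thesis .
    qed
    ultimately show ?thesis using card_mono finite_subset by (meson order_trans)
  qed
qed

text \<open>There are at most \<open>4\<^sup>B\<close> nodes of cost \<open>B\<close>, so that the budget \<open>2\<^sup>k / 4\<close> allows fewer than
  \<open>2\<close> to the power \<open>2\<^sup>k\<close> of them; rounding it down makes the first partition trivial.\<close>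

definition depth :: "nat \<Rightarrow> 'a \<Rightarrow> nat" where
  "depth k z = Max {n. cost n z \<le> 2 ^ k div 4}"

lemma depth_iff:
  assumes "z \<in> T"
  shows "n \<le> depth k z \<longleftrightarrow> cost n z \<le> 2 ^ k div 4"
proof -
  let ?S = "{n. cost n z \<le> 2 ^ k div 4}"
  have f: "finite ?S"
    by (rule finite_subset[of _ "{..2 ^ k div 4}"]) (use cost_ge[OF assms] order_trans in auto)
  moreover have "0 \<in> ?S" by (simp add: cost_def)
  ultimately have "Max ?S \<in> ?S" by (intro Max_in) auto
  moreover have "n \<le> Max ?S" if "n \<in> ?S" using f that by simp
  ultimately show ?thesis
    using cost_mono[of n "Max ?S" z] unfolding depth_def by auto
qed

text \<open>Points of one node can stop at different depths, because their next codewords have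
  different lengths. The condition on the depth separates them and makes the parts disjoint.\<close>

definition part :: "nat \<Rightarrow> 'a \<Rightarrow> 'a set" where
  "part k z = {y\<in>node (depth k z) z. depth k y = depth k z}"

lemma part_self: "z \<in> T \<Longrightarrow> z \<in> part k z"
  by (simp add: part_def node_self)

lemma part_eq: "y \<in> part k z \<Longrightarrow> part k y = part k z"
  using node_eq by (auto simp: part_def)

lemma part_subset: "part k z \<subseteq> T"
  using node_subset by (auto simp: part_def)

lemma depth_mono: "z \<in> T \<Longrightarrow> depth k z \<le> depth (Suc k) z"
proof -
  assume z: "z \<in> T"
  have "(2::nat) ^ k div 4 \<le> 2 ^ Suc k div 4" by (rule div_le_mono) simp
  then show ?thesis using depth_iff[OF z, of "depth k z" k] depth_iff[OF z, of "depth k z" "Suc k"] by simp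
qed

text \<open>Points of a common node have equal costs at all levels above it, and these costs already
  determine the depth reached with the smaller budget.\<close>

lemma part_Suc: 
  assumes z: "z \<in> T"
  shows "part (Suc k) z \<subseteq> part k z"
proof
  fix y assume y: "y \<in> part (Suc k) z"
  have yT: "y \<in> T" using y part_subset by auto
  have yn: "y \<in> node (depth (Suc k) z) z" and d: "depth (Suc k) y = depth (Suc k) z"
    using y by (auto simp: part_def)
  have "n \<le> depth k y \<longleftrightarrow> n \<le> depth k z" for n
  proof (cases "n \<le> depth (Suc k) z")
    case True
    then show ?thesis using cost_eq[OF yn] depth_iff[OF z] depth_iff[OF yT] by simp
  next
    case False
    then show ?thesis using depth_mono[OF z, of k] depth_mono[OF yT, of k] d by auto
  qed
  then have "depth k y = depth k z" by (meson le_antisym order_refl)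
  then show "y \<in> part k z" using yn node_antimono[OF depth_mono[OF z]] by (auto simp: part_def)
qed

lemma partition_part: "partition_on T (part k ` T)"
proof (rule partition_onI)
  show "\<Union> (part k ` T) = T" using part_self part_subset by blast
next
  fix p q assume "p \<in> part k ` T" "q \<in> part k ` T" "p \<noteq> q"
  then show "disjnt p q" unfolding disjnt_def using part_eq by blast
next
  show "{} \<notin> part k ` T" using part_self by blast
qed

lemma admissible_part: "admissible T (\<lambda>k. part k ` T)"
  unfolding admissible_def
proof (intro conjI allI)
  have "depth 0 z = 0" if "z \<in> T" for z
    using depth_iff[OF that, of "depth 0 z" 0] cost_ge[OF that, of "depth 0 z"] by simp
  then have "part 0 z = T" if "z \<in> T" for z using that by (auto simp: part_def)
  then show "part 0 ` T = {T}" using nonempty by auto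
next
  fix k
  show "partition_on T (part k ` T)" by (rule partition_part)
  define B :: nat where "B = 2 ^ k div 4"
  have sub: "part k ` T \<subseteq> (\<lambda>(n, A). {y\<in>A. depth k y = n}) ` (\<Union>b\<in>{..B}. nodes b)"
  proof
    fix S assume "S \<in> part k ` T"
    then obtain z where z: "z \<in> T" "S = part k z" by auto
    have "(depth k z, node (depth k z) z) \<in> (\<Union>b\<in>{..B}. nodes b)"
      using z(1) depth_iff[OF z(1), of "depth k z" k] by (auto simp: nodes_def B_def)
    then show "S \<in> (\<lambda>(n, A). {y\<in>A. depth k y = n}) ` (\<Union>b\<in>{..B}. nodes b)"
      unfolding z(2) part_def by (rule rev_image_eqI) simp
  qed
  have f: "finite (\<Union>b\<in>{..B}. nodes b)" using nodes_count by auto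
  show "finite (part k ` T)" using sub f finite_subset by blast
  have "card (part k ` T) \<le> card (\<Union>b\<in>{..B}. nodes b)"
    using sub f by (meson card_image_le card_mono finite_imageI order_trans)
  also have "\<dots> \<le> (\<Sum>b\<in>{..B}. card (nodes b))" by (rule card_UN_le) simp
  also have "\<dots> \<le> (\<Sum>b\<in>{..B}. 4 ^ b)" by (rule sum_mono) (use nodes_count in auto)
  also have "\<dots> \<le> 2 ^ 2 ^ k"
  proof (cases "B = 0")
    case True then show ?thesis by simp
  next
    case False
    have "(\<Sum>b\<in>{..B}. (4::nat) ^ b) \<le> 2 ^ (2 * B + 1)" for B
      by (induction B) (auto simp: power_add power_mult)
    also have "2 * (p div 4) + 1 \<le> p" if "p div 4 \<noteq> 0" for p :: nat using that by linarith
    then have "(2::nat) ^ (2 * B + 1) \<le> 2 ^ 2 ^ k" using False unfolding B_def by (intro power_increasing) auto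
    finally show ?thesis .
  qed
  finally show "card (part k ` T) \<le> 2 ^ 2 ^ k" .
  show "refines T (part (Suc k) ` T) (part k ` T)"
    unfolding refines_def using partition_part part_Suc by (auto intro!: bexI)
qed

lemma cell_part: "z \<in> T \<Longrightarrow> cell (part k ` T) z = part k z"
  unfolding cell_def by (rule the_equality) (use part_self part_eq in auto)

text \<open>If k has depth n then 2^k < 4 * cost (n+1), since otherwise the budget would reach one
  level further; so the 2^k with this depth add up to at most 8 * cost (n+1). Exchanging the sums
  charges a bit spent at level l with the sum of 8 / 4^n over n >= l, which is (32/3) / 4^l, and
  32/3 <= 11.\<close>

lemma chain_sum:
  assumes z: "z \<in> T" and B: "\<And>N. (\<Sum>l<N. real (L l (node l z) z) / 4 ^ l) \<le> B"
  shows "(\<Sum>k<K. 2 ^ k / 4 ^ depth k z) \<le> 11 * B"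
proof -
  define M where "M = Suc (Max (insert 0 ((\<lambda>k. depth k z) ` {..<K})))"
  have M: "depth k z < M" if "k < K" for k using that by (simp add: M_def less_Suc_eq_le)
  define c where "c = (\<lambda>l. real (L l (node l z) z))"
  define S where "S = (\<lambda>n. sum c {..<n})"
  have S0: "S n \<ge> 0" for n by (simp add: S_def c_def sum_nonneg)
  have "(\<Sum>k<K. (2::real) ^ k / 4 ^ depth k z) = (\<Sum>n<M. \<Sum>k | k \<in> {..<K} \<and> depth k z = n. 2 ^ k / 4 ^ depth k z)"
    by (rule sum.group[symmetric]) (use M in auto)
  also have "\<dots> \<le> (\<Sum>n<M. (\<Sum>l<Suc n. 8 * c l) / 4 ^ n)"
  proof (rule sum_mono)
    fix n assume "n \<in> {..<M}"
    have "(\<Sum>k | k \<in> {..<K} \<and> depth k z = n. 2 ^ k / 4 ^ depth k z) = (\<Sum>k | k \<in> {..<K} \<and> depth k z = n. (2::real) ^ k) / 4 ^ n"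
      by (simp add: sum_divide_distrib)
    also have "(\<Sum>k | k \<in> {..<K} \<and> depth k z = n. (2::real) ^ k) \<le> 2 * (4 * real (cost (Suc n) z))"
    proof (rule sum_two_powers_le)
      fix k assume "k \<in> {k. k \<in> {..<K} \<and> depth k z = n}"
      then have "\<not> cost (Suc n) z \<le> 2 ^ k div 4" using depth_iff[OF z, of "Suc n" k] by auto
      then have "2 ^ k < 4 * cost (Suc n) z" by linarith
      then have "real (2 ^ k) < real (4 * cost (Suc n) z)" by (rule of_nat_less_iff[THEN iffD2])
      then show "2 ^ k < 4 * real (cost (Suc n) z)" by simp
    qed auto
    also have "2 * (4 * real (cost (Suc n) z)) = (\<Sum>l<Suc n. 8 * c l)"
      by (simp add: cost_def c_def flip: sum_distrib_left)
    finally show "(\<Sum>k | k \<in> {..<K} \<and> depth k z = n. (2::real) ^ k / 4 ^ depth k z) \<le> (\<Sum>l<Suc n. 8 * c l) / 4 ^ n"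
      by (simp add: divide_right_mono)
  qed
  also have "\<dots> = (\<Sum>n<M. 8 * S (Suc n) / 4 ^ n)" by (simp add: S_def flip: sum_distrib_left)
  \<comment> \<open>Summation by parts in closed form; the boundary term at M has a favourable sign
    and is dropped.\<close>
  also have "\<dots> = 8 * (4/3) * (\<Sum>l<M. c l / 4 ^ l) - 8 * (4/3) * S M / 4 ^ M"
  proof (induction M)
    case 0 show ?case by (simp add: S_def)
  next
    case (Suc M)
    have "S (Suc M) = S M + c M" by (simp add: S_def)
    then show ?case unfolding sum.lessThan_Suc Suc.IH by (simp add: field_simps)
  qed
  also have "\<dots> \<le> 8 * (4/3) * (\<Sum>l<M. c l / 4 ^ l)" using S0[of M] by simp
  also have "\<dots> \<le> 8 * (4/3) * B" using B[of M] by (simp add: c_def)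
  also have "\<dots> \<le> 11 * B" using B[of 0] by simp
  finally show ?thesis .
qed

lemma gamma22_le:
  assumes B: "\<And>z N. z \<in> T \<Longrightarrow> (\<Sum>l<N. real (L l (node l z) z) / 4 ^ l) \<le> B"
    and d: "\<And>n A x y. \<lbrakk>G n A; A \<subseteq> T; x \<in> A; y \<in> A\<rbrakk> \<Longrightarrow> d x y \<le> r / 2 ^ n"
    and r: "0 \<le> r"
  shows "gamma22 T d \<le> ennreal (r * sqrt (11 * B))"
proof -
  have B0: "0 \<le> B" using B[of _ 0] nonempty by auto
  have "gamma22 T d \<le> (SUP x\<in>T. esqrt (\<Sum>k. 2 ^ k * (ediam d (cell (part k ` T) x))\<^sup>2))"
    unfolding gamma22_def by (rule INF_lower) (simp add: admissible_part)
  also have "\<dots> \<le> ennreal (r * sqrt (11 * B))"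
  proof (rule SUP_least)
    fix z assume z: "z \<in> T"
    have "2 ^ k * (ediam d (cell (part k ` T) z))\<^sup>2 \<le> ennreal (r\<^sup>2 * (2 ^ k / 4 ^ depth k z))" for k
    proof -
      have "ediam d (part k z) \<le> ennreal (r / 2 ^ depth k z)"
        unfolding ediam_def
        by (intro SUP_least ennreal_leI d[OF good[OF z] node_subset]) (auto simp: part_def)
      then have "(ediam d (part k z))\<^sup>2 \<le> (ennreal (r / 2 ^ depth k z))\<^sup>2"
        by (rule power_mono) simp
      also have "\<dots> = ennreal ((r / 2 ^ depth k z)\<^sup>2)" using r by (simp add: ennreal_power)
      also have "(r / 2 ^ depth k z)\<^sup>2 = r\<^sup>2 / 4 ^ depth k z"
        by (simp add: power_divide power_mult[symmetric] mult.commute[of _ 2]) (simp add: power_mult)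
      finally have "2 ^ k * (ediam d (part k z))\<^sup>2 \<le> ennreal (2 ^ k) * ennreal (r\<^sup>2 / 4 ^ depth k z)"
        by (intro mult_mono) (auto simp flip: ennreal_power)
      also have "\<dots> = ennreal (2 ^ k * (r\<^sup>2 / 4 ^ depth k z))" by (rule ennreal_mult[symmetric]) auto
      finally show ?thesis using z by (simp add: cell_part mult.commute)
    qed
    then have "(\<Sum>k. 2 ^ k * (ediam d (cell (part k ` T) z))\<^sup>2) \<le> (\<Sum>k. ennreal (r\<^sup>2 * (2 ^ k / 4 ^ depth k z)))"
      by (intro suminf_le) auto
    also have "\<dots> = (SUP K. \<Sum>k<K. ennreal (r\<^sup>2 * (2 ^ k / 4 ^ depth k z)))"
      by (rule suminf_eq_SUP)
    also have "\<dots> \<le> ennreal (r\<^sup>2 * (11 * B))"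
    proof (rule SUP_least)
      fix K
      have "(\<Sum>k<K. ennreal (r\<^sup>2 * (2 ^ k / 4 ^ depth k z))) = ennreal (r\<^sup>2 * (\<Sum>k<K. 2 ^ k / 4 ^ depth k z))"
        by (simp add: sum_ennreal sum_distrib_left)
      also have "\<dots> \<le> ennreal (r\<^sup>2 * (11 * B))"
        by (intro ennreal_leI mult_left_mono chain_sum z B) auto
      finally show "(\<Sum>k<K. ennreal (r\<^sup>2 * (2 ^ k / 4 ^ depth k z))) \<le> ennreal (r\<^sup>2 * (11 * B))" .
    qed
    finally have *: "(\<Sum>k. 2 ^ k * (ediam d (cell (part k ` T) z))\<^sup>2) \<le> ennreal (r\<^sup>2 * (11 * B))" .
    then have "enn2real (\<Sum>k. 2 ^ k * (ediam d (cell (part k ` T) z))\<^sup>2) \<le> r\<^sup>2 * (11 * B)"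
      using B0 by (intro enn2real_leI) auto
    then have "sqrt (enn2real (\<Sum>k. 2 ^ k * (ediam d (cell (part k ` T) z))\<^sup>2)) \<le> r * sqrt (11 * B)"
      using r by (metis real_sqrt_abs abs_of_nonneg real_sqrt_le_mono real_sqrt_mult)
    moreover have "(\<Sum>k. 2 ^ k * (ediam d (cell (part k ` T) z))\<^sup>2) \<noteq> \<infinity>"
      using * by (auto simp: top_unique)
    ultimately show "esqrt (\<Sum>k. 2 ^ k * (ediam d (cell (part k ` T) z))\<^sup>2) \<le> ennreal (r * sqrt (11 * B))"
      unfolding esqrt_def by (auto intro: ennreal_leI)
  qed
  finally show ?thesis .
qed

end

lemma gamma22_le_split_code:
  assumes ne: "T \<noteq> {}" and r: "0 \<le> r"
    and R0: "\<And>x y. x \<in> T \<Longrightarrow> y \<in> T \<Longrightarrow> R 0 x y"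
    and step: "\<And>n A. \<lbrakk>A \<subseteq> T; \<forall>x\<in>A. \<forall>y\<in>A. R n x y\<rbrakk> \<Longrightarrow> split_code A (R (Suc n)) (bnd n)"
    and d: "\<And>n x y. \<lbrakk>x \<in> T; y \<in> T; R n x y\<rbrakk> \<Longrightarrow> d x y \<le> r / 2 ^ n"
    and B: "\<And>z N. z \<in> T \<Longrightarrow> (\<Sum>l<N. bnd l z / 4 ^ l) \<le> B"
  shows "gamma22 T d \<le> ennreal (r * sqrt (11 * B))"
proof -
  define G where "G = (\<lambda>n A. \<forall>x\<in>A. \<forall>y\<in>A. R n x y)"
  define L where "L = (\<lambda>n A. fst (SOME p. is_code A (R (Suc n)) (bnd n) (fst p) (snd p)))"
  define lab where "lab = (\<lambda>n A. snd (SOME p. is_code A (R (Suc n)) (bnd n) (fst p) (snd p)))"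
  have *: "is_code A (R (Suc n)) (bnd n) (L n A) (lab n A)" if "A \<subseteq> T" "G n A" for n A
  proof -
    have "split_code A (R (Suc n)) (bnd n)" using step that by (simp add: G_def)
    then have "\<exists>p. is_code A (R (Suc n)) (bnd n) (fst p) (snd p)" unfolding split_code_def by simp
    from someI_ex[OF this] show ?thesis by (simp add: L_def lab_def)
  qed
  interpret code_tree T G L lab
  proof
    show "T \<noteq> {}" "G 0 T" using ne R0 by (auto simp: G_def)
  next
    fix n A z b assume A: "G n A" "A \<subseteq> T"
    note Q = is_codeD[OF *[OF A(2,1)]]
    show "finite (lab n A ` {z\<in>A. L n A z = b})" "card (lab n A ` {z\<in>A. L n A z = b}) \<le> 2 ^ b"
      by (rule Q)+
    assume z: "z \<in> A"
    show "1 \<le> L n A z" using Q z by simp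
    show "G (Suc n) {y\<in>A. L n A y = L n A z \<and> lab n A y = lab n A z}"
      using Q(5) by (simp add: G_def)
  qed
  show ?thesis
  proof (rule gamma22_le)
    fix z N assume z: "z \<in> T"
    have "(\<Sum>l<N. real (L l (node l z) z) / 4 ^ l) \<le> (\<Sum>l<N. bnd l z / 4 ^ l)"
      using *[OF node_subset good[OF z]] node_self[OF z] by (intro sum_mono divide_right_mono is_codeD(2)) auto 
    then show "(\<Sum>l<N. real (L l (node l z) z) / 4 ^ l) \<le> B" using B[OF z, of N] by linarith
  qed (use d r in \<open>auto simp: G_def subset_iff\<close>)
qed

section \<open>Gaussian measures\<close>

abbreviation std :: "real measure" where "std \<equiv> std_normal_distribution"

lemma prob_space_std: "prob_space std"
  by (rule prob_space_normal_density) simp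

lemma prob_space_gauss: "prob_space (gauss I)"
  unfolding gauss_def by (intro prob_space_PiM prob_space_std)

lemma sets_gauss [measurable_cong]: "sets (gauss I) = sets (Pi\<^sub>M I (\<lambda>_. borel))"
  unfolding gauss_def by (intro sets_PiM_cong) auto

lemma space_gauss: "space (gauss I) = I \<rightarrow>\<^sub>E UNIV"
  unfolding gauss_def by (simp add: space_PiM)

interpretation std_prod: product_sigma_finite "\<lambda>_::'i. std"
  unfolding product_sigma_finite_def using prob_space_std prob_space_imp_sigma_finite by blast

lemma nn_integral_gauss_prod:
  assumes "finite I" "\<And>i. i \<in> I \<Longrightarrow> f i \<in> borel_measurable borel"
  shows "(\<integral>\<^sup>+g. (\<Prod>i\<in>I. f i (g i)) \<partial>gauss I) = (\<Prod>i\<in>I. \<integral>\<^sup>+x. f i x \<partial>std)"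
  unfolding gauss_def by (rule std_prod.product_nn_integral_prod) (use assms in auto)

lemma nn_integral_gauss_component:
  assumes "finite I" "i \<in> I" and [measurable]: "f \<in> borel_measurable borel"
  shows "(\<integral>\<^sup>+g. f (g i) \<partial>gauss I) = (\<integral>\<^sup>+x. f x \<partial>std)"
proof -
  have "(\<integral>\<^sup>+g. f (g i) \<partial>gauss I) = (\<integral>\<^sup>+g. (\<Prod>j\<in>I. (if j = i then f else (\<lambda>_. 1)) (g j)) \<partial>gauss I)"
    using assms by (intro nn_integral_cong) (simp add: if_distrib[of "\<lambda>h. h _"] cong: if_cong)
  also have "\<dots> = (\<Prod>j\<in>I. \<integral>\<^sup>+x. (if j = i then f else (\<lambda>_. 1)) x \<partial>std)"
    by (rule nn_integral_gauss_prod) (use assms in auto)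
  also have "\<dots> = (\<Prod>j\<in>I. if j = i then \<integral>\<^sup>+x. f x \<partial>std else 1)"
    by (intro prod.cong) (auto simp: prob_space.emeasure_space_1[OF prob_space_std, simplified])
  also have "\<dots> = (\<integral>\<^sup>+x. f x \<partial>std)" using assms by simp
  finally show ?thesis .
qed

lemma borel_PiM_std: "borel_measurable (Pi\<^sub>M J (\<lambda>_. std)) = borel_measurable (Pi\<^sub>M J (\<lambda>_. borel))"
  by (intro measurable_cong_sets sets_PiM_cong) auto

text \<open>A one-dimensional change of variables passes to the product by Fubini, one coordinate at
  a time. It is applied to translations, whose weight is the Cameron-Martin density, and to the
  reflection at the origin.\<close>

lemma nn_integral_gauss_transform:
  fixes w :: "'i \<Rightarrow> real \<Rightarrow> ennreal"
  assumes "finite I"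
    and [measurable]: "\<And>i. T i \<in> borel_measurable borel" "\<And>i. w i \<in> borel_measurable borel"
    and 1: "\<And>i h. h \<in> borel_measurable borel \<Longrightarrow> (\<integral>\<^sup>+t. h (T i t) * w i t \<partial>std) = (\<integral>\<^sup>+t. h t \<partial>std)"
    and "f \<in> borel_measurable (Pi\<^sub>M I (\<lambda>_. borel))"
  shows "(\<integral>\<^sup>+g. f (\<lambda>i\<in>I. T i (g i)) * (\<Prod>i\<in>I. w i (g i)) \<partial>gauss I) = (\<integral>\<^sup>+g. f g \<partial>gauss I)"
  using assms(1,5)
proof (induction I arbitrary: f)
  case empty
  show ?case unfolding gauss_def by (simp add: PiM_empty nn_integral_count_space_finite)
next
  case (insert i I)
  note f [measurable] = insert.prems
  have sg: "sets (gauss I) = sets (Pi\<^sub>M I (\<lambda>_. borel))" by (rule sets_gauss)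
  let ?h = "\<lambda>x. \<integral>\<^sup>+t. f (x(i := t)) \<partial>std"
  have m1: "(\<lambda>(x, t). f (x(i := t))) \<in> borel_measurable (Pi\<^sub>M I (\<lambda>_. borel) \<Otimes>\<^sub>M borel)"
    by measurable
  have m2: "(\<lambda>t. f (x(i := t))) \<in> borel_measurable borel" if "x \<in> I \<rightarrow>\<^sub>E UNIV" for x
    using measurable_Pair2[OF m1, of x] that by (simp add: space_PiM)
  have h [measurable]: "?h \<in> borel_measurable (Pi\<^sub>M I (\<lambda>_. borel))"
    using sigma_finite_measure.borel_measurable_nn_integral[OF prob_space_imp_sigma_finite[OF prob_space_std], of "\<lambda>x t. f (x(i := t))" "Pi\<^sub>M I (\<lambda>_. borel)"]
      m1 by (simp add: measurable_cong_sets[OF sets_pair_measure_cong[OF refl, of std borel] refl])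
  have F: "(\<lambda>g. f (\<lambda>k\<in>insert i I. T k (g k)) * (\<Prod>k\<in>insert i I. w k (g k)))
      \<in> borel_measurable (Pi\<^sub>M (insert i I) (\<lambda>_. std))"
  proof -
    have "(\<lambda>g. f (\<lambda>k\<in>insert i I. T k (g k)) * (\<Prod>k\<in>insert i I. w k (g k)))
      \<in> borel_measurable (Pi\<^sub>M (insert i I) (\<lambda>_. borel))"
      by measurable
    then show ?thesis by (simp only: borel_PiM_std)
  qed
  have "(\<integral>\<^sup>+g. f (\<lambda>k\<in>insert i I. T k (g k)) * (\<Prod>k\<in>insert i I. w k (g k)) \<partial>gauss (insert i I))
      = (\<integral>\<^sup>+x. \<integral>\<^sup>+t. f (\<lambda>k\<in>insert i I. T k ((x(i := t)) k)) * (\<Prod>k\<in>insert i I. w k ((x(i := t)) k)) \<partial>std \<partial>gauss I)"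
    unfolding gauss_def by (rule std_prod.product_nn_integral_insert) (use insert F in auto)
  also have "\<dots> = (\<integral>\<^sup>+x. ?h (\<lambda>k\<in>I. T k (x k)) * (\<Prod>k\<in>I. w k (x k)) \<partial>gauss I)"
  proof (rule nn_integral_cong)
    fix x assume x: "x \<in> space (gauss I)"
    let ?x = "\<lambda>k\<in>I. T k (x k)"
    have x': "?x \<in> I \<rightarrow>\<^sub>E UNIV" by auto
    have e1: "(\<lambda>k\<in>insert i I. T k ((x(i := t)) k)) = ?x(i := T i t)" for t
      using insert.hyps by (auto simp: fun_eq_iff restrict_def)
    have e2: "(\<Prod>k\<in>insert i I. w k ((x(i := t)) k)) = w i t * (\<Prod>k\<in>I. w k (x k))" for t
    proof -
      have "(\<Prod>k\<in>I. w k ((x(i := t)) k)) = (\<Prod>k\<in>I. w k (x k))"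
        by (rule prod.cong) (use insert.hyps in auto)
      then show ?thesis unfolding prod.insert[OF insert.hyps] by simp
    qed
    have "(\<integral>\<^sup>+t. f (\<lambda>k\<in>insert i I. T k ((x(i := t)) k)) * (\<Prod>k\<in>insert i I. w k ((x(i := t)) k)) \<partial>std)
       = (\<integral>\<^sup>+t. f (?x(i := T i t)) * w i t * (\<Prod>k\<in>I. w k (x k)) \<partial>std)"
      unfolding e1 e2 by (simp add: mult.assoc)
    also have "\<dots> = (\<integral>\<^sup>+t. f (?x(i := T i t)) * w i t \<partial>std) * (\<Prod>k\<in>I. w k (x k))"
      by (rule nn_integral_multc) (use borel_measurable_times_ennreal[OF measurable_compose[OF assms(2)[of i] m2[OF x']] assms(3)[of i]] in simp)
    also have "(\<integral>\<^sup>+t. f (?x(i := T i t)) * w i t \<partial>std) = ?h ?x"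
      by (rule 1) (rule m2[OF x'])
    finally show "(\<integral>\<^sup>+t. f (\<lambda>k\<in>insert i I. T k ((x(i := t)) k)) * (\<Prod>k\<in>insert i I. w k ((x(i := t)) k)) \<partial>std)
      = ?h ?x * (\<Prod>k\<in>I. w k (x k))" .
  qed
  also have "\<dots> = (\<integral>\<^sup>+x. ?h x \<partial>gauss I)" by (rule insert.IH[OF h])
  also have "\<dots> = (\<integral>\<^sup>+g. f g \<partial>gauss (insert i I))"
    unfolding gauss_def
    by (rule std_prod.product_nn_integral_insert[symmetric])
       (use insert.hyps insert.prems borel_PiM_std[of "insert i I"] in simp_all)
  finally show ?case .
qed

section \<open>Translates of symmetric sets under the Gaussian measure\<close>

lemma nn_integral_std: "f \<in> borel_measurable borel \<Longrightarrow>
   (\<integral>\<^sup>+t. f t \<partial>std) = (\<integral>\<^sup>+t. ennreal (std_normal_density t) * f t \<partial>lborel)"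
  by (subst nn_integral_density) auto

lemma std_shift:
  assumes [measurable]: "h \<in> borel_measurable borel"
  shows "(\<integral>\<^sup>+t. h (t + y) * ennreal (exp (- (t * y) - y\<^sup>2 / 2)) \<partial>std) = (\<integral>\<^sup>+t. h t \<partial>std)"
proof -
  have *: "std_normal_density t * exp (- (t * y) - y\<^sup>2 / 2) = std_normal_density (y + t)" for t
    by (simp add: std_normal_density_def power2_sum field_simps flip: exp_add)
  have **: "ennreal (std_normal_density t) * (h (t + y) * ennreal (exp (- (t * y) - y\<^sup>2 / 2)))
      = ennreal (std_normal_density (y + 1 * t)) * h (y + 1 * t)" for t
  proof -
    have "ennreal (std_normal_density (y + 1 * t)) = ennreal (std_normal_density t) * ennreal (exp (- (t * y) - y\<^sup>2 / 2))"
      by (simp only: mult_1 *[symmetric]) (rule ennreal_mult, auto)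
    then show ?thesis by (simp add: add.commute[of t y] mult.left_commute mult.commute)
  qed
  have "(\<integral>\<^sup>+t. h (t + y) * ennreal (exp (- (t * y) - y\<^sup>2 / 2)) \<partial>std)
      = (\<integral>\<^sup>+t. ennreal (std_normal_density (y + 1 * t)) * h (y + 1 * t) \<partial>lborel)"
    by (subst nn_integral_std, measurable) (simp only: **)
  also have "\<dots> = (\<integral>\<^sup>+t. ennreal (std_normal_density t) * h t \<partial>lborel)"
    using nn_integral_real_affine[of "\<lambda>t. ennreal (std_normal_density t) * h t" 1 y] by simp
  also have "\<dots> = (\<integral>\<^sup>+t. h t \<partial>std)" by (rule nn_integral_std[symmetric]) simp
  finally show ?thesis .
qed

text \<open>The trivial weight 1 is written out to match the hypothesis of
  \<open>nn_integral_gauss_transform\<close>.\<close>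

lemma std_reflect:
  assumes [measurable]: "h \<in> borel_measurable borel"
  shows "(\<integral>\<^sup>+t. h (- t) * 1 \<partial>std) = (\<integral>\<^sup>+t. h t \<partial>std)"
proof -
  have *: "std_normal_density (- t) = std_normal_density t" for t
    by (simp add: std_normal_density_def)
  have "(\<integral>\<^sup>+t. h (- t) * 1 \<partial>std) = (\<integral>\<^sup>+t. ennreal (std_normal_density (0 + (-1) * t)) * h (0 + (-1) * t) \<partial>lborel)"
    by (subst nn_integral_std) (auto simp: *)
  also have "\<dots> = (\<integral>\<^sup>+t. ennreal (std_normal_density t) * h t \<partial>lborel)"
    using nn_integral_real_affine[of "\<lambda>t. ennreal (std_normal_density t) * h t" "-1" 0] by simp
  also have "\<dots> = (\<integral>\<^sup>+t. h t \<partial>std)" by (rule nn_integral_std[symmetric]) simp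
  finally show ?thesis .
qed

text \<open>The mass of B + y is the integral over B of exp(-<g,y> - |y|^2/2). By symmetry of B the
  sign of y may be changed; adding the two expressions gives 2 cosh(<g,y>) * exp(-|y|^2/2), and cosh
  >= 1.\<close>

lemma gauss_shift_lower:
  assumes I: "finite I" and B [measurable]: "B \<in> sets (gauss I)"
    and sym: "\<And>g. g \<in> B \<Longrightarrow> (\<lambda>i\<in>I. - g i) \<in> B"
    and y: "(\<Sum>i\<in>I. (y i)\<^sup>2) \<le> c"
  shows "emeasure (gauss I) {g \<in> space (gauss I). (\<lambda>i\<in>I. g i - y i) \<in> B} \<ge> ennreal (exp (- c / 2)) * emeasure (gauss I) B"
proof -
  have B' [measurable]: "B \<in> sets (Pi\<^sub>M I (\<lambda>_. borel))" using B by (simp add: sets_gauss)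
  define e where "e = (\<lambda>z (g :: _ \<Rightarrow> real). ennreal (exp (- (\<Sum>i\<in>I. g i * z i) - (\<Sum>i\<in>I. (z i)\<^sup>2) / 2)))"
  have ew: "e z g = (\<Prod>i\<in>I. ennreal (exp (- (g i * z i) - (z i)\<^sup>2 / 2)))" for z g
  proof -
    have "e z g = ennreal (exp (\<Sum>i\<in>I. - (g i * z i) - (z i)\<^sup>2 / 2))"
      unfolding e_def by (simp add: sum_subtractf sum_negf sum_divide_distrib)
    then show ?thesis using I by (simp add: exp_sum prod_ennreal)
  qed
  have e_meas [measurable]: "e z \<in> borel_measurable (Pi\<^sub>M I (\<lambda>_. borel))" for z
    unfolding e_def by measurable
  let ?S = "{g \<in> space (gauss I). (\<lambda>i\<in>I. g i - y i) \<in> B}"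
  have msh: "(\<lambda>g. \<lambda>i\<in>I. g i - y i) \<in> measurable (Pi\<^sub>M I (\<lambda>_. borel)) (Pi\<^sub>M I (\<lambda>_. borel))"
    by measurable
  have S: "?S \<in> sets (gauss I)"
    using measurable_sets[OF msh B'] by (simp add: sets_gauss space_gauss space_PiM vimage_def Int_def conj_commute)
  have mS: "(\<lambda>g. indicator B (\<lambda>i\<in>I. g i - y i) :: ennreal) \<in> borel_measurable (Pi\<^sub>M I (\<lambda>_. borel))"
    by (rule measurable_compose[OF msh]) measurable
  have "emeasure (gauss I) ?S = (\<integral>\<^sup>+g. indicator ?S g \<partial>gauss I)" using S by simp
  also have "\<dots> = (\<integral>\<^sup>+g. indicator B (\<lambda>i\<in>I. g i - y i) \<partial>gauss I)"
    by (intro nn_integral_cong) (auto simp: indicator_def)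
  also have "\<dots> = (\<integral>\<^sup>+g. indicator B (\<lambda>i\<in>I. (\<lambda>i\<in>I. g i + y i) i - y i) * e y g \<partial>gauss I)"
    unfolding ew
    by (rule nn_integral_gauss_transform[OF I _ _ _ mS, symmetric]) (auto simp: std_shift)
  also have "\<dots> = (\<integral>\<^sup>+g. indicator B g * e y g \<partial>gauss I)"
  proof (rule nn_integral_cong)
    fix g assume "g \<in> space (gauss I)"
    then have "(\<lambda>i\<in>I. (\<lambda>i\<in>I. g i + y i) i - y i) = g" by (auto simp: space_gauss fun_eq_iff PiE_def extensional_def)
    then show "indicator B (\<lambda>i\<in>I. (\<lambda>i\<in>I. g i + y i) i - y i) * e y g = indicator B g * e y g" by simp
  qed
  finally have m1: "emeasure (gauss I) ?S = (\<integral>\<^sup>+g. indicator B g * e y g \<partial>gauss I)" .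
  have "(\<integral>\<^sup>+g. indicator B g * e y g \<partial>gauss I)
      = (\<integral>\<^sup>+g. (indicator B (\<lambda>i\<in>I. - g i) * e y (\<lambda>i\<in>I. - g i)) * (\<Prod>i\<in>I. 1) \<partial>gauss I)"
    by (rule nn_integral_gauss_transform[OF I, symmetric]) (auto simp: std_reflect simp del: mult_1_right)
  also have "\<dots> = (\<integral>\<^sup>+g. indicator B g * e (\<lambda>i. - y i) g \<partial>gauss I)"
  proof (rule nn_integral_cong)
    fix g assume g: "g \<in> space (gauss I)"
    have "(\<lambda>i\<in>I. - (\<lambda>i\<in>I. - g i) i) = g" using g by (auto simp: space_gauss fun_eq_iff PiE_def extensional_def)
    then have "(\<lambda>i\<in>I. - g i) \<in> B \<longleftrightarrow> g \<in> B" using sym[of g] sym[of "\<lambda>i\<in>I. - g i"] by auto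
    moreover have "e y (\<lambda>i\<in>I. - g i) = e (\<lambda>i. - y i) g" unfolding e_def by (simp cong: sum.cong)
    ultimately show "(indicator B (\<lambda>i\<in>I. - g i) * e y (\<lambda>i\<in>I. - g i)) * (\<Prod>i\<in>I. 1) = indicator B g * e (\<lambda>i. - y i) g"
      by (simp add: indicator_def)
  qed
  finally have m2: "(\<integral>\<^sup>+g. indicator B g * e y g \<partial>gauss I) = (\<integral>\<^sup>+g. indicator B g * e (\<lambda>i. - y i) g \<partial>gauss I)" .
  have "2 * (ennreal (exp (- c / 2)) * emeasure (gauss I) B)
      = (\<integral>\<^sup>+g. ennreal (2 * exp (- c / 2)) * indicator B g \<partial>gauss I)"
    by (subst nn_integral_cmult_indicator) (auto simp: ennreal_mult mult.assoc)
  also have "\<dots> \<le> (\<integral>\<^sup>+g. indicator B g * e y g + indicator B g * e (\<lambda>i. - y i) g \<partial>gauss I)"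
  proof (rule nn_integral_mono)
    fix g
    define s where "s = (\<Sum>i\<in>I. g i * y i)"
    have "2 \<le> exp s + exp (- s)"
    proof -
      have "0 \<le> (exp (s / 2) - exp (- s / 2))\<^sup>2" by simp
      also have "\<dots> = exp s + exp (- s) - 2"
      proof -
        have "(exp (s / 2))\<^sup>2 = exp s" "(exp (- s / 2))\<^sup>2 = exp (- s)" "exp (s / 2) * exp (- s / 2) = 1"
          by (simp_all add: power2_eq_square flip: exp_add)
        then show ?thesis by (simp add: power2_diff)
      qed
      finally show ?thesis by simp
    qed
    then have "2 * exp (- c / 2) \<le> (exp s + exp (- s)) * exp (- (\<Sum>i\<in>I. (y i)\<^sup>2) / 2)"
      using y by (intro mult_mono) auto
    also have "\<dots> = exp (- s - (\<Sum>i\<in>I. (y i)\<^sup>2) / 2) + exp (s - (\<Sum>i\<in>I. (y i)\<^sup>2) / 2)"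
      by (simp add: distrib_right flip: exp_add)
    finally have "ennreal (2 * exp (- c / 2)) \<le> e y g + e (\<lambda>i. - y i) g"
      by (simp add: e_def s_def sum_negf ennreal_leI flip: ennreal_plus)
    then show "ennreal (2 * exp (- c / 2)) * indicator B g \<le> indicator B g * e y g + indicator B g * e (\<lambda>i. - y i) g"
      by (simp add: indicator_def)
  qed
  also have "\<dots> = (\<integral>\<^sup>+g. indicator B g * e y g \<partial>gauss I) + (\<integral>\<^sup>+g. indicator B g * e (\<lambda>i. - y i) g \<partial>gauss I)"
    by (intro nn_integral_add) auto
  also have "\<dots> = 2 * emeasure (gauss I) ?S" unfolding m1 m2[symmetric] by (simp add: mult_2)
  finally show ?thesis by (simp add: ennreal_mult_le_mult_iff)
qed

text \<open>The translates of B by the points of F are disjoint, each has mass at least exp(-c/2) /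
  2, and the total mass is 1.\<close>

lemma gauss_packing:
  assumes I: "finite I" and B [measurable]: "B \<in> sets (gauss I)"
    and sym: "\<And>g. g \<in> B \<Longrightarrow> (\<lambda>i\<in>I. - g i) \<in> B"
    and half: "emeasure (gauss I) B \<ge> ennreal (1 / 2)"
    and F: "finite F" "\<And>y. y \<in> F \<Longrightarrow> (\<Sum>i\<in>I. (y i)\<^sup>2) \<le> c"
    and disj: "\<And>y y' g g'. \<lbrakk>y \<in> F; y' \<in> F; y \<noteq> y'; g \<in> B; g' \<in> B\<rbrakk> \<Longrightarrow> \<exists>i\<in>I. g i + y i \<noteq> g' i + y' i"
  shows "real (card F) \<le> 2 * exp (c / 2)"
proof -
  interpret prob_space "gauss I" by (rule prob_space_gauss)
  define S where "S = (\<lambda>y. {g \<in> space (gauss I). (\<lambda>i\<in>I. g i - y i) \<in> B})"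
  have B' [measurable]: "B \<in> sets (Pi\<^sub>M I (\<lambda>_. borel))" using B by (simp add: sets_gauss)
  have msh: "(\<lambda>g. \<lambda>i\<in>I. g i - y i) \<in> measurable (Pi\<^sub>M I (\<lambda>_. borel)) (Pi\<^sub>M I (\<lambda>_. borel))" for y :: "_ \<Rightarrow> real"
    by measurable
  have S: "S y \<in> sets (gauss I)" for y
    unfolding S_def using measurable_sets[OF msh B', of y] by (simp add: sets_gauss space_gauss space_PiM vimage_def Int_def conj_commute)
  have dj: "disjoint_family_on S F"
    unfolding disjoint_family_on_def
  proof (intro ballI impI)
    fix y y' assume y: "y \<in> F" "y' \<in> F" "y \<noteq> y'"
    show "S y \<inter> S y' = {}"
    proof (rule ccontr)
      assume "S y \<inter> S y' \<noteq> {}"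
      then obtain g where "(\<lambda>i\<in>I. g i - y i) \<in> B" "(\<lambda>i\<in>I. g i - y' i) \<in> B" by (auto simp: S_def)
      from disj[OF y this] show False by auto
    qed
  qed
  have lb: "prob (S y) \<ge> exp (- c / 2) / 2" if "y \<in> F" for y
  proof -
    have "ennreal (exp (- c / 2) * (1 / 2)) = ennreal (exp (- c / 2)) * ennreal (1 / 2)"
      by (rule ennreal_mult) auto
    also have "\<dots> \<le> ennreal (exp (- c / 2)) * emeasure (gauss I) B" by (intro mult_left_mono half) simp
    also have "\<dots> \<le> emeasure (gauss I) (S y)"
      unfolding S_def using gauss_shift_lower[OF I B sym F(2)[OF that]] by simp
    also have "\<dots> = ennreal (prob (S y))" by (rule emeasure_eq_measure)
    finally show ?thesis by simp
  qed
  have "real (card F) * (exp (- c / 2) / 2) \<le> (\<Sum>y\<in>F. prob (S y))"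
    using sum_mono[OF lb, of F "\<lambda>y. y"] by simp
  also have "\<dots> = prob (\<Union>y\<in>F. S y)"
    by (rule finite_measure_finite_Union[symmetric]) (use F(1) S dj in auto)
  also have "\<dots> \<le> 1" by (rule prob_le_1)
  finally show ?thesis by (simp add: exp_minus field_simps)
qed

section \<open>Estimates for one Gaussian variable and for independent families\<close>

lemma emeasure_std: "A \<in> sets borel \<Longrightarrow> emeasure std A = (\<integral>\<^sup>+t. ennreal (std_normal_density t) * indicator A t \<partial>lborel)"
  by (simp add: emeasure_density)

lemma sqrt_two_pi_bounds: "2 \<le> sqrt (2 * pi)" "sqrt (2 * pi) \<le> 2.6"
proof -
  show "2 \<le> sqrt (2 * pi)" by (rule real_le_rsqrt) (use pi_gt3 in simp)
  show "sqrt (2 * pi) \<le> 2.6" by (rule real_le_lsqrt) (use pi_less_4 pi_approx in \<open>simp_all add: power2_eq_square\<close>)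
qed

text \<open>On the interval from a to a + 1 one has x^2 / 2 <= a^2 + 1, so the density is at least
  5/13 * exp(-a^2) / 3, and 5/39 >= 1/8. The loss of a factor 2 in the exponent is harmless
  later.\<close>

lemma std_tail_lower:
  assumes a: "0 \<le> a"
  shows "emeasure std {x. a \<le> \<bar>x\<bar>} \<ge> ennreal (exp (- a\<^sup>2) / 8)"
proof -
  have "ennreal (exp (- a\<^sup>2) / 8) * indicator {a..a + 1} x \<le> ennreal (std_normal_density x) * indicator {x. a \<le> \<bar>x\<bar>} x" for x
  proof (cases "x \<in> {a..a + 1}")
    case True
    have "x\<^sup>2 \<le> (a + 1)\<^sup>2" using True a by (intro power_mono) auto
    also have "\<dots> \<le> 2 * a\<^sup>2 + 2" using sum_squares_bound[of a 1] by (simp add: power2_sum)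
    finally have "exp (- a\<^sup>2 - 1) \<le> exp (- (x\<^sup>2 / 2))" by simp
    moreover have "exp (- a\<^sup>2) * (1 / 3) \<le> exp (- a\<^sup>2) * exp (- 1)"
    proof (intro mult_left_mono)
      have "exp (1::real) \<le> 3" by (rule exp_le)
      then show "1 / 3 \<le> exp (- 1 :: real)" by (simp add: exp_minus field_simps)
    qed simp
    moreover have "exp (- a\<^sup>2) * exp (- 1) = exp (- a\<^sup>2 - 1)" by (simp flip: exp_add)
    ultimately have "exp (- a\<^sup>2) / 3 \<le> exp (- (x\<^sup>2 / 2))" by linarith
    moreover have "5 / 13 \<le> 1 / sqrt (2 * pi)"
      using sqrt_two_pi_bounds by (simp add: field_simps)
    ultimately have "(5 / 13) * (exp (- a\<^sup>2) / 3) \<le> 1 / sqrt (2 * pi) * exp (- (x\<^sup>2 / 2))"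
      by (intro mult_mono) auto
    then have "exp (- a\<^sup>2) / 8 \<le> 1 / sqrt (2 * pi) * exp (- (x\<^sup>2 / 2))"
      using exp_gt_zero[of "- a\<^sup>2"] by linarith
    then show ?thesis using True a by (simp add: std_normal_density_def ennreal_leI)
  qed simp
  then have "(\<integral>\<^sup>+x. ennreal (exp (- a\<^sup>2) / 8) * indicator {a..a + 1} x \<partial>lborel) \<le> emeasure std {x. a \<le> \<bar>x\<bar>}"
    by (subst emeasure_std) (auto intro!: nn_integral_mono)
  then show ?thesis by (simp add: nn_integral_cmult_indicator)
qed

lemma std_small_ball: "emeasure std {x. \<bar>x\<bar> < 1 / 2} \<le> ennreal (1 / 2)"
proof -
  have "emeasure std {x. \<bar>x\<bar> < 1 / 2} \<le> (\<integral>\<^sup>+x. ennreal (1 / 2) * indicator {- 1 / 2..1 / 2} (x::real) \<partial>lborel)"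
  proof (subst emeasure_std)
    show "(\<integral>\<^sup>+ t. ennreal (std_normal_density t) * indicator {x. \<bar>x\<bar> < 1 / 2} t \<partial>lborel) \<le> (\<integral>\<^sup>+x. ennreal (1 / 2) * indicator {- 1 / 2..1 / 2} (x::real) \<partial>lborel)"
    proof (rule nn_integral_mono)
      fix t :: real
      have "1 / sqrt (2 * pi) * exp (- (t\<^sup>2 / 2)) \<le> (1 / 2) * 1"
        using sqrt_two_pi_bounds by (intro mult_mono divide_left_mono) auto
      then have "std_normal_density t \<le> 1 / 2" by (simp add: std_normal_density_def)
      then show "ennreal (std_normal_density t) * indicator {x. \<bar>x\<bar> < 1 / 2} t \<le> ennreal (1 / 2) * indicator {- 1 / 2..1 / 2} t"
        by (intro mult_mono ennreal_leI) (auto simp: indicator_def)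
    qed
  qed auto
  also have "\<dots> = ennreal (1 / 2)" by (subst nn_integral_cmult_indicator) auto
  finally show ?thesis .
qed

text \<open>The product with the density is sqrt 2 times the density of a centred Gaussian of
  variance 2.\<close>

lemma std_exp_moment: "(\<integral>\<^sup>+x. ennreal (exp (x\<^sup>2 / 4)) \<partial>std) = ennreal (sqrt 2)"
proof -
  have *: "std_normal_density x * exp (x\<^sup>2 / 4) = sqrt 2 * normal_density 0 (sqrt 2) x" for x
    by (simp add: normal_density_def real_sqrt_mult field_simps flip: exp_add)
  have "(\<integral>\<^sup>+x. ennreal (exp (x\<^sup>2 / 4)) \<partial>std) = (\<integral>\<^sup>+x. ennreal (sqrt 2) * ennreal (normal_density 0 (sqrt 2) x) \<partial>lborel)"
    by (subst nn_integral_std) (auto simp: * intro!: nn_integral_cong simp flip: ennreal_mult)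
  also have "\<dots> = ennreal (sqrt 2) * (\<integral>\<^sup>+x. ennreal (normal_density 0 (sqrt 2) x) \<partial>lborel)"
    by (rule nn_integral_cmult) simp
  also have "(\<integral>\<^sup>+x. ennreal (normal_density 0 (sqrt 2) x) \<partial>lborel) = 1"
    using prob_space.emeasure_space_1[OF prob_space_normal_density[of "sqrt 2" 0]] by (simp add: emeasure_density)
  finally show ?thesis by simp
qed

lemma std_second_moment_finite: "(\<integral>\<^sup>+x. ennreal (x\<^sup>2) \<partial>std) < \<infinity>"
proof -
  have "(\<integral>\<^sup>+x. ennreal (x\<^sup>2) \<partial>std) \<le> (\<integral>\<^sup>+x. ennreal 4 * ennreal (exp (x\<^sup>2 / 4)) \<partial>std)"
  proof (rule nn_integral_mono)
    fix x :: real
    have "x\<^sup>2 \<le> 4 * exp (x\<^sup>2 / 4)" using exp_ge_add_one_self[of "x\<^sup>2 / 4"] by linarith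
    then show "ennreal (x\<^sup>2) \<le> ennreal 4 * ennreal (exp (x\<^sup>2 / 4))"
      by (subst ennreal_mult[symmetric]) (auto intro: ennreal_leI)
  qed
  also have "\<dots> = ennreal 4 * ennreal (sqrt 2)" by (subst nn_integral_cmult) (auto simp: std_exp_moment)
  also have "\<dots> < \<infinity>" by (simp add: ennreal_mult_less_top)
  finally show ?thesis .
qed

text \<open>A converse to Markov's inequality, by the Laplace transform: for Z = sum of
  \<open>\<psi> i (g i)\<close>, independence gives E exp(-Z) <= exp(-(sum of the means) / 2), while
  Z < 1 with probability at least 1/2 gives E exp(-Z) >= exp(-1) / 2 >= exp(-2).\<close>

lemma gauss_count_bound:
  fixes \<psi> :: "'i \<Rightarrow> real \<Rightarrow> real"
  assumes I: "finite I" and [measurable]: "\<And>i. i \<in> I \<Longrightarrow> \<psi> i \<in> borel_measurable borel"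
    and psi: "\<And>i x. i \<in> I \<Longrightarrow> 0 \<le> \<psi> i x" "\<And>i x. i \<in> I \<Longrightarrow> \<psi> i x \<le> 1"
    and small: "measure (gauss I) {g \<in> space (gauss I). 1 \<le> (\<Sum>i\<in>I. \<psi> i (g i))} \<le> 1 / 2"
  shows "(\<Sum>i\<in>I. \<integral>x. \<psi> i x \<partial>std) \<le> 4"
proof -
  interpret S: prob_space std by (rule prob_space_std)
  interpret G: prob_space "gauss I" by (rule prob_space_gauss)
  define E where "E = (\<lambda>i. \<integral>x. \<psi> i x \<partial>std)"
  have int: "integrable std (\<psi> i)" if "i \<in> I" for i
    by (rule S.integrable_const_bound[where B = 1]) (use psi that in auto)
  have E0: "0 \<le> E i" if "i \<in> I" for i unfolding E_def using psi(1)[OF that] by simp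
  have E1: "E i \<le> 1" if "i \<in> I" for i
    unfolding E_def using S.integral_le_const[OF int[OF that], of 1] psi(2)[OF that] by simp
  have one: "(\<integral>\<^sup>+x. ennreal (exp (- \<psi> i x)) \<partial>std) \<le> ennreal (exp (- E i / 2))" if i: "i \<in> I" for i
  proof -
    have "exp (- t) \<le> 1 - t / 2" if "0 \<le> t" "t \<le> 1" for t :: real
    proof -
      have "exp (- t) = inverse (exp t)" by (simp add: exp_minus)
      also have "\<dots> \<le> inverse (1 + t)" using exp_ge_add_one_self[of t] that by (intro le_imp_inverse_le) auto
      also have "\<dots> \<le> 1 - t / 2"
      proof -
        have "1 \<le> (1 - t / 2) * (1 + t)" using that mult_left_mono[of t 1 t] by (simp add: algebra_simps)
        then show ?thesis using that by (simp add: inverse_eq_divide pos_divide_le_eq)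
      qed
      finally show ?thesis .
    qed
    then have "(\<integral>\<^sup>+x. ennreal (exp (- \<psi> i x)) \<partial>std) \<le> (\<integral>\<^sup>+x. ennreal (1 - \<psi> i x / 2) \<partial>std)"
      by (intro nn_integral_mono ennreal_leI) (simp add: psi[OF i])
    also have "\<dots> = ennreal (\<integral>x. 1 - \<psi> i x / 2 \<partial>std)"
    proof (rule nn_integral_eq_integral)
      show "AE x in std. 0 \<le> 1 - \<psi> i x / 2" 
      proof (rule AE_I2)
        fix x show "0 \<le> 1 - \<psi> i x / 2" using psi(2)[OF i, of x] by simp
      qed
    qed (use int[OF i] in auto)
    also have "(\<integral>x. 1 - \<psi> i x / 2 \<partial>std) = 1 - E i / 2"
      using int[OF i] S.prob_space by (simp add: E_def)
    also have "ennreal (1 - E i / 2) \<le> ennreal (exp (- E i / 2))"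
      using exp_ge_add_one_self[of "- E i / 2"] by (intro ennreal_leI) simp
    finally show ?thesis .
  qed
  define Z where "Z = (\<lambda>g. \<Sum>i\<in>I. \<psi> i (g i))"
  have [measurable]: "Z \<in> borel_measurable (gauss I)"
    unfolding Z_def measurable_cong_sets[OF sets_gauss refl] by measurable
  define A where "A = {g \<in> space (gauss I). 1 \<le> Z g}"
  have e: "exp (- (\<Sum>i\<in>I. h i)) = (\<Prod>i\<in>I. exp (- h i))" for h :: "'i \<Rightarrow> real"
    using exp_sum[OF I, of "\<lambda>i. - h i"] by (simp add: sum_negf)
  have [measurable]: "A \<in> sets (gauss I)" unfolding A_def by measurable
  have "ennreal (exp (- 1) / 2) = ennreal (exp (- 1)) * ennreal (1 / 2)" by (subst ennreal_mult[symmetric]) auto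
  also have "\<dots> \<le> ennreal (exp (- 1)) * emeasure (gauss I) (space (gauss I) - A)"
  proof (rule mult_left_mono)
    have "1 / 2 \<le> G.prob (space (gauss I) - A)"
      using small G.prob_compl[of A] by (simp add: A_def Z_def)
    then show "ennreal (1 / 2) \<le> emeasure (gauss I) (space (gauss I) - A)"
      unfolding G.emeasure_eq_measure by (rule ennreal_leI)
  qed simp
  also have "\<dots> = (\<integral>\<^sup>+g. ennreal (exp (- 1)) * indicator (space (gauss I) - A) g \<partial>gauss I)"
    by (subst nn_integral_cmult_indicator) auto
  also have "\<dots> \<le> (\<integral>\<^sup>+g. ennreal (exp (- Z g)) \<partial>gauss I)"
    by (rule nn_integral_mono) (auto simp: indicator_def A_def ennreal_leI)
  also have "\<dots> = (\<integral>\<^sup>+g. (\<Prod>i\<in>I. ennreal (exp (- \<psi> i (g i)))) \<partial>gauss I)"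
    by (simp only: Z_def e prod_ennreal exp_ge_zero)
  also have "\<dots> = (\<Prod>i\<in>I. \<integral>\<^sup>+x. ennreal (exp (- \<psi> i x)) \<partial>std)"
    by (rule nn_integral_gauss_prod) (use I in auto)
  also have "\<dots> \<le> (\<Prod>i\<in>I. ennreal (exp (- E i / 2)))" by (intro prod_mono_ennreal one)
  also have "\<dots> = ennreal (exp (- (\<Sum>i\<in>I. E i / 2)))"
    by (simp only: e prod_ennreal exp_ge_zero minus_divide_left)
  finally have "exp (- 1) / 2 \<le> exp (- (\<Sum>i\<in>I. E i) / 2)" by (simp add: sum_divide_distrib)
  also have "exp (- 2 :: real) \<le> exp (- 1) / 2"
  proof -
    have "(2::real) \<le> exp 1" using exp_ge_add_one_self[of "1::real"] by simp
    then have "exp (- 2 :: real) * 2 \<le> exp (- 2) * exp 1" by (intro mult_left_mono) auto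
    then show ?thesis by (simp flip: exp_add)
  qed
  finally show ?thesis unfolding E_def by simp
qed

section \<open>The norms and the weights of the rows\<close>

text \<open>After multiplication by p this says that t^p lies above its tangent at c.\<close>

lemma powr_young:
  fixes c t p :: real
  assumes "0 \<le> c" "0 \<le> t" "1 \<le> p"
  shows "c powr (p - 1) * t \<le> (1 - 1 / p) * c powr p + t powr p / p"
proof (cases "c = 0 \<or> t = 0")
  case True
  then show ?thesis using assms by auto
next
  case False
  have "(c powr p) powr (1 - 1 / p) * (t powr p) powr (1 / p) \<le> (1 - 1 / p) * c powr p + 1 / p * t powr p"
    by (rule Youngs_inequality_0) (use assms False in \<open>auto simp: field_simps\<close>)
  moreover have "(c powr p) powr (1 - 1 / p) = c powr (p - 1)" 
  proof -
    have "p * (1 - 1 / p) = p - 1" using assms by (simp add: right_diff_distrib)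
    then show ?thesis by (simp add: powr_powr)
  qed
  moreover have "(t powr p) powr (1 / p) = t" using assms by (simp add: powr_powr)
  ultimately show ?thesis by simp
qed

text \<open>The weights may add up to less than 1, as the squares of a vector of the unit ball do;
  the missing mass can be thought of as sitting at 0. The proof averages the tangent inequality at
  the mean.\<close>

lemma powr_jensen:
  fixes p :: real
  assumes "finite K" "1 \<le> p" and l: "\<And>k. k \<in> K \<Longrightarrow> 0 \<le> l k" "(\<Sum>k\<in>K. l k) \<le> 1" and t: "\<And>k. k \<in> K \<Longrightarrow> 0 \<le> t k"
  shows "(\<Sum>k\<in>K. l k * t k) powr p \<le> (\<Sum>k\<in>K. l k * t k powr p)"
proof -
  define c where "c = (\<Sum>k\<in>K. l k * t k)"
  have c0: "0 \<le> c" unfolding c_def using l t by (simp add: sum_nonneg)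
  have "c powr p = c powr (p - 1) * c" using c0 by (simp add: powr_mult_base mult.commute)
  also have "\<dots> = (\<Sum>k\<in>K. l k * (c powr (p - 1) * t k))" by (simp add: c_def sum_distrib_left mult.left_commute)
  also have "\<dots> \<le> (\<Sum>k\<in>K. l k * ((1 - 1 / p) * c powr p + t k powr p / p))"
    using l t c0 assms(2) by (intro sum_mono mult_left_mono powr_young) auto
  also have "\<dots> = (\<Sum>k\<in>K. l k) * ((1 - 1 / p) * c powr p) + (\<Sum>k\<in>K. l k * t k powr p) / p"
    by (simp add: distrib_left sum.distrib sum_distrib_right sum_divide_distrib)
  also have "\<dots> \<le> 1 * ((1 - 1 / p) * c powr p) + (\<Sum>k\<in>K. l k * t k powr p) / p"
    using l(2) assms(2) by (intro add_right_mono mult_right_mono) auto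
  finally have "c powr p / p \<le> (\<Sum>k\<in>K. l k * t k powr p) / p" using assms(2) by (simp add: left_diff_distrib)
  then show ?thesis using assms(2) by (simp add: c_def divide_le_cancel)
qed

section \<open>The norms of finite exponent, the norm \<open>lnorm\<close>, and Hoelder's
  inequality\<close>

definition lp :: "real \<Rightarrow> 'i set \<Rightarrow> ('i \<Rightarrow> real) \<Rightarrow> real" where
  "lp p I x = (\<Sum>i\<in>I. \<bar>x i\<bar> powr p) powr (1 / p)"

lemma lnorm_ereal: "lnorm (ereal p) I x = lp p I x"
  by (simp add: lnorm_def lp_def)

lemma lnorm_infinity: "lnorm \<infinity> I x = (MAX i\<in>I. \<bar>x i\<bar>)"
  by (simp add: lnorm_def)

lemma exponent_cases:
  assumes "2 \<le> (t::ereal)"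
  obtains "t = \<infinity>" | p where "t = ereal p" "2 \<le> p"
  using assms by (cases t) auto

lemma lp_nonneg [simp]: "0 \<le> lp p I x" by (simp add: lp_def)

lemma lp_powr: "0 < p \<Longrightarrow> lp p I x powr p = (\<Sum>i\<in>I. \<bar>x i\<bar> powr p)"
  by (simp add: lp_def powr_powr sum_nonneg)

lemma lp_leI:
  assumes "0 < p" "0 \<le> c" "(\<Sum>i\<in>I. \<bar>x i\<bar> powr p) \<le> c powr p"
  shows "lp p I x \<le> c"
proof -
  have "lp p I x \<le> (c powr p) powr (1 / p)"
    unfolding lp_def using assms by (intro powr_mono2) (auto simp: sum_nonneg)
  then show ?thesis using assms by (simp add: powr_powr)
qed

lemma lp_leD: "\<lbrakk>0 < p; lp p I x \<le> c\<rbrakk> \<Longrightarrow> (\<Sum>i\<in>I. \<bar>x i\<bar> powr p) \<le> c powr p"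
  using powr_mono2[of p "lp p I x" c] by (simp add: lp_powr)

lemma lp_normalised:
  assumes "0 < lp p I x" "0 < p"
  shows "(\<Sum>i\<in>I. (\<bar>x i\<bar> / lp p I x) powr p) = 1"
proof -
  have "(\<Sum>i\<in>I. (\<bar>x i\<bar> / lp p I x) powr p) = (\<Sum>i\<in>I. \<bar>x i\<bar> powr p) / lp p I x powr p"
    by (simp add: powr_divide sum_divide_distrib)
  also have "\<dots> = lp p I x powr p / lp p I x powr p" by (simp only: lp_powr[OF assms(2)])
  finally show ?thesis using assms(1) by simp
qed

lemma lp_component:
  assumes "finite I" "i \<in> I" "0 < p"
  shows "\<bar>x i\<bar> \<le> lp p I x"
proof -
  have "\<bar>x i\<bar> powr p \<le> (\<Sum>i\<in>I. \<bar>x i\<bar> powr p)" using assms by (intro member_le_sum) auto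
  then have "(\<bar>x i\<bar> powr p) powr (1 / p) \<le> lp p I x"
    unfolding lp_def using assms by (intro powr_mono2) auto
  then show ?thesis using assms by (simp add: powr_powr)
qed

lemma lp_antimono:
  assumes "finite I" "0 < q" "q \<le> p"
  shows "lp p I x \<le> lp q I x"
proof (cases "lp q I x = 0")
  case True
  then have "\<bar>x i\<bar> = 0" if "i \<in> I" for i using lp_component[OF assms(1) that assms(2), of x] by simp
  then have "lp p I x = 0" using assms by (simp add: lp_def)
  then show ?thesis by simp
next
  case False
  define M where "M = lp q I x"
  have M: "0 < M" using False by (simp add: M_def less_le)
  show ?thesis
  proof (rule lp_leI)
    have "(\<Sum>i\<in>I. \<bar>x i\<bar> powr p) = M powr p * (\<Sum>i\<in>I. (\<bar>x i\<bar> / M) powr p)"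
      using M by (simp add: powr_divide sum_distrib_left)
    also have "\<dots> \<le> M powr p * (\<Sum>i\<in>I. (\<bar>x i\<bar> / M) powr q)"
    proof (intro mult_left_mono sum_mono)
      fix i assume "i \<in> I"
      then have "\<bar>x i\<bar> \<le> M" unfolding M_def using assms by (intro lp_component) auto
      then show "(\<bar>x i\<bar> / M) powr p \<le> (\<bar>x i\<bar> / M) powr q" using M assms by (intro powr_mono') auto
    qed simp
    also have "(\<Sum>i\<in>I. (\<bar>x i\<bar> / M) powr q) = 1" using M assms(2) unfolding M_def by (rule lp_normalised)
    finally show "(\<Sum>i\<in>I. \<bar>x i\<bar> powr p) \<le> lp q I x powr p" by (simp add: M_def)
  qed (use assms in auto)
qed

lemma lp_two: "lp 2 I x = L2_set x I"
  by (simp add: lp_def L2_set_def powr_half_sqrt sum_nonneg)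

text \<open>Minkowski by convexity: (|x| + |y|) / (A + B) is the average of |x| / A and |y| / B with
  weights A / (A + B) and B / (A + B), and \<open>powr_jensen\<close>, with index set
  \<open>bool\<close>, applies in every coordinate.\<close>

lemma lp_triangle:
  assumes I: "finite I" and p: "1 \<le> p"
  shows "lp p I (\<lambda>i. x i + y i) \<le> lp p I x + lp p I y"
proof -
  define A B where "A = lp p I x" and "B = lp p I y"
  have A0: "0 \<le> A" "0 \<le> B" by (auto simp: A_def B_def)
  have zero: "z i = 0" if "lp p I z = 0" "i \<in> I" for z i
  proof -
    have "\<bar>z i\<bar> \<le> lp p I z" by (rule lp_component[OF I that(2)]) (use p in linarith)
    then show ?thesis unfolding that(1) by simp
  qed
  show ?thesis
  proof (cases "A = 0 \<or> B = 0")
    case True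
    then show ?thesis
    proof
      assume "A = 0"
      then have "x i = 0" if "i \<in> I" for i using zero[of x i] that by (simp add: A_def)
      then have "lp p I (\<lambda>i. x i + y i) = lp p I y" unfolding lp_def by simp
      then show ?thesis by simp
    next
      assume "B = 0"
      then have "y i = 0" if "i \<in> I" for i using zero[of y i] that by (simp add: B_def)
      then have "lp p I (\<lambda>i. x i + y i) = lp p I x" unfolding lp_def by simp
      then show ?thesis by simp
    qed
  next
    case False
    then have AB: "0 < A" "0 < B" using A0 by auto
    define l where "l = (\<lambda>b. if b then A / (A + B) else B / (A + B))"
    have sA: "(\<Sum>i\<in>I. (\<bar>x i\<bar> / A) powr p) = 1" "(\<Sum>i\<in>I. (\<bar>y i\<bar> / B) powr p) = 1"
      using AB p unfolding A_def B_def by (auto intro!: lp_normalised)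
    have "A + B = lp p I x + lp p I y" by (simp add: A_def B_def)
    moreover have "lp p I (\<lambda>i. x i + y i) \<le> A + B"
    proof (rule lp_leI)
      have "(\<Sum>i\<in>I. \<bar>x i + y i\<bar> powr p) \<le> (\<Sum>i\<in>I. (A + B) powr p * (A / (A + B) * (\<bar>x i\<bar> / A) powr p + B / (A + B) * (\<bar>y i\<bar> / B) powr p))"
      proof (rule sum_mono)
        fix i
        have "(\<Sum>b\<in>UNIV. l b * (if b then \<bar>x i\<bar> / A else \<bar>y i\<bar> / B)) powr p
           \<le> (\<Sum>b\<in>UNIV. l b * (if b then \<bar>x i\<bar> / A else \<bar>y i\<bar> / B) powr p)"
          by (rule powr_jensen) (use AB p in \<open>auto simp: l_def UNIV_bool add_divide_distrib[symmetric]\<close>)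
        then have *: "(\<bar>x i\<bar> / (A + B) + \<bar>y i\<bar> / (A + B)) powr p \<le> A / (A + B) * (\<bar>x i\<bar> / A) powr p + B / (A + B) * (\<bar>y i\<bar> / B) powr p"
          using AB by (simp add: l_def UNIV_bool add.commute)
        have "\<bar>x i + y i\<bar> powr p \<le> ((A + B) * (\<bar>x i\<bar> / (A + B) + \<bar>y i\<bar> / (A + B))) powr p"
          using p AB by (intro powr_mono2) (auto simp: distrib_left)
        also have "\<dots> = (A + B) powr p * (\<bar>x i\<bar> / (A + B) + \<bar>y i\<bar> / (A + B)) powr p"
          by (rule powr_mult)
        also have "\<dots> \<le> (A + B) powr p * (A / (A + B) * (\<bar>x i\<bar> / A) powr p + B / (A + B) * (\<bar>y i\<bar> / B) powr p)"
          by (intro mult_left_mono *) auto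
        finally show "\<bar>x i + y i\<bar> powr p \<le> (A + B) powr p * (A / (A + B) * (\<bar>x i\<bar> / A) powr p + B / (A + B) * (\<bar>y i\<bar> / B) powr p)" .
      qed
      also have "\<dots> = (A + B) powr p * (A / (A + B) * (\<Sum>i\<in>I. (\<bar>x i\<bar> / A) powr p) + B / (A + B) * (\<Sum>i\<in>I. (\<bar>y i\<bar> / B) powr p))"
        by (simp add: sum_distrib_left sum.distrib distrib_left)
      also have "\<dots> = (A + B) powr p" unfolding sA using AB by (simp flip: add_divide_distrib)
      finally show "(\<Sum>i\<in>I. \<bar>x i + y i\<bar> powr p) \<le> (A + B) powr p" .
    qed (use p A0 in auto)
    ultimately show ?thesis by simp
  qed
qed

lemma lp_card_bound:
  assumes "finite I" "0 < p" "\<And>i. i \<in> I \<Longrightarrow> \<bar>x i\<bar> \<le> c" "0 \<le> c"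
  shows "lp p I x \<le> real (card I) powr (1 / p) * c"
proof (rule lp_leI)
  have "(\<Sum>i\<in>I. \<bar>x i\<bar> powr p) \<le> (\<Sum>i\<in>I. c powr p)"
    using assms by (intro sum_mono powr_mono2) auto
  also have "\<dots> = (real (card I) powr (1 / p) * c) powr p"
    using assms by (simp add: powr_mult powr_powr)
  finally show "(\<Sum>i\<in>I. \<bar>x i\<bar> powr p) \<le> (real (card I) powr (1 / p) * c) powr p" .
qed (use assms in auto)

lemma lp_mono:
  assumes "0 < p" "\<And>i. i \<in> I \<Longrightarrow> \<bar>x i\<bar> \<le> \<bar>y i\<bar>"
  shows "lp p I x \<le> lp p I y"
  unfolding lp_def using assms by (intro powr_mono2 sum_mono) (auto simp: sum_nonneg)

lemma lp_cmult:
  assumes "0 < p"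
  shows "lp p I (\<lambda>i. c * x i) = \<bar>c\<bar> * lp p I x"
  using assms by (simp add: lp_def abs_mult powr_mult powr_powr sum_nonneg flip: sum_distrib_left)

context
  fixes t :: ereal and I :: "nat set"
  assumes t: "2 \<le> t" and I: "finite I" "I \<noteq> {}"
begin

lemma lnorm_component: "i \<in> I \<Longrightarrow> \<bar>x i\<bar> \<le> lnorm t I x"
  using t by (cases rule: exponent_cases) (auto simp: lnorm_ereal lnorm_infinity I lp_component)

lemma lnorm_nonneg: "0 \<le> lnorm t I x"
  using lnorm_component[of _ x] I(2) by (meson abs_ge_zero ex_in_conv order_trans)

lemma lnorm_mono: "(\<And>i. i \<in> I \<Longrightarrow> \<bar>x i\<bar> \<le> \<bar>y i\<bar>) \<Longrightarrow> lnorm t I x \<le> lnorm t I y"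
  using t
proof (cases rule: exponent_cases)
  case 1
  assume *: "\<And>i. i \<in> I \<Longrightarrow> \<bar>x i\<bar> \<le> \<bar>y i\<bar>"
  have "\<bar>x i\<bar> \<le> lnorm t I y" if "i \<in> I" for i
    using *[OF that] lnorm_component[OF that, of y] by linarith
  then show ?thesis using I unfolding 1 lnorm_infinity[of I x] by (intro Max.boundedI) auto
qed (simp add: lnorm_ereal lp_mono)

lemma lnorm_cong: "(\<And>i. i \<in> I \<Longrightarrow> \<bar>x i\<bar> = \<bar>y i\<bar>) \<Longrightarrow> lnorm t I x = lnorm t I y"
  by (intro antisym lnorm_mono) auto

lemma lnorm_le_lp:
  assumes "0 < q" "ereal q \<le> t"
  shows "lnorm t I x \<le> lp q I x"
  using t by (cases rule: exponent_cases)
    (use assms in \<open>auto simp: lnorm_ereal lnorm_infinity I intro!: lp_antimono lp_component\<close>)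

lemma lnorm_le_L2: "lnorm t I x \<le> L2_set x I"
  using lnorm_le_lp[of 2 x] t by (simp add: lp_two)

lemma lnorm_triangle: "lnorm t I (\<lambda>i. x i + y i) \<le> lnorm t I x + lnorm t I y"
  using t
proof (cases rule: exponent_cases)
  case 1
  have "\<bar>x i + y i\<bar> \<le> (MAX i\<in>I. \<bar>x i\<bar>) + (MAX i\<in>I. \<bar>y i\<bar>)" if "i \<in> I" for i
    using that I by (intro order_trans[OF abs_triangle_ineq] add_mono) auto
  then show ?thesis using 1 I by (simp add: lnorm_infinity)
next
  case (2 p)
  then show ?thesis using lp_triangle[of I p x y] I by (simp add: lnorm_ereal)
qed

lemma lnorm_cmult: "lnorm t I (\<lambda>i. c * x i) = \<bar>c\<bar> * lnorm t I x"
  using t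
proof (cases rule: exponent_cases)
  case 1
  show ?thesis
  proof (rule antisym)
    show "lnorm t I (\<lambda>i. c * x i) \<le> \<bar>c\<bar> * lnorm t I x"
      using 1 I lnorm_component[of _ x] by (auto simp: lnorm_infinity abs_mult intro!: mult_left_mono)
    obtain i where "i \<in> I" "(MAX i\<in>I. \<bar>x i\<bar>) = \<bar>x i\<bar>"
      using Max_in[of "(\<lambda>i. \<bar>x i\<bar>) ` I"] I by (smt (verit) finite_imageI image_iff image_is_empty)
    then show "\<bar>c\<bar> * lnorm t I x \<le> lnorm t I (\<lambda>i. c * x i)"
      using 1 lnorm_component[of i "\<lambda>i. c * x i"] by (simp add: lnorm_infinity abs_mult)
  qed
qed (simp add: lnorm_ereal lp_cmult)

lemma lnorm_measurable:
  assumes "\<And>i. i \<in> I \<Longrightarrow> (\<lambda>g. f g i) \<in> borel_measurable M"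
  shows "(\<lambda>g. lnorm t I (f g)) \<in> borel_measurable M"
  using t
proof (cases rule: exponent_cases)
  case 1
  have "(\<lambda>g. MAX i\<in>I. \<bar>f g i\<bar>) \<in> borel_measurable M"
    by (rule borel_measurable_Max) (use I assms in auto)
  then show ?thesis using 1 by (simp add: lnorm_infinity)
next
  case (2 p)
  then show ?thesis unfolding 2 lnorm_ereal lp_def using assms by measurable
qed

text \<open>For t = p the exponent \<open>expo t - 1\<close> is 1 - 2/p, so this is Hoelder for the
  squares with the exponents p/2 and p/(p-2), proved by Young after normalising h. The bound 2 for
  the squares of x fits the pointwise maximum of two vectors of the unit ball.\<close>

lemma lnorm_hoelder:
  assumes x: "\<And>i. i \<in> I \<Longrightarrow> 0 \<le> x i" and x2: "(\<Sum>i\<in>I. (x i)\<^sup>2) \<le> 2"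
  shows "L2_set (\<lambda>i. h i * rpow (x i) (expo t - 1)) I \<le> sqrt 2 * lnorm t I h"
proof (cases "lnorm t I h = 0")
  case True
  then have "h i = 0" if "i \<in> I" for i using lnorm_component[OF that, of h] by simp
  then have "L2_set (\<lambda>i. h i * rpow (x i) (expo t - 1)) I = 0" by (simp add: L2_set_def)
  then show ?thesis using lnorm_nonneg by simp
next
  case False
  define A where "A = lnorm t I h"
  have A: "0 < A" using False lnorm_nonneg[of h] by (simp add: A_def)
  have "(\<Sum>i\<in>I. (h i * rpow (x i) (expo t - 1))\<^sup>2) \<le> 2 * A\<^sup>2"
    using t
  proof (cases rule: exponent_cases)
    case 1
    have "(\<Sum>i\<in>I. (h i * rpow (x i) (expo t - 1))\<^sup>2) \<le> (\<Sum>i\<in>I. A\<^sup>2 * (x i)\<^sup>2)"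
    proof (rule sum_mono)
      fix i assume i: "i \<in> I"
      have "(h i)\<^sup>2 \<le> A\<^sup>2" using lnorm_component[OF i, of h] A by (intro abs_le_square_iff[THEN iffD1]) (simp add: A_def)
      then show "(h i * rpow (x i) (expo t - 1))\<^sup>2 \<le> A\<^sup>2 * (x i)\<^sup>2"
        using 1 x[OF i] by (simp add: expo_def rpow_def power_mult_distrib mult_right_mono)
    qed
    also have "\<dots> \<le> A\<^sup>2 * 2" unfolding sum_distrib_left[symmetric] by (intro mult_left_mono x2) simp
    finally show ?thesis by simp
  next
    case (2 p)
    have e: "expo t - 1 = 1 - 2 / p" using 2 by (simp add: expo_def)
    have s1: "(\<Sum>i\<in>I. (\<bar>h i\<bar> / A) powr p) = 1"
      using A 2 lp_normalised[of p I h] by (simp add: A_def lnorm_ereal)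
    have "(h i * rpow (x i) (expo t - 1))\<^sup>2 \<le> A\<^sup>2 * (2 / p * (\<bar>h i\<bar> / A) powr p + (1 - 2 / p) * (x i)\<^sup>2)" if i: "i \<in> I" for i
    proof -
      have "(\<bar>h i\<bar> / A)\<^sup>2 * (rpow (x i) (1 - 2 / p))\<^sup>2 \<le> 2 / p * (\<bar>h i\<bar> / A) powr p + (1 - 2 / p) * (x i)\<^sup>2"
      \<comment> \<open>For p = 2 the exponent is 0 and \<open>rpow\<close> is identically 1, where
        \<open>powr\<close> would vanish at 0. This case and the zeros are kept away from Young's
        inequality.\<close>
      proof (cases "h i = 0 \<or> x i = 0 \<or> p = 2")
        case True
        have "0 \<le> (1 - 2 / p) * (x i)\<^sup>2" using 2 by simp
        then show ?thesis using True 2 A by (auto simp: rpow_def)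
      next
        case False
        have "((\<bar>h i\<bar> / A) powr p) powr (2 / p) * ((x i)\<^sup>2) powr (1 - 2 / p) \<le> 2 / p * (\<bar>h i\<bar> / A) powr p + (1 - 2 / p) * (x i)\<^sup>2"
          by (rule Youngs_inequality_0) (use 2 False A in auto)
        moreover have "((\<bar>h i\<bar> / A) powr p) powr (2 / p) = (\<bar>h i\<bar> / A)\<^sup>2" using 2 A by (simp add: powr_powr)
        moreover have "((x i)\<^sup>2) powr (1 - 2 / p) = (rpow (x i) (1 - 2 / p))\<^sup>2"
          using False 2 x[OF i] by (simp add: rpow_def powr_power mult.commute powr_powr flip: powr_numeral)
        ultimately show ?thesis by simp
      qed
      then have "A\<^sup>2 * ((\<bar>h i\<bar> / A)\<^sup>2 * (rpow (x i) (1 - 2 / p))\<^sup>2) \<le> A\<^sup>2 * (2 / p * (\<bar>h i\<bar> / A) powr p + (1 - 2 / p) * (x i)\<^sup>2)"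
        by (intro mult_left_mono) auto
      then show ?thesis using A unfolding e by (simp add: power_mult_distrib power_divide)
    qed
    then have "(\<Sum>i\<in>I. (h i * rpow (x i) (expo t - 1))\<^sup>2) \<le> (\<Sum>i\<in>I. A\<^sup>2 * (2 / p * (\<bar>h i\<bar> / A) powr p + (1 - 2 / p) * (x i)\<^sup>2))"
      by (rule sum_mono)
    also have "\<dots> = A\<^sup>2 * (2 / p * (\<Sum>i\<in>I. (\<bar>h i\<bar> / A) powr p) + (1 - 2 / p) * (\<Sum>i\<in>I. (x i)\<^sup>2))"
      by (simp add: sum_distrib_left sum.distrib distrib_left)
    also have "\<dots> \<le> A\<^sup>2 * (2 / p * 1 + (1 - 2 / p) * 2)"
      unfolding s1 using x2 2 by (intro mult_left_mono add_left_mono) auto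
    also have "\<dots> \<le> A\<^sup>2 * 2" using 2 by (intro mult_left_mono) (auto simp: field_simps)
    finally show ?thesis by simp
  qed
  then have "L2_set (\<lambda>i. h i * rpow (x i) (expo t - 1)) I \<le> sqrt (2 * A\<^sup>2)"
    unfolding L2_set_def by (rule real_sqrt_le_mono)
  then show ?thesis using A by (simp add: real_sqrt_mult A_def)
qed

end

section \<open>Differences of powers on the positive part of the ball\<close>

lemma expo_bounds:
  assumes "2 \<le> t"
  shows "1 \<le> expo t" "expo t \<le> 2"
  using assms by (cases rule: exponent_cases; simp add: expo_def)+

text \<open>Convexity: the difference is at most the slope at the larger point, p * a^(p-1), times
  the increment, and p <= 2.\<close>

lemma rpow_diff_le:
  assumes "0 \<le> b" "b \<le> a" "1 \<le> p" "p \<le> 2"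
  shows "rpow a p - rpow b p \<le> 2 * rpow a (p - 1) * (a - b)"
proof (cases "a = 0 \<or> p = 1")
  case True
  then show ?thesis using assms by (auto simp: rpow_def)
next
  case False
  have "a powr (p - 1) * b \<le> (1 - 1 / p) * a powr p + b powr p / p"
    by (rule powr_young) (use assms in auto)
  then have "p * (a powr (p - 1) * b) \<le> p * ((1 - 1 / p) * a powr p + b powr p / p)"
    using assms by (intro mult_left_mono) auto
  also have "\<dots> = (p - 1) * a powr p + b powr p" using assms by (simp add: field_simps)
  finally have *: "p * (a powr (p - 1) * b) \<le> (p - 1) * a powr p + b powr p" .
  have "a powr p = a powr (p - 1) * a" using assms by (simp add: powr_mult_base mult.commute)
  then have "a powr p - b powr p \<le> p * (a powr (p - 1) * (a - b))" using * by (simp add: algebra_simps)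
  also have "\<dots> \<le> 2 * (a powr (p - 1) * (a - b))" using assms by (intro mult_right_mono) auto
  finally show ?thesis using False assms by (simp add: rpow_def)
qed

lemma rpow_nonneg [simp]: "0 \<le> rpow x p" by (simp add: rpow_def)

lemma rpow_le_one: "\<lbrakk>0 \<le> x; x \<le> 1; 0 \<le> p\<rbrakk> \<Longrightarrow> rpow x p \<le> 1"
  by (simp add: rpow_def powr_le1)

lemma rpow_mono: "\<lbrakk>0 \<le> x; x \<le> y; 0 \<le> p\<rbrakk> \<Longrightarrow> rpow x p \<le> rpow y p"
  by (simp add: rpow_def powr_mono2)

lemma B2plusD:
  assumes "v \<in> B2plus d"
  shows "\<And>i. i < d \<Longrightarrow> 0 \<le> v i" "(\<Sum>i<d. (v i)\<^sup>2) \<le> 1" "\<And>i. i < d \<Longrightarrow> v i \<le> 1"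
proof -
  show 0: "\<And>i. i < d \<Longrightarrow> 0 \<le> v i" using assms by (simp add: B2plus_def)
  show 1: "(\<Sum>i<d. (v i)\<^sup>2) \<le> 1" using assms by (simp add: B2plus_def L2_set_def)
  fix i assume i: "i < d"
  have "(v i)\<^sup>2 \<le> (\<Sum>i<d. (v i)\<^sup>2)" by (rule member_le_sum) (use i in auto)
  then show "v i \<le> 1" using 0[OF i] 1 by (intro power2_le_imp_le[of "v i" 1]) auto
qed

text \<open>The powers are linearised at the larger of the two points. These larger points form a
  vector x of squared length at most 2, and Hoelder's inequality absorbs the slopes
  x^(beta-1).\<close>

lemma L2_rpow_diff:
  assumes t: "2 \<le> t" and n: "0 < n" and v: "v \<in> B2plus n" "v' \<in> B2plus n"
  shows "L2_set (\<lambda>j. c j * (rpow (v j) (expo t) - rpow (v' j) (expo t))) {..<n}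
     \<le> 2 * sqrt 2 * lnorm t {..<n} (\<lambda>j. c j * (v j - v' j))"
proof -
  have I: "finite {..<n}" "{..<n} \<noteq> {}" using n by auto
  define x where "x = (\<lambda>j. max (v j) (v' j))"
  have x0: "0 \<le> x j" if "j < n" for j using B2plusD(1)[OF v(1) that] by (simp add: x_def)
  have "(\<Sum>j<n. (x j)\<^sup>2) \<le> (\<Sum>j<n. (v j)\<^sup>2 + (v' j)\<^sup>2)"
    by (rule sum_mono) (auto simp: x_def max_def)
  also have "\<dots> \<le> 2" using B2plusD(2)[OF v(1)] B2plusD(2)[OF v(2)] by (simp add: sum.distrib)
  finally have x2: "(\<Sum>j<n. (x j)\<^sup>2) \<le> 2" .
  note e = expo_bounds[OF t]
  have "L2_set (\<lambda>j. c j * (rpow (v j) (expo t) - rpow (v' j) (expo t))) {..<n}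
    \<le> L2_set (\<lambda>j. 2 * \<bar>c j * (v j - v' j) * rpow (x j) (expo t - 1)\<bar>) {..<n}"
    unfolding L2_set_def
  proof (intro real_sqrt_le_mono sum_mono)
    fix j assume "j \<in> {..<n}"
    then have j: "0 \<le> v j" "0 \<le> v' j" using B2plusD(1)[OF v(1)] B2plusD(1)[OF v(2)] by auto
    have "\<bar>rpow (v j) (expo t) - rpow (v' j) (expo t)\<bar> \<le> 2 * rpow (x j) (expo t - 1) * \<bar>v j - v' j\<bar>"
    proof (cases "v' j \<le> v j")
      case True
      then show ?thesis using rpow_diff_le[OF j(2) True e] rpow_mono[OF j(2) True, of "expo t"] e by (simp add: x_def max_def)
    next
      case False
      then have "v j \<le> v' j" by simp
      then show ?thesis using rpow_diff_le[OF j(1) _ e, of "v' j"] rpow_mono[OF j(1), of "v' j" "expo t"] e by (auto simp: x_def max_def)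
    qed
    then have "\<bar>c j\<bar> * \<bar>rpow (v j) (expo t) - rpow (v' j) (expo t)\<bar> \<le> \<bar>c j\<bar> * (2 * rpow (x j) (expo t - 1) * \<bar>v j - v' j\<bar>)"
      by (intro mult_left_mono) auto
    also have "\<dots> = 2 * \<bar>c j * (v j - v' j) * rpow (x j) (expo t - 1)\<bar>" by (simp add: abs_mult)
    finally show "(c j * (rpow (v j) (expo t) - rpow (v' j) (expo t)))\<^sup>2 \<le> (2 * \<bar>c j * (v j - v' j) * rpow (x j) (expo t - 1)\<bar>)\<^sup>2"
      by (intro abs_le_square_iff[THEN iffD1]) (simp add: abs_mult)
  qed
  also have "\<dots> = 2 * L2_set (\<lambda>j. c j * (v j - v' j) * rpow (x j) (expo t - 1)) {..<n}"
    by (simp add: L2_set_def power_mult_distrib real_sqrt_mult flip: sum_distrib_left)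
  also have "\<dots> \<le> 2 * (sqrt 2 * lnorm t {..<n} (\<lambda>j. c j * (v j - v' j)))"
    using lnorm_hoelder[OF t I, of x "\<lambda>j. c j * (v j - v' j)"] x0 x2 by simp
  finally show ?thesis by simp
qed

text \<open>The seminorm whose second Gaussian moment is the square of \<open>H_s\<close>. For the
  transposed matrix and r in place of s it gives \<open>H_r\<close>.\<close>

definition col_norm :: "ereal \<Rightarrow> nat \<Rightarrow> nat \<Rightarrow> (nat \<Rightarrow> nat \<Rightarrow> real) \<Rightarrow> (nat \<Rightarrow> real) \<Rightarrow> real" where
  "col_norm s m n a x = (MAX j\<in>{..<n}. lnorm s {..<m} (\<lambda>i. a i j * x i))"

text \<open>The length of the \<open>i\<close>-th row of \<open>U\<close>, up to the factor \<open>\<alpha> u\<^sub>i\<^sup>\<alpha>\<^sup>-\<^sup>1\<close>.\<close>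

definition row_wt :: "ereal \<Rightarrow> nat \<Rightarrow> (nat \<Rightarrow> nat \<Rightarrow> real) \<Rightarrow> (nat \<Rightarrow> real) \<Rightarrow> nat \<Rightarrow> real" where
  "row_wt r n a v i = L2_set (\<lambda>j. a i j * rpow (v j) (expo r)) {..<n}"

context
  fixes s :: ereal and m n :: nat and a :: "nat \<Rightarrow> nat \<Rightarrow> real"
  assumes s: "2 \<le> s" and m: "0 < m" and n: "0 < n"
begin

lemma col_norm_ge: "j < n \<Longrightarrow> lnorm s {..<m} (\<lambda>i. a i j * x i) \<le> col_norm s m n a x"
  unfolding col_norm_def by (rule Max_ge) auto

lemma col_norm_leI: "(\<And>j. j < n \<Longrightarrow> lnorm s {..<m} (\<lambda>i. a i j * x i) \<le> c) \<Longrightarrow> col_norm s m n a x \<le> c"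
  unfolding col_norm_def using n by (subst Max_le_iff) auto

lemma I_ne: "finite {..<m}" "{..<m} \<noteq> {}" using m by auto

lemma col_norm_nonneg: "0 \<le> col_norm s m n a x"
  using col_norm_ge[OF n, of x] lnorm_nonneg[OF s I_ne] by (meson order_trans)

lemma col_norm_triangle: "col_norm s m n a (\<lambda>i. x i + y i) \<le> col_norm s m n a x + col_norm s m n a y"
proof (rule col_norm_leI)
  fix j assume j: "j < n"
  have "lnorm s {..<m} (\<lambda>i. a i j * (x i + y i)) \<le> lnorm s {..<m} (\<lambda>i. a i j * x i) + lnorm s {..<m} (\<lambda>i. a i j * y i)"
    unfolding distrib_left by (rule lnorm_triangle[OF s I_ne])
  then show "lnorm s {..<m} (\<lambda>i. a i j * (x i + y i)) \<le> col_norm s m n a x + col_norm s m n a y"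
    using col_norm_ge[OF j, of x] col_norm_ge[OF j, of y] by linarith
qed

lemma col_norm_cmult_le: "col_norm s m n a (\<lambda>i. c * x i) \<le> \<bar>c\<bar> * col_norm s m n a x"
proof (rule col_norm_leI)
  fix j assume j: "j < n"
  have "lnorm s {..<m} (\<lambda>i. a i j * (c * x i)) = \<bar>c\<bar> * lnorm s {..<m} (\<lambda>i. a i j * x i)"
    using lnorm_cmult[OF s I_ne, of c "\<lambda>i. a i j * x i"] by (simp add: mult.left_commute)
  then show "lnorm s {..<m} (\<lambda>i. a i j * (c * x i)) \<le> \<bar>c\<bar> * col_norm s m n a x"
    using col_norm_ge[OF j, of x] by (simp add: mult_left_mono)
qed

lemma col_norm_cong: "(\<And>i. i < m \<Longrightarrow> x i = y i) \<Longrightarrow> col_norm s m n a x = col_norm s m n a y"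
proof -
  assume *: "\<And>i. i < m \<Longrightarrow> x i = y i"
  have "lnorm s {..<m} (\<lambda>i. a i j * x i) = lnorm s {..<m} (\<lambda>i. a i j * y i)" for j
    by (rule lnorm_cong[OF s I_ne]) (use * in auto)
  then show ?thesis unfolding col_norm_def by simp
qed

lemma col_norm_component: "\<lbrakk>i < m; j < n\<rbrakk> \<Longrightarrow> \<bar>a i j * x i\<bar> \<le> col_norm s m n a x"
  using lnorm_component[OF s I_ne, of i "\<lambda>i. a i j * x i"] col_norm_ge[of j x] by simp

lemma col_norm_le_L2:
  assumes "\<And>i j. \<lbrakk>i < m; j < n\<rbrakk> \<Longrightarrow> \<bar>a i j\<bar> \<le> b" "0 \<le> b"
  shows "col_norm s m n a x \<le> b * L2_set x {..<m}"
proof (rule col_norm_leI)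
  fix j assume j: "j < n"
  have "lnorm s {..<m} (\<lambda>i. a i j * x i) \<le> lnorm s {..<m} (\<lambda>i. b * x i)"
    by (rule lnorm_mono[OF s I_ne]) (use assms j in \<open>auto simp: abs_mult intro!: mult_right_mono\<close>)
  also have "\<dots> = b * lnorm s {..<m} x" using lnorm_cmult[OF s I_ne, of b x] assms by simp
  also have "\<dots> \<le> b * L2_set x {..<m}" by (intro mult_left_mono lnorm_le_L2[OF s I_ne] assms)
  finally show "lnorm s {..<m} (\<lambda>i. a i j * x i) \<le> b * L2_set x {..<m}" .
qed

lemma col_norm_measurable:
  "col_norm s m n a \<in> borel_measurable (Pi\<^sub>M {..<m} (\<lambda>_. borel))"
proof -
  have "(\<lambda>x. lnorm s {..<m} (\<lambda>i. a i j * x i)) \<in> borel_measurable (Pi\<^sub>M {..<m} (\<lambda>_. borel))" for j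
    by (rule lnorm_measurable[OF s I_ne]) measurable
  then have "(\<lambda>x. MAX j\<in>{..<n}. lnorm s {..<m} (\<lambda>i. a i j * x i)) \<in> borel_measurable (Pi\<^sub>M {..<m} (\<lambda>_. borel))"
    by (intro borel_measurable_Max) auto
  then show ?thesis unfolding col_norm_def[abs_def] .
qed

lemma row_wt_power2_le:
  assumes r: "2 \<le> r" and v: "v \<in> B2plus n"
  shows "(row_wt r n a v i)\<^sup>2 \<le> (\<Sum>j<n. (v j)\<^sup>2 * (a i j)\<^sup>2)"
proof -
  have "(row_wt r n a v i)\<^sup>2 = (\<Sum>j<n. (a i j * rpow (v j) (expo r))\<^sup>2)"
    by (simp add: row_wt_def L2_set_def sum_nonneg)
  also have "\<dots> \<le> (\<Sum>j<n. (v j)\<^sup>2 * (a i j)\<^sup>2)"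
  proof (rule sum_mono)
    fix j assume "j \<in> {..<n}"
    then have j: "0 \<le> v j" "v j \<le> 1" using B2plusD[OF v] by auto
    have "v j powr expo r \<le> v j powr 1" using j expo_bounds[OF r] by (intro powr_mono') auto
    then have "rpow (v j) (expo r) \<le> v j" using j expo_bounds[OF r] by (simp add: rpow_def)
    then have "(rpow (v j) (expo r))\<^sup>2 \<le> (v j)\<^sup>2" by (rule power_mono) simp
    then show "(a i j * rpow (v j) (expo r))\<^sup>2 \<le> (v j)\<^sup>2 * (a i j)\<^sup>2"
      unfolding power_mult_distrib mult.commute[of "(v j)\<^sup>2"] by (rule mult_left_mono) simp
  qed
  finally show ?thesis .
qed

lemma row_wt_le:
  assumes r: "2 \<le> r" and v: "v \<in> B2plus n" and a: "\<And>j. j < n \<Longrightarrow> \<bar>a i j\<bar> \<le> b" and b: "0 \<le> b"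
  shows "row_wt r n a v i \<le> b"
proof -
  have "(row_wt r n a v i)\<^sup>2 \<le> (\<Sum>j<n. (v j)\<^sup>2 * (a i j)\<^sup>2)" by (rule row_wt_power2_le[OF r v])
  also have "\<dots> \<le> (\<Sum>j<n. (v j)\<^sup>2 * b\<^sup>2)"
  proof (intro sum_mono mult_left_mono)
    fix j assume "j \<in> {..<n}"
    then have "\<bar>a i j\<bar> \<le> \<bar>b\<bar>" using a[of j] b by simp
    then show "(a i j)\<^sup>2 \<le> b\<^sup>2" by (simp only: abs_le_square_iff)
  qed simp
  also have "\<dots> \<le> 1 * b\<^sup>2" unfolding sum_distrib_right[symmetric] by (intro mult_right_mono B2plusD(2)[OF v]) auto
  finally show ?thesis using b by (auto intro: power2_le_imp_le)
qed

text \<open>Jensen's inequality with the weights \<open>v\<^sub>j\<^sup>2\<close>.\<close>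

lemma lnorm_row_wt_le:
  assumes r: "2 \<le> r" and v: "v \<in> B2plus n"
  shows "lnorm s {..<m} (\<lambda>i. row_wt r n a v i * x i) \<le> col_norm s m n a x"
proof -
  define M where "M = col_norm s m n a x"
  have M0: "0 \<le> M" by (simp add: M_def col_norm_nonneg)
  have w0: "0 \<le> row_wt r n a v i" for i by (simp add: row_wt_def)
  have w2: "(row_wt r n a v i * x i)\<^sup>2 \<le> (\<Sum>j<n. (v j)\<^sup>2 * (a i j * x i)\<^sup>2)" for i
  proof -
    have "(row_wt r n a v i * x i)\<^sup>2 \<le> (\<Sum>j<n. (v j)\<^sup>2 * (a i j)\<^sup>2) * (x i)\<^sup>2"
      unfolding power_mult_distrib by (intro mult_right_mono row_wt_power2_le[OF r v]) auto
    then show ?thesis by (simp add: sum_distrib_right power_mult_distrib mult.assoc)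
  qed
  show ?thesis
    using s
  proof (cases rule: exponent_cases)
    case 1
    have "\<bar>row_wt r n a v i * x i\<bar> \<le> M" if i: "i < m" for i
    proof -
      have "(row_wt r n a v i * x i)\<^sup>2 \<le> (\<Sum>j<n. (v j)\<^sup>2 * M\<^sup>2)"
      proof (rule order_trans[OF w2 sum_mono])
        fix j assume "j \<in> {..<n}"
        then have "\<bar>a i j * x i\<bar> \<le> \<bar>M\<bar>" using col_norm_component[OF i, of j x] M0 by (simp add: M_def)
        then show "(v j)\<^sup>2 * (a i j * x i)\<^sup>2 \<le> (v j)\<^sup>2 * M\<^sup>2"
          by (intro mult_left_mono) (simp_all only: abs_le_square_iff zero_le_power2)
      qed
      also have "\<dots> \<le> 1 * M\<^sup>2" unfolding sum_distrib_right[symmetric] by (intro mult_right_mono B2plusD(2)[OF v]) auto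
      finally have "\<bar>row_wt r n a v i * x i\<bar> \<le> \<bar>M\<bar>" by (simp add: abs_le_square_iff)
      then show ?thesis using M0 by simp
    qed
    then show ?thesis unfolding 1 lnorm_infinity M_def[symmetric, unfolded 1]
      using m by (intro Max.boundedI) auto
  next
    case (2 p)
    have "lp p {..<m} (\<lambda>i. row_wt r n a v i * x i) \<le> M"
    proof (rule lp_leI)
      have "(\<Sum>i<m. \<bar>row_wt r n a v i * x i\<bar> powr p) \<le> (\<Sum>i<m. \<Sum>j<n. (v j)\<^sup>2 * \<bar>a i j * x i\<bar> powr p)"
      proof (rule sum_mono)
        fix i
        have sq: "\<bar>y\<bar> powr p = (y\<^sup>2) powr (p / 2)" for y :: real
        proof -
          have "y\<^sup>2 = \<bar>y\<bar> powr 2" by simp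
          then show ?thesis unfolding \<open>y\<^sup>2 = \<bar>y\<bar> powr 2\<close> powr_powr by simp
        qed
        have "\<bar>row_wt r n a v i * x i\<bar> powr p \<le> (\<Sum>j<n. (v j)\<^sup>2 * (a i j * x i)\<^sup>2) powr (p / 2)"
          unfolding sq using 2 by (intro powr_mono2 w2) auto
        also have "\<dots> \<le> (\<Sum>j<n. (v j)\<^sup>2 * ((a i j * x i)\<^sup>2) powr (p / 2))"
          using 2 B2plusD(2)[OF v] by (intro powr_jensen) auto
        finally show "\<bar>row_wt r n a v i * x i\<bar> powr p \<le> (\<Sum>j<n. (v j)\<^sup>2 * \<bar>a i j * x i\<bar> powr p)"
          unfolding sq .
      qed
      also have "\<dots> = (\<Sum>j<n. (v j)\<^sup>2 * (\<Sum>i<m. \<bar>a i j * x i\<bar> powr p))"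
        by (subst sum.swap) (simp add: sum_distrib_left)
      also have "\<dots> \<le> (\<Sum>j<n. (v j)\<^sup>2 * M powr p)"
        using 2 col_norm_ge[of _ x] by (intro sum_mono mult_left_mono lp_leD) (auto simp: M_def lnorm_ereal)
      also have "\<dots> \<le> 1 * M powr p" unfolding sum_distrib_right[symmetric] by (intro mult_right_mono B2plusD(2)[OF v]) auto
      finally show "(\<Sum>i<m. \<bar>row_wt r n a v i * x i\<bar> powr p) \<le> M powr p" by simp
    qed (use 2 M0 in auto)
    then show ?thesis using 2 by (simp add: lnorm_ereal M_def)
  qed
qed

end

lemma row_wt_lipschitz:
  assumes r: "2 \<le> r" and n: "0 < n" and m: "0 < m" and i: "i < m" and v: "v \<in> B2plus n" "v' \<in> B2plus n"
  shows "\<bar>row_wt r n a v i - row_wt r n a v' i\<bar> \<le> 2 * sqrt 2 * col_norm r n m (\<lambda>j i. a i j) (\<lambda>j. v j - v' j)"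
proof -
  have le: "row_wt r n a v i \<le> row_wt r n a v' i + L2_set (\<lambda>j. a i j * (rpow (v j) (expo r) - rpow (v' j) (expo r))) {..<n}" for v v'
    unfolding row_wt_def
    by (rule order_trans[OF _ L2_set_triangle_ineq]) (simp add: algebra_simps)
  have "L2_set (\<lambda>j. a i j * (rpow (v j) (expo r) - rpow (v' j) (expo r))) {..<n} =
     L2_set (\<lambda>j. a i j * (rpow (v' j) (expo r) - rpow (v j) (expo r))) {..<n}"
    by (simp add: L2_set_def power_mult_distrib power2_commute)
  then have "\<bar>row_wt r n a v i - row_wt r n a v' i\<bar> \<le> L2_set (\<lambda>j. a i j * (rpow (v j) (expo r) - rpow (v' j) (expo r))) {..<n}"
    using le[of v v'] le[of v' v] by simp
  also have "\<dots> \<le> 2 * sqrt 2 * lnorm r {..<n} (\<lambda>j. a i j * (v j - v' j))"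
    by (rule L2_rpow_diff[OF r n v])
  also have "\<dots> \<le> 2 * sqrt 2 * col_norm r n m (\<lambda>j i. a i j) (\<lambda>j. v j - v' j)"
    by (intro mult_left_mono col_norm_ge[OF r n m i]) auto
  finally show ?thesis .
qed

text \<open>Product rule. The increment of u^(alpha-1) meets v^beta, whose contribution along the
  row is \<open>row_wt\<close>; the increment of v^beta meets u'^(alpha-1) <= 1 and is controlled by
  the seminorm of v - v'. The outer factor 2 bounds alpha.\<close>

lemma U_row_le:
  assumes s: "2 \<le> s" and r: "2 \<le> r" and n: "0 < n" and m: "0 < m" and i: "i < m"
    and u: "u \<in> B2plus m" "u' \<in> B2plus m" and v: "v \<in> B2plus n" "v' \<in> B2plus n"
  shows "L2_set (\<lambda>j. Umat r s a (u, v) i j - Umat r s a (u', v') i j) {..<n} \<le>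
     2 * (row_wt r n a v i * \<bar>rpow (u i) (expo s - 1) - rpow (u' i) (expo s - 1)\<bar>
       + 2 * sqrt 2 * col_norm r n m (\<lambda>j i. a i j) (\<lambda>j. v j - v' j))"
proof -
  define y y' where "y = rpow (u i) (expo s - 1)" and "y' = rpow (u' i) (expo s - 1)"
  have y': "0 \<le> y'" "y' \<le> 1"
    unfolding y'_def using B2plusD[OF u(2)] i expo_bounds[OF s] by (auto intro: rpow_le_one)
  let ?d = "\<lambda>j. a i j * (rpow (v j) (expo r) - rpow (v' j) (expo r))"
  have "L2_set (\<lambda>j. Umat r s a (u, v) i j - Umat r s a (u', v') i j) {..<n}
     = L2_set (\<lambda>j. expo s * ((y - y') * (a i j * rpow (v j) (expo r)) + y' * ?d j)) {..<n}"
    by (simp add: Umat_def Let_def y_def y'_def algebra_simps)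
  also have "\<dots> = expo s * L2_set (\<lambda>j. (y - y') * (a i j * rpow (v j) (expo r)) + y' * ?d j) {..<n}"
    using expo_bounds[OF s] by (subst L2_set_right_distrib) auto
  also have "\<dots> \<le> expo s * (L2_set (\<lambda>j. (y - y') * (a i j * rpow (v j) (expo r))) {..<n} + L2_set (\<lambda>j. y' * ?d j) {..<n})"
    using expo_bounds[OF s] by (intro mult_left_mono L2_set_triangle_ineq) auto
  also have "\<dots> \<le> 2 * (L2_set (\<lambda>j. (y - y') * (a i j * rpow (v j) (expo r))) {..<n} + L2_set (\<lambda>j. y' * ?d j) {..<n})"
    using expo_bounds[OF s] by (intro mult_right_mono) auto
  also have "L2_set (\<lambda>j. (y - y') * (a i j * rpow (v j) (expo r))) {..<n} = row_wt r n a v i * \<bar>y - y'\<bar>"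
    by (simp add: row_wt_def L2_set_def power_mult_distrib[of "y - y'"] real_sqrt_mult mult.commute flip: sum_distrib_left)
  also have "L2_set (\<lambda>j. y' * ?d j) {..<n} \<le> L2_set ?d {..<n}"
    unfolding L2_set_right_distrib[OF y'(1), symmetric]
    using y' mult_right_mono[of y' 1 "L2_set ?d {..<n}"] by simp
  also have "L2_set ?d {..<n} \<le> 2 * sqrt 2 * lnorm r {..<n} (\<lambda>j. a i j * (v j - v' j))"
    by (rule L2_rpow_diff[OF r n v])
  also have "\<dots> \<le> 2 * sqrt 2 * col_norm r n m (\<lambda>j i. a i j) (\<lambda>j. v j - v' j)"
    by (intro mult_left_mono col_norm_ge[OF r n m i]) auto
  finally show ?thesis unfolding y_def y'_def by simp
qed

section \<open>Codes for a seminorm on the Euclidean ball\<close>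

text \<open>By \<open>half\<close>, h lies above a median of N under the Gaussian measure. It is the
  only information about the size of N that enters the code lengths.\<close>

locale gauss_seminorm =
  fixes I :: "nat set" and N :: "(nat \<Rightarrow> real) \<Rightarrow> real" and h :: real
  assumes I: "finite I"
    and nonneg: "0 \<le> N x"
    and triangle: "N (\<lambda>i. x i + y i) \<le> N x + N y"
    and cmult: "N (\<lambda>i. c * x i) \<le> \<bar>c\<bar> * N x"
    and cong: "(\<And>i. i \<in> I \<Longrightarrow> x i = y i) \<Longrightarrow> N x = N y"
    and meas: "N \<in> borel_measurable (Pi\<^sub>M I (\<lambda>_. borel))"
    and h: "0 < h"
    and half: "1 / 2 \<le> measure (gauss I) {g \<in> space (gauss I). N g \<le> h}"
begin

lemma minus: "N (\<lambda>i. - x i) = N x"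
  using cmult[of "-1" x] cmult[of "-1" "\<lambda>i. - x i"] by simp

lemma diff_commute: "N (\<lambda>i. x i - y i) = N (\<lambda>i. y i - x i)"
  using minus[of "\<lambda>i. x i - y i"] by simp

lemma diff_triangle: "N (\<lambda>i. x i - z i) \<le> N (\<lambda>i. x i - y i) + N (\<lambda>i. y i - z i)"
  using triangle[of "\<lambda>i. x i - y i" "\<lambda>i. y i - z i"] by simp

lemma zero: "N (\<lambda>i. 0) = 0"
  using cmult[of 0 "\<lambda>i. 0"] nonneg[of "\<lambda>i. 0"] by simp

definition sq :: "(nat \<Rightarrow> real) \<Rightarrow> real" where
  "sq y = (\<Sum>i\<in>I. (y i)\<^sup>2)"

text \<open>The squared Euclidean distance from the origin to the N-ball of radius e around z. It
  decreases in e and is at most |z|^2, so its increments between consecutive scales telescope.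
  Near-minimisers are used instead of minimisers, at the price of a slack
  \<open>\<eta>\<close>.\<close>

definition phi :: "(nat \<Rightarrow> real) \<Rightarrow> real \<Rightarrow> real" where
  "phi z e = Inf (sq ` {y. N (\<lambda>i. y i - z i) \<le> e})"

lemma sq_nonneg: "0 \<le> sq y" by (simp add: sq_def sum_nonneg)

lemma phi_le: "N (\<lambda>i. y i - z i) \<le> e \<Longrightarrow> phi z e \<le> sq y"
  unfolding phi_def by (intro cInf_lower bdd_belowI[of _ 0]) (auto simp: sq_nonneg)

lemma phi_nonneg: "0 \<le> e \<Longrightarrow> 0 \<le> phi z e"
  unfolding phi_def
proof (rule cInf_greatest)
  assume "0 \<le> e"
  then have "N (\<lambda>i. z i - z i) \<le> e" by (simp add: zero)
  then show "sq ` {y. N (\<lambda>i. y i - z i) \<le> e} \<noteq> {}" by blast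
qed (auto simp: sq_nonneg)

lemma phi_near:
  assumes "0 \<le> e" "0 < \<eta>"
  shows "\<exists>y. N (\<lambda>i. y i - z i) \<le> e \<and> sq y \<le> phi z e + \<eta>"
proof -
  have "N (\<lambda>i. z i - z i) \<le> e" using assms by (simp add: zero)
  then have "sq ` {y. N (\<lambda>i. y i - z i) \<le> e} \<noteq> {}" by blast
  then have "\<exists>v\<in>sq ` {y. N (\<lambda>i. y i - z i) \<le> e}. v < phi z e + \<eta>"
    unfolding phi_def by (intro cInf_lessD) (use assms in auto)
  then show ?thesis by force
qed

lemma phi_antimono_ball:
  assumes "0 \<le> e" "N (\<lambda>i. a i - z i) + e \<le> e'"
  shows "phi z e' \<le> phi a e"
proof -
  have *: "N (\<lambda>i. a i - a i) \<le> e" using assms by (simp add: zero)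
  show ?thesis
    unfolding phi_def[of a]
  proof (rule cInf_greatest)
    show "sq ` {y. N (\<lambda>i. y i - a i) \<le> e} \<noteq> {}" using * by blast
    fix v assume "v \<in> sq ` {y. N (\<lambda>i. y i - a i) \<le> e}"
    then obtain y where y: "v = sq y" "N (\<lambda>i. y i - a i) \<le> e" by auto
    then show "phi z e' \<le> v" using phi_le[of y z e'] diff_triangle[of y z a] assms(2) by simp
  qed
qed

text \<open>The midpoint of x and y lies in the same convex ball, so its squared length is at least
  \<open>phi a e\<close>; the parallelogram identity turns this into a bound for the
  distance.\<close>

lemma near_minimizers_close:
  assumes x: "N (\<lambda>i. x i - a i) \<le> e" "sq x \<le> phi a e + \<eta>"
    and y: "N (\<lambda>i. y i - a i) \<le> e"
  shows "sq (\<lambda>i. y i - x i) \<le> 2 * (sq y - phi a e) + 2 * \<eta>"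
proof -
  define w where "w = (\<lambda>i. 1 / 2 * (x i + y i))"
  have "N (\<lambda>i. w i - a i) = N (\<lambda>i. 1 / 2 * ((x i - a i) + (y i - a i)))"
    by (simp add: w_def field_simps)
  also have "\<dots> \<le> 1 / 2 * N (\<lambda>i. (x i - a i) + (y i - a i))"
    using cmult[of "1 / 2" "\<lambda>i. (x i - a i) + (y i - a i)"] by simp
  also have "\<dots> \<le> 1 / 2 * (N (\<lambda>i. x i - a i) + N (\<lambda>i. y i - a i))" by (intro mult_left_mono triangle) simp
  also have "\<dots> \<le> e" using x y by simp
  finally have "phi a e \<le> sq w" by (rule phi_le)
  moreover have "sq (\<lambda>i. y i - x i) = 2 * sq y + 2 * sq x - 4 * sq w"
    unfolding sq_def w_def sum_distrib_left sum.distrib[symmetric] sum_subtractf[symmetric]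
    by (intro sum.cong) (auto simp: power2_eq_square field_simps)
  ultimately show ?thesis using x by simp
qed

text \<open>Division by t = d / (2h) turns the separation d into 2h, so that translates of the set
  where N <= h become disjoint and \<open>gauss_packing\<close> applies with c / t^2.\<close>

lemma separated_card:
  assumes F: "finite F" and c: "\<And>z. z \<in> F \<Longrightarrow> sq (\<lambda>i. y z i - x i) \<le> c"
    and sep: "\<And>z z'. \<lbrakk>z \<in> F; z' \<in> F; z \<noteq> z'\<rbrakk> \<Longrightarrow> d < N (\<lambda>i. y z i - y z' i)" and d: "0 < d"
  shows "real (card F) \<le> 2 * exp (2 * c * h\<^sup>2 / d\<^sup>2)"
proof -
  define t where "t = d / (2 * h)"
  have t: "0 < t" using d h by (simp add: t_def)
  define f where "f = (\<lambda>z i. (y z i - x i) / t)"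
  define B where "B = {g \<in> space (gauss I). N g \<le> h}"
  have B: "B \<in> sets (gauss I)"
    unfolding B_def using meas by (simp add: measurable_cong_sets[OF sets_gauss refl, symmetric])
  have far: "2 * h < N (\<lambda>i. f z i - f z' i)" if "z \<in> F" "z' \<in> F" "z \<noteq> z'" for z z'
  proof -
    have "N (\<lambda>i. y z i - y z' i) = N (\<lambda>i. t * (f z i - f z' i))"
    proof -
      have "t * (f z i - f z' i) = y z i - y z' i" for i
        using t by (simp add: f_def flip: diff_divide_distrib)
      then show ?thesis by simp
    qed
    also have "\<dots> \<le> t * N (\<lambda>i. f z i - f z' i)" using cmult[of t "\<lambda>i. f z i - f z' i"] t by simp
    finally have "d < t * N (\<lambda>i. f z i - f z' i)" using sep[OF that] by simp
    then show ?thesis using h d by (simp add: t_def field_simps)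
  qed
  have inj: "inj_on f F"
  proof (rule inj_onI)
    fix z z' assume z: "z \<in> F" "z' \<in> F" "f z = f z'"
    show "z = z'"
    proof (rule ccontr)
      assume "z \<noteq> z'"
      then have "2 * h < N (\<lambda>i. f z i - f z' i)" using far z by blast
      then show False using h z(3) by (simp add: zero)
    qed
  qed
  have "real (card (f ` F)) \<le> 2 * exp ((c / t\<^sup>2) / 2)"
  proof (rule gauss_packing[OF I B])
    show "(\<lambda>i\<in>I. - g i) \<in> B" if "g \<in> B" for g
    proof -
      have "N (\<lambda>i\<in>I. - g i) = N (\<lambda>i. - g i)" by (rule cong) simp
      then show ?thesis using that by (simp add: B_def space_gauss minus)
    qed
    interpret prob_space "gauss I" by (rule prob_space_gauss)
    show "ennreal (1 / 2) \<le> emeasure (gauss I) B"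
      unfolding emeasure_eq_measure B_def by (intro ennreal_leI half)
    show "finite (f ` F)" using F by simp
    show "(\<Sum>i\<in>I. (v i)\<^sup>2) \<le> c / t\<^sup>2" if "v \<in> f ` F" for v
    proof -
      from that obtain z where z: "v = f z" "z \<in> F" by (rule imageE)
      have "(\<Sum>i\<in>I. (v i)\<^sup>2) = sq (\<lambda>i. y z i - x i) / t\<^sup>2"
        by (simp add: z(1) f_def sq_def power_divide sum_divide_distrib)
      then show ?thesis using c[OF z(2)] by (simp add: divide_right_mono)
    qed
    show "\<exists>i\<in>I. g i + v i \<noteq> g' i + v' i"
      if v: "v \<in> f ` F" "v' \<in> f ` F" "v \<noteq> v'" and g: "g \<in> B" "g' \<in> B" for v v' g g'
    proof (rule ccontr)
      assume "\<not> ?thesis"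
      then have "v i - v' i = g' i + (- g i)" if "i \<in> I" for i using that by (simp add: algebra_simps)
      then have "N (\<lambda>i. v i - v' i) = N (\<lambda>i. g' i + (- g i))" by (rule cong)
      also have "\<dots> \<le> N g' + N g" using triangle[of g' "\<lambda>i. - g i"] by (simp add: minus)
      also have "\<dots> \<le> 2 * h" using g by (simp add: B_def)
      finally show False using far v by fastforce
    qed
  qed
  also have "(c / t\<^sup>2) / 2 = 2 * c * h\<^sup>2 / d\<^sup>2" using d h by (simp add: t_def field_simps power2_eq_square)
  finally show ?thesis using card_image[OF inj] by simp
qed

text \<open>The radii r/8 and 4r differ by 2^5, so over dyadic r the differences telescope up to
  five terms. Of the slack 4 \<open>\<eta>\<close>, half comes from each of the two near-minimisers
  involved.\<close>

definition gap :: "(nat \<Rightarrow> real) \<Rightarrow> real \<Rightarrow> real \<Rightarrow> real" where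
  "gap z r \<eta> = 2 * (phi z (r / 8) - phi z (4 * r)) + 4 * \<eta>"

lemma gap_nonneg: "\<lbrakk>0 < r; 0 \<le> \<eta>\<rbrakk> \<Longrightarrow> 0 \<le> gap z r \<eta>"
  using phi_antimono_ball[of "r / 8" z z "4 * r"] by (simp add: gap_def zero)

lemma exists_maximal_separated:
  assumes bound: "\<And>F. \<lbrakk>F \<subseteq> Z; finite F; \<forall>z\<in>F. \<forall>z'\<in>F. z \<noteq> z' \<longrightarrow> \<not> D z z'\<rbrakk> \<Longrightarrow> card F \<le> b"
    and refl: "\<And>z. z \<in> Z \<Longrightarrow> D z z" and sym: "\<And>z z'. D z z' \<Longrightarrow> D z' z"
  shows "\<exists>F. F \<subseteq> Z \<and> finite F \<and> card F \<le> b \<and> (\<forall>z\<in>Z. \<exists>c\<in>F. D z c)"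
proof -
  define P where "P = (\<lambda>F. F \<subseteq> Z \<and> finite F \<and> (\<forall>z\<in>F. \<forall>z'\<in>F. z \<noteq> z' \<longrightarrow> \<not> D z z'))"
  have "P {}" by (simp add: P_def)
  moreover have "\<forall>F. P F \<longrightarrow> card F < Suc b" using bound by (auto simp: P_def less_Suc_eq_le)
  ultimately obtain F where F: "P F" "\<forall>F'. P F' \<longrightarrow> card F' \<le> card F"
    using ex_has_greatest_nat[of P "{}" card "Suc b"] by blast
  have "\<exists>c\<in>F. D z c" if z: "z \<in> Z" for z
  proof (rule ccontr)
    assume *: "\<not> ?thesis"
    then have "z \<notin> F" using refl[OF z] by auto
    moreover have "P (insert z F)" using F(1) * z sym by (auto simp: P_def)
    ultimately show False using F by (auto simp: P_def dest!: spec[of _ "insert z F"])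
  qed
  then show ?thesis using F(1) bound by (auto simp: P_def)
qed

text \<open>Fix a in A and a near-minimiser x of the ball of radius 2r around a. The near-minimiser
  y z of the ball of radius r/8 around z lies in the large ball as well, so its squared distance to
  x is at most \<open>gap z\<close>. Points of code length b therefore have y z in a Euclidean ball
  whose size is governed by b, and a maximal r/16-separated set there has at most 2^b elements.
  Equal keys give distance at most r/8 + r/16 + r/16 + r/8 <= r/2.\<close>

lemma linear_split_code:
  assumes A: "\<And>z z'. \<lbrakk>z \<in> A; z' \<in> A\<rbrakk> \<Longrightarrow> N (\<lambda>i. z i - z' i) \<le> r" and r: "0 < r" and eta: "0 < \<eta>"
  shows "split_code A (\<lambda>z z'. N (\<lambda>i. z i - z' i) \<le> r / 2) (\<lambda>z. 2 + 1024 * gap z r \<eta> * h\<^sup>2 / r\<^sup>2)"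
proof (cases "A = {}")
  case True
  then show ?thesis by (intro split_codeI[where L = "\<lambda>_. 1" and key = "\<lambda>z. z"]) auto
next
  case False
  then obtain a where a: "a \<in> A" by auto
  obtain x where x: "N (\<lambda>i. x i - a i) \<le> 2 * r" "sq x \<le> phi a (2 * r) + \<eta>"
    using phi_near[of "2 * r" \<eta> a] r eta by auto
  have "\<exists>y. N (\<lambda>i. y i - z i) \<le> r / 8 \<and> sq y \<le> phi z (r / 8) + \<eta>" for z
    using phi_near[of "r / 8" \<eta> z] r eta by auto
  then obtain y where y: "\<And>z. N (\<lambda>i. y z i - z i) \<le> r / 8" "\<And>z. sq (y z) \<le> phi z (r / 8) + \<eta>"
    by metis
  have close: "sq (\<lambda>i. y z i - x i) \<le> gap z r \<eta>" if z: "z \<in> A" for z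
  proof -
    have "N (\<lambda>i. y z i - a i) \<le> r / 8 + r" using diff_triangle[of "y z" a z] y(1)[of z] A[OF z a] by linarith
    then have "N (\<lambda>i. y z i - a i) \<le> 2 * r" using r by linarith
    from near_minimizers_close[OF x this]
    have "sq (\<lambda>i. y z i - x i) \<le> 2 * (sq (y z) - phi a (2 * r)) + 2 * \<eta>" .
    \<comment> \<open>This replaces a quantity of the reference point a by one of z itself, so that
      the bound depends on z only.\<close>
    moreover have "phi z (4 * r) \<le> phi a (2 * r)"
      by (rule phi_antimono_ball) (use A[OF a z] r in linarith)+
    ultimately show ?thesis using y(2)[of z] by (simp add: gap_def)
  qed
  \<comment> \<open>With 1024 the exponent 2 * c * h^2 / (r/16)^2 below becomes (b - 1) / 2, and 2 *
    exp((b - 1) / 2) <= 2^b.\<close>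
  define L where "L = (\<lambda>z. nat \<lceil>1 + 1024 * gap z r \<eta> * h\<^sup>2 / r\<^sup>2\<rceil>)"
  have g0: "0 \<le> 1024 * gap z r \<eta> * h\<^sup>2 / r\<^sup>2" for z using gap_nonneg[of r \<eta> z] r eta by simp
  have L: "1 + 1024 * gap z r \<eta> * h\<^sup>2 / r\<^sup>2 \<le> real (L z)" "real (L z) \<le> 2 + 1024 * gap z r \<eta> * h\<^sup>2 / r\<^sup>2" "1 \<le> L z" for z
    using g0[of z] unfolding L_def by linarith+
  define D where "D = (\<lambda>z z'. N (\<lambda>i. y z i - y z' i) \<le> r / 16)"
  have "\<exists>F. F \<subseteq> {z\<in>A. L z = b} \<and> finite F \<and> card F \<le> 2 ^ b \<and> (\<forall>z\<in>{z\<in>A. L z = b}. \<exists>c\<in>F. D z c)" for b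
  proof (rule exists_maximal_separated)
    show "D z z" for z using r by (simp add: D_def zero)
    show "D z z' \<Longrightarrow> D z' z" for z z' by (simp add: D_def diff_commute[of "y z"])
    fix F assume F: "F \<subseteq> {z\<in>A. L z = b}" "finite F" "\<forall>z\<in>F. \<forall>z'\<in>F. z \<noteq> z' \<longrightarrow> \<not> D z z'"
    show "card F \<le> 2 ^ b"
    proof (cases "F = {}")
      case False
      then have b: "1 \<le> b" using F(1) L(3) by auto
      define c where "c = (real b - 1) * r\<^sup>2 / (1024 * h\<^sup>2)"
      have gc: "gap z r \<eta> \<le> c" if "z \<in> F" for z
        using L(1)[of z] that F(1) h r by (auto simp: c_def field_simps)
      have "sq (\<lambda>i. y z i - x i) \<le> c" if "z \<in> F" for z
        using close[of z] gc[OF that] that F(1) by auto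
      then have "real (card F) \<le> 2 * exp (2 * c * h\<^sup>2 / (r / 16)\<^sup>2)"
        using F r by (intro separated_card[of F y x]) (auto simp: D_def not_le)
      also have "2 * c * h\<^sup>2 / (r / 16)\<^sup>2 = (real b - 1) * (1 / 2)" using h r by (simp add: c_def power_divide)
      also have "exp ((real b - 1) * (1 / 2)) = exp (1 / 2) powr (real b - 1)" by (simp add: powr_def mult.commute)
      also have "\<dots> \<le> 2 powr (real b - 1)"
      proof (intro powr_mono2)
        have "exp (1 / 2 :: real) \<le> 1 + 1 / 2 + (1 / 2)\<^sup>2" by (rule exp_bound) auto
        then show "exp (1 / 2 :: real) \<le> 2" by (simp add: power2_eq_square)
      qed (use b in auto)
      also have "2 * (2 powr (real b - 1)) = 2 powr (real b)" by (simp add: powr_diff)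
      also have "\<dots> = real (2 ^ b)" by (simp add: powr_realpow)
      finally show ?thesis by (simp only: of_nat_le_iff)
    qed auto
  qed
  from choice[OF allI[OF this]] obtain F where FF: "\<forall>b. F b \<subseteq> {z\<in>A. L z = b} \<and> finite (F b) \<and> card (F b) \<le> 2 ^ b \<and> (\<forall>z\<in>{z\<in>A. L z = b}. \<exists>c\<in>F b. D z c)" ..
  note FF' = conjunct2[OF spec[OF FF]]
  have F1: "finite (F b)" for b by (rule conjunct1[OF FF'])
  have F2: "card (F b) \<le> 2 ^ b" for b by (rule conjunct1[OF conjunct2[OF FF']])
  have F3: "\<exists>c\<in>F (L z). D z c" if "z \<in> A" for z
  proof -
    have "\<forall>y\<in>{y\<in>A. L y = L z}. \<exists>c\<in>F (L z). D y c"
      by (rule conjunct2[OF conjunct2[OF FF']])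
    moreover have "z \<in> {y\<in>A. L y = L z}" using that by blast
    ultimately show ?thesis by (rule bspec)
  qed
  define key where "key = (\<lambda>z. SOME c. c \<in> F (L z) \<and> D z c)"
  have key: "key z \<in> F (L z) \<and> D z (key z)" if "z \<in> A" for z
    unfolding key_def by (rule someI_ex[of "\<lambda>c. c \<in> F (L z) \<and> D z c"]) (use F3[OF that] in blast)
  have keyF: "key ` {z\<in>A. L z = b} \<subseteq> F b" for b using key by blast
  show ?thesis
  proof (rule split_codeI[where L = L and key = key])
    show "finite (key ` {z\<in>A. L z = b})" for b by (rule finite_subset[OF keyF F1])
    show "card (key ` {z\<in>A. L z = b}) \<le> 2 ^ b" for b
      by (rule order_trans[OF card_mono[OF F1 keyF] F2])
    fix z z' assume z: "z \<in> A" "z' \<in> A" "L z = L z'" "key z = key z'"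
    have 1: "N (\<lambda>i. y z i - y (key z) i) \<le> r / 16" "N (\<lambda>i. y (key z) i - y z' i) \<le> r / 16"
      using key[OF z(1)] key[OF z(2)] z(4) by (auto simp: D_def diff_commute[of "y z'"])
    have 2: "N (\<lambda>i. z i - y z i) \<le> r / 8" using y(1)[of z] by (simp add: diff_commute[of z])
    show "N (\<lambda>i. z i - z' i) \<le> r / 2"
      using diff_triangle[of z z' "y z"] diff_triangle[of "y z" z' "y (key z)"] diff_triangle[of "y (key z)" z' "y z'"]
        1 2 y(1)[of z'] r by linarith
  qed (use L in auto)
qed

definition lin_bnd :: "real \<Rightarrow> nat \<Rightarrow> (nat \<Rightarrow> real) \<Rightarrow> real" where
  "lin_bnd r l z = 2 + 1024 * gap z (r / 2 ^ l) (1 / 2 ^ l) * h\<^sup>2 / (r / 2 ^ l)\<^sup>2"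

lemma linear_split_code_level:
  assumes "\<And>z z'. \<lbrakk>z \<in> A; z' \<in> A\<rbrakk> \<Longrightarrow> N (\<lambda>i. z i - z' i) \<le> r / 2 ^ l" and "0 < r"
  shows "split_code A (\<lambda>z z'. N (\<lambda>i. z i - z' i) \<le> r / 2 ^ Suc l) (lin_bnd r l)"
  using linear_split_code[of A "r / 2 ^ l" "1 / 2 ^ l"] assms by (simp add: lin_bnd_def[abs_def] mult.commute)

text \<open>Division by 4^l cancels the dyadic part of the squared radius, leaving the plain sum of
  the gaps. The telescoping sum leaves at most five terms of size at most 1, doubled; the slacks 4 /
  2^l add at most 8. This gives 18, and 1024 * 18 = 18432.\<close>

lemma lin_bnd_sum:
  assumes z: "sq z \<le> 1" and r: "0 < r"
  shows "(\<Sum>l<K. lin_bnd r l z / 4 ^ l) \<le> 4 + 18432 * h\<^sup>2 / r\<^sup>2"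
proof -
  define \<psi> where "\<psi> = (\<lambda>k. phi z (4 * r / 2 ^ k))"
  have psi: "0 \<le> \<psi> k" "\<psi> k \<le> 1" for k
    using phi_nonneg[of "4 * r / 2 ^ k" z] phi_le[of z z "4 * r / 2 ^ k"] z r by (auto simp: \<psi>_def zero)
  have gap: "gap z (r / 2 ^ l) (1 / 2 ^ l) = 2 * (\<psi> (l + 5) - \<psi> l) + 4 / 2 ^ l" for l
    by (simp add: gap_def \<psi>_def power_add mult.commute)
  have tele: "(\<Sum>l<K. \<psi> (l + 5) - \<psi> l) = (\<Sum>j<5. \<psi> (K + j) - \<psi> j)"
    by (induction K) (simp_all add: eval_nat_numeral)
  have "(\<Sum>l<K. \<psi> (l + 5) - \<psi> l) \<le> 5"
    unfolding tele using sum_mono[of "{..<5::nat}" "\<lambda>j. \<psi> (K + j) - \<psi> j" "\<lambda>_. 1"] psi by (simp add: diff_le_eq add_increasing2 order_trans)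
  moreover have "(\<Sum>l<K. 1 / 2 ^ l) \<le> (2::real)"
    using geometric_sum[of "1 / 2 :: real" K] by (simp add: power_one_over)
  ultimately have G: "(\<Sum>l<K. gap z (r / 2 ^ l) (1 / 2 ^ l)) \<le> 18"
    unfolding gap sum.distrib sum_distrib_left[symmetric]
    using sum_distrib_left[of 4 "\<lambda>l. 1 / 2 ^ l :: real" "{..<K}"] by simp
  have "lin_bnd r l z / 4 ^ l = 2 * (1 / 4) ^ l + (1024 * h\<^sup>2 / r\<^sup>2) * gap z (r / 2 ^ l) (1 / 2 ^ l)" for l
  proof -
    have "(2 ^ l)\<^sup>2 = (4::real) ^ l" by (simp add: power2_eq_square flip: power_mult_distrib)
    then show ?thesis using r by (simp add: lin_bnd_def power_divide power_one_over field_simps)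
  qed
  then have "(\<Sum>l<K. lin_bnd r l z / 4 ^ l) = 2 * (\<Sum>l<K. (1 / 4) ^ l) + (1024 * h\<^sup>2 / r\<^sup>2) * (\<Sum>l<K. gap z (r / 2 ^ l) (1 / 2 ^ l))"
    by (simp add: sum.distrib sum_distrib_left)
  also have "(\<Sum>l<K. (1 / 4) ^ l) \<le> (2::real)"
  proof -
    have "0 \<le> (1 / 4 :: real) ^ K" by (rule zero_le_power) simp
    moreover have "(\<Sum>l<K. (1 / 4) ^ l) = (4 - 4 * (1 / 4) ^ K) / (3::real)"
      by (induction K) simp_all
    moreover have "(4 - 4 * q) / 3 \<le> 2" if "0 \<le> q" for q :: real using that by simp
    ultimately show ?thesis by metis
  qed
  also have "(1024 * h\<^sup>2 / r\<^sup>2) * (\<Sum>l<K. gap z (r / 2 ^ l) (1 / 2 ^ l)) \<le> (1024 * h\<^sup>2 / r\<^sup>2) * 18"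
    by (intro mult_left_mono G) simp
  finally show ?thesis by simp
qed

end

section \<open>Codes for the coordinates\<close>

text \<open>Kraft's argument for the product prior that gives the value 0 weight 1 and the value k >
  0 weight \<open>\<delta> i\<close> / 2^k. The total weight is at most exp(S) with S the sum of the
  \<open>\<delta> i\<close>, and a key of length b has weight at least 2^(2S - b). The factors 2
  convert natural to binary logarithms, since 1 <= 2 * ln 2.\<close>

lemma coordinate_split_code:
  fixes q :: "'a \<Rightarrow> 'i \<Rightarrow> nat" and \<delta> :: "'i \<Rightarrow> real"
  assumes I: "finite I" and d: "\<And>i. i \<in> I \<Longrightarrow> 0 < \<delta> i" "\<And>i. i \<in> I \<Longrightarrow> \<delta> i \<le> 1"
  shows "split_code A (\<lambda>z z'. \<forall>i\<in>I. q z i = q z' i)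
    (\<lambda>z. 2 + 2 * (\<Sum>i\<in>I. \<delta> i) + (\<Sum>i\<in>I. if q z i = 0 then 0 else 2 * ln (1 / \<delta> i) + real (q z i)))"
proof -
  define S where "S = (\<Sum>i\<in>I. \<delta> i)"
  define c1 where "c1 = (\<lambda>(k::nat) i. if k = 0 then 0 else 2 * ln (1 / \<delta> i) + real k)"
  define cst where "cst = (\<lambda>z. \<Sum>i\<in>I. c1 (q z i) i)"
  define L where "L = (\<lambda>z. nat \<lceil>1 + 2 * S + cst z\<rceil>)"
  define key where "key = (\<lambda>z. restrict (q z) I)"
  define w where "w = (\<lambda>i (k::nat). if k = 0 then 1 else \<delta> i / 2 ^ k)"
  have S0: "0 \<le> S" unfolding S_def using d by (intro sum_nonneg) (auto intro: less_imp_le)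
  have ln0: "0 \<le> ln (1 / \<delta> i)" if "i \<in> I" for i using d[OF that] by simp
  have c1_ge: "real k \<le> c1 k i" if "i \<in> I" for i k using ln0[OF that] by (simp add: c1_def)
  have c1_0: "0 \<le> c1 k i" if "i \<in> I" for i k using c1_ge[OF that, of k] by linarith
  have cst0: "0 \<le> cst z" for z unfolding cst_def by (intro sum_nonneg c1_0)
  have L: "1 + 2 * S + cst z \<le> real (L z)" "real (L z) \<le> 2 + 2 * S + cst z" "1 \<le> L z" for z
    unfolding L_def using S0 cst0[of z] by linarith+
  have w0: "0 \<le> w i k" if "i \<in> I" for i k using d[OF that] by (simp add: w_def)
  have w_ge: "2 powr (- c1 k i) \<le> w i k" if i: "i \<in> I" for i k
  proof (cases "k = 0")
    case False
    have "2 powr (- (2 * ln (1 / \<delta> i))) = exp (- (ln (1 / \<delta> i)) * (2 * ln 2))" by (simp add: powr_def)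
    also have "\<dots> \<le> exp (- ln (1 / \<delta> i) * 1)"
    proof -
      have "1 \<le> 2 * ln (2::real)" using ln2_ge_two_thirds by simp
      then have "ln (1 / \<delta> i) * 1 \<le> ln (1 / \<delta> i) * (2 * ln 2)" by (intro mult_left_mono ln0[OF i])
      then show ?thesis by simp
    qed
    also have "\<dots> = \<delta> i" using d[OF i] by (simp add: ln_div)
    finally have *: "2 powr (- (2 * ln (1 / \<delta> i))) \<le> \<delta> i" .
    have "2 powr (- c1 k i) = 2 powr (- (2 * ln (1 / \<delta> i))) * 2 powr (- real k)"
      using False by (simp add: c1_def flip: powr_add)
    also have "2 powr (- real k) = 1 / 2 ^ k" by (simp add: powr_minus_divide powr_realpow)
    also have "2 powr (- (2 * ln (1 / \<delta> i))) * (1 / 2 ^ k) \<le> \<delta> i * (1 / 2 ^ k)"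
      by (intro mult_right_mono *) simp
    finally show ?thesis using False by (simp add: w_def)
  qed (simp add: w_def c1_def)
  \<comment> \<open>A value k costs at least k bits, so keys of length b take values up to b only
    and the total weight becomes a finite product of sums.\<close>
  have keyP: "key ` {z\<in>A. L z = b} \<subseteq> I \<rightarrow>\<^sub>E {..b}" for b
  proof
    fix k assume "k \<in> key ` {z\<in>A. L z = b}"
    then obtain z where z: "k = key z" "L z = b" by auto
    have "q z i \<le> b" if i: "i \<in> I" for i
    proof -
      have "c1 (q z i) i \<le> cst z" unfolding cst_def by (rule member_le_sum) (use i I c1_0 in auto)
      then have "real (q z i) \<le> real b" using c1_ge[OF i, of "q z i"] L(1)[of z] S0 z(2) by linarith
      then show ?thesis by simp
    qed
    then show "k \<in> I \<rightarrow>\<^sub>E {..b}" by (auto simp: z(1) key_def)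
  qed
  have fin: "finite (I \<rightarrow>\<^sub>E {..b})" for b :: nat using I by (simp add: finite_PiE)
  have card: "card (key ` {z\<in>A. L z = b}) \<le> 2 ^ b" for b
  proof -
    let ?K = "key ` {z\<in>A. L z = b}"
    have fK: "finite ?K" by (rule finite_subset[OF keyP fin])
    have lower: "2 powr (2 * S - real b) \<le> (\<Prod>i\<in>I. w i (k i))" if "k \<in> ?K" for k
    proof -
      from that obtain z where z: "k = key z" "L z = b" by auto
      have "2 powr (2 * S - real b) \<le> 2 powr (- cst z)" using L(1)[of z] z(2) by simp
      also have "\<dots> = (\<Prod>i\<in>I. 2 powr (- c1 (q z i) i))"
        unfolding cst_def sum_negf[symmetric] using I by (simp add: powr_sum)
      also have "\<dots> \<le> (\<Prod>i\<in>I. w i (q z i))" by (rule prod_mono) (use w_ge in auto)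
      also have "\<dots> = (\<Prod>i\<in>I. w i (k i))" by (rule prod.cong) (auto simp: z(1) key_def)
      finally show ?thesis .
    qed
    have "real (card ?K) * 2 powr (2 * S - real b) \<le> (\<Sum>k\<in>?K. \<Prod>i\<in>I. w i (k i))"
      using sum_mono[OF lower, of ?K "\<lambda>k. k"] by simp
    also have "\<dots> \<le> (\<Sum>k\<in>I \<rightarrow>\<^sub>E {..b}. \<Prod>i\<in>I. w i (k i))"
      by (rule sum_mono2[OF fin keyP]) (auto intro!: prod_nonneg w0)
    also have "\<dots> = (\<Prod>i\<in>I. \<Sum>k\<le>b. w i k)" by (rule prod_sum_PiE[symmetric]) (use I in auto)
    also have "\<dots> \<le> (\<Prod>i\<in>I. exp (\<delta> i))"
    proof (rule prod_mono, rule conjI)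
      fix i assume i: "i \<in> I"
      show "0 \<le> (\<Sum>k\<le>b. w i k)" by (intro sum_nonneg w0[OF i])
      have "(\<Sum>k\<le>b. w i k) = 1 + \<delta> i * (1 - 1 / 2 ^ b)"
        by (induction b) (auto simp: w_def field_simps)
      also have "\<dots> \<le> 1 + \<delta> i * 1" using d[OF i] by (intro add_left_mono mult_left_mono) auto
      also have "\<dots> \<le> exp (\<delta> i)" using exp_ge_add_one_self[of "\<delta> i"] by simp
      finally show "(\<Sum>k\<le>b. w i k) \<le> exp (\<delta> i)" .
    qed
    also have "\<dots> = exp S" unfolding S_def by (rule exp_sum[OF I, symmetric])
    also have "\<dots> \<le> 2 powr (2 * S)"
    proof -
      have "S * 1 \<le> S * (2 * ln 2)" using ln2_ge_two_thirds by (intro mult_left_mono S0) simp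
      then show ?thesis by (simp add: powr_def mult.assoc mult.left_commute)
    qed
    finally have "real (card ?K) * 2 powr (2 * S - real b) \<le> 2 powr (2 * S)" .
    then have "real (card ?K) * 2 powr (2 * S - real b) * 2 powr (real b - 2 * S) \<le> 2 powr (2 * S) * 2 powr (real b - 2 * S)"
      by (rule mult_right_mono) simp
    then have "real (card ?K) \<le> 2 powr real b" by (simp add: mult.assoc flip: powr_add)
    then have "real (card ?K) \<le> real (2 ^ b)" by (simp add: powr_realpow)
    then show ?thesis by (simp only: of_nat_le_iff)
  qed
  show ?thesis
  proof (rule split_codeI[where L = L and key = key])
    show "finite (key ` {z\<in>A. L z = b})" for b by (rule finite_subset[OF keyP fin])
    show "card (key ` {z\<in>A. L z = b}) \<le> 2 ^ b" for b by (rule card)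
    show "1 \<le> L z" for z by (rule L)
    show "real (L z) \<le> 2 + 2 * (\<Sum>i\<in>I. \<delta> i) + (\<Sum>i\<in>I. if q z i = 0 then 0 else 2 * ln (1 / \<delta> i) + real (q z i))" for z
      using L(2)[of z] by (simp add: S_def cst_def c1_def)
    show "\<forall>i\<in>I. q z i = q z' i" if "key z = key z'" for z z'
    proof
      fix i assume "i \<in> I"
      then show "q z i = q z' i" using fun_cong[OF that, of i] by (simp add: key_def)
    qed
  qed
qed

section \<open>Sums over dyadic scales\<close>

lemma sum_small_dyadic:
  fixes y :: real
  assumes y: "0 \<le> y"
  shows "(\<Sum>l<K. if 1 / 2 ^ l \<le> y then 1 / 2 ^ l else 0) \<le> 2 * y"
proof -
  define X where "X = (\<lambda>K. \<Sum>l<K. if 1 / 2 ^ l \<le> y then 1 / 2 ^ l else (0::real))"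
  \<comment> \<open>Until the first term is counted the sum is 0; from then on room for the
    remaining tail 2 / 2^K is kept.\<close>
  have "X K \<le> 0 \<or> X K \<le> 2 * y - 2 * (1 / 2 ^ K)"
  proof (induction K)
    case (Suc K)
    have h: "2 * (1 / 2 ^ Suc K) = (1 / 2 ^ K :: real)" by simp
    show ?case
    proof (cases "1 / 2 ^ K \<le> y")
      case True
      then have "X (Suc K) = X K + 1 / 2 ^ K" by (simp add: X_def)
      then show ?thesis using Suc y True h by linarith
    next
      case False
      then have "X (Suc K) = X K" by (simp add: X_def)
      then show ?thesis using Suc False by linarith
    qed
  qed (simp add: X_def)
  moreover have "0 \<le> (1 / 2 ^ K :: real)" by simp
  ultimately have "X K \<le> 2 * y" using y by linarith
  then show ?thesis by (simp add: X_def)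
qed

lemma sum_small_dyadic_sq:
  fixes y :: real
  assumes y: "0 \<le> y"
  shows "(\<Sum>l<K. if 1 / 2 ^ l \<le> y then 1 / 4 ^ l else 0) \<le> 2 * y\<^sup>2"
proof -
  have "(\<Sum>l<K. if 1 / 2 ^ l \<le> y then 1 / 4 ^ l else 0) \<le> (\<Sum>l<K. y * (if 1 / 2 ^ l \<le> y then 1 / 2 ^ l else 0))"
  proof (rule sum_mono)
    fix l
    have "1 / 4 ^ l = (1 / 2 ^ l) * (1 / 2 ^ l :: real)" by (simp flip: power_mult_distrib)
    moreover have "(1 / 2 ^ l) * (1 / 2 ^ l) \<le> y * (1 / 2 ^ l)" if "1 / 2 ^ l \<le> y" by (rule mult_right_mono[OF that]) simp
    ultimately show "(if 1 / 2 ^ l \<le> y then 1 / 4 ^ l else 0) \<le> y * (if 1 / 2 ^ l \<le> y then 1 / 2 ^ l else 0)" by simp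
  qed
  also have "\<dots> \<le> y * (2 * y)" unfolding sum_distrib_left[symmetric] by (intro mult_left_mono sum_small_dyadic y)
  finally show ?thesis by (simp add: power2_eq_square)
qed

text \<open>This is the reason for the fourth power in the prior: (x * 2^l)^4 / 4^l grows with l as
  long as x * 2^l < 1, so that part of the sum is dominated by its last terms, of order x^2. Beyond
  it the tail of 4^-l is of order x^2 as well.\<close>

lemma sum_min_dyadic:
  fixes x :: real
  assumes x: "0 \<le> x"
  shows "(\<Sum>l<K. min 1 ((x * 2 ^ l) ^ 4) / 4 ^ l) \<le> 4 * x\<^sup>2"
proof (cases "x = 0")
  case False
  then have x: "0 < x" using x by simp
  have "(\<Sum>l<K. min 1 ((x * 2 ^ l) ^ 4) / 4 ^ l) \<le> (\<Sum>l<K. (if 1 / 2 ^ l \<le> x then 1 / 4 ^ l else 0) + (if 2 ^ l < 1 / x then x ^ 3 * 2 ^ l else 0))"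
  proof (rule sum_mono)
    fix l
    show "min 1 ((x * 2 ^ l) ^ 4) / 4 ^ l \<le> (if 1 / 2 ^ l \<le> x then 1 / 4 ^ l else 0) + (if 2 ^ l < 1 / x then x ^ 3 * 2 ^ l else 0)"
    proof (cases "1 / 2 ^ l \<le> x")
      case True
      have "min 1 ((x * 2 ^ l) ^ 4) / 4 ^ l \<le> 1 / 4 ^ l" by (intro divide_right_mono) auto
      moreover have "0 \<le> x ^ 3 * 2 ^ l" using x by simp
      ultimately show ?thesis using True by simp
    next
      case False
      then have lt: "x * 2 ^ l < 1" "2 ^ l < 1 / x" using x by (simp_all add: field_simps)
      have "min 1 ((x * 2 ^ l) ^ 4) / 4 ^ l \<le> (x * 2 ^ l) ^ 4 / 4 ^ l" by (intro divide_right_mono) auto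
      also have four: "(4::real) ^ l = 2 ^ l * 2 ^ l" by (simp flip: power_mult_distrib)
      also have "(x * 2 ^ l) ^ 4 / (2 ^ l * 2 ^ l) = x ^ 3 * 2 ^ l * (x * 2 ^ l)" by (simp add: eval_nat_numeral)
      also have "\<dots> \<le> x ^ 3 * 2 ^ l * 1" using lt x by (intro mult_left_mono) auto
      finally show ?thesis using False lt by (simp add: four)
    qed
  qed
  also have "\<dots> \<le> 2 * x\<^sup>2 + x ^ 3 * (2 * (1 / x))"
    unfolding sum.distrib
  proof (rule add_mono)
    show "(\<Sum>l<K. if 1 / 2 ^ l \<le> x then 1 / 4 ^ l else 0) \<le> 2 * x\<^sup>2" by (rule sum_small_dyadic_sq) (use x in simp)
    have "(\<Sum>l<K. if 2 ^ l < 1 / x then x ^ 3 * 2 ^ l else 0) = x ^ 3 * (\<Sum>l\<in>{l\<in>{..<K}. 2 ^ l < 1 / x}. 2 ^ l)"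
      by (simp add: sum.If_cases sum_distrib_left Int_def)
    also have "\<dots> \<le> x ^ 3 * (2 * (1 / x))" using x by (intro mult_left_mono sum_two_powers_le) auto
    finally show "(\<Sum>l<K. if 2 ^ l < 1 / x then x ^ 3 * 2 ^ l else 0) \<le> x ^ 3 * (2 * (1 / x))" .
  qed
  also have "\<dots> = 4 * x\<^sup>2" using x by (simp add: eval_nat_numeral)
  finally show ?thesis .
qed simp

text \<open>For x >= 0 the value at infinity is the pointwise limit of min(1, x^p) as p
  grows.\<close>

definition trunc_pow :: "ereal \<Rightarrow> real \<Rightarrow> real" where
  "trunc_pow s x = (if s = \<infinity> then (if 1 \<le> x then 1 else 0) else min 1 (x powr real_of_ereal s))"

lemma trunc_pow_bounds: "0 \<le> trunc_pow s x" "trunc_pow s x \<le> 1"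
  by (auto simp: trunc_pow_def)

lemma trunc_pow_measurable [measurable]: "trunc_pow s \<in> borel_measurable borel"
  unfolding trunc_pow_def[abs_def] by measurable

context
  fixes s :: ereal and H :: real
  assumes s: "2 \<le> s" and H: "0 < H"
begin

lemma trunc_pow_mono: "\<lbrakk>0 \<le> x; x \<le> y\<rbrakk> \<Longrightarrow> trunc_pow s x \<le> trunc_pow s y"
  using s
proof (cases rule: exponent_cases)
  case (2 p)
  assume "0 \<le> x" "x \<le> y"
  then have "x powr p \<le> y powr p" using 2 by (intro powr_mono2) auto
  then show ?thesis using 2 by (simp add: trunc_pow_def)
qed (auto simp: trunc_pow_def)

text \<open>The exponent \<open>2 - expo s\<close> is 2/s, so the power s of the hypothesis is u^2
  <= x^s; at infinity the hypothesis reads 1 <= x.\<close>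

lemma trunc_pow_ge:
  assumes u: "0 < u" "u \<le> 1" and x: "u powr (2 - expo s) \<le> x"
  shows "u\<^sup>2 \<le> trunc_pow s x"
  using s
proof (cases rule: exponent_cases)
  case 1
  then have "1 \<le> x" using x u by (simp add: expo_def)
  then show ?thesis using 1 u by (simp add: trunc_pow_def power_le_one)
next
  case (2 p)
  have "(u powr (2 / p)) powr p \<le> x powr p" using x 2 by (intro powr_mono2) (auto simp: expo_def)
  then have "u\<^sup>2 \<le> x powr p" using u 2 by (simp add: powr_powr)
  then show ?thesis using 2 u by (simp add: trunc_pow_def power_le_one)
qed

definition trunc_mean :: "real \<Rightarrow> real" where
  "trunc_mean w = (\<integral>x. trunc_pow s (w * \<bar>x\<bar> / (4 * H)) \<partial>std)"

lemma trunc_integrable: "integrable std (\<lambda>x. trunc_pow s (w * \<bar>x\<bar> / (4 * H)))"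
proof -
  interpret prob_space std by (rule prob_space_std)
  show ?thesis by (rule integrable_const_bound[where B = 1]) (auto simp: trunc_pow_bounds)
qed

lemma trunc_mean_nonneg: "0 \<le> trunc_mean w"
  unfolding trunc_mean_def by (intro Bochner_Integration.integral_nonneg) (simp add: trunc_pow_bounds)

lemma trunc_mean_mono: "\<lbrakk>0 \<le> w; w \<le> w'\<rbrakk> \<Longrightarrow> trunc_mean w \<le> trunc_mean w'"
  unfolding trunc_mean_def using H
  by (intro integral_mono trunc_integrable trunc_pow_mono divide_right_mono mult_right_mono) auto

lemma trunc_mean_ge:
  assumes w: "0 \<le> w" and u: "0 < u" "u \<le> 1" and b: "0 \<le> b" and x: "u powr (2 - expo s) \<le> w * b / (4 * H)"
  shows "u\<^sup>2 * exp (- b\<^sup>2) / 8 \<le> trunc_mean w"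
proof -
  interpret prob_space std by (rule prob_space_std)
  have "exp (- b\<^sup>2) / 8 \<le> prob {x. b \<le> \<bar>x\<bar>}"
    using std_tail_lower[OF b] by (simp add: emeasure_eq_measure)
  then have "u\<^sup>2 * (exp (- b\<^sup>2) / 8) \<le> u\<^sup>2 * prob {x. b \<le> \<bar>x\<bar>}" by (rule mult_left_mono) simp
  also have "\<dots> = (\<integral>x. u\<^sup>2 * indicator {x. b \<le> \<bar>x\<bar>} x \<partial>std)" by simp
  also have "\<dots> \<le> trunc_mean w"
    unfolding trunc_mean_def
  proof (rule integral_mono[OF _ trunc_integrable])
    show "integrable std (\<lambda>x. u\<^sup>2 * indicator {x. b \<le> \<bar>x\<bar>} x)"
      by (rule integrable_const_bound[where B = "u\<^sup>2"]) (auto simp: indicator_def)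
    fix x
    have "u\<^sup>2 \<le> trunc_pow s (w * \<bar>x\<bar> / (4 * H))" if "b \<le> \<bar>x\<bar>"
    proof (rule trunc_pow_ge[OF u])
      have "w * b / (4 * H) \<le> w * \<bar>x\<bar> / (4 * H)" using w H that by (intro divide_right_mono mult_left_mono) auto
      then show "u powr (2 - expo s) \<le> w * \<bar>x\<bar> / (4 * H)" using \<open>u powr (2 - expo s) \<le> w * b / (4 * H)\<close> by linarith
    qed
    then show "u\<^sup>2 * indicator {x. b \<le> \<bar>x\<bar>} x \<le> trunc_pow s (w * \<bar>x\<bar> / (4 * H))"
      by (auto simp: indicator_def trunc_pow_bounds)
  qed
  finally show ?thesis by simp
qed

text \<open>The typical size of the \<open>i\<close>-th coordinate of \<open>w\<^sub>i u\<^sub>i\<^sup>\<alpha>\<^sup>-\<^sup>1 / H\<close>: the code charges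
  the logarithm of the ratio of a coordinate to this scale.\<close>

definition coord_scale :: "real \<Rightarrow> real" where
  "coord_scale w = w / H * (8 * trunc_mean w) powr ((expo s - 1) / 2)"

lemma coord_scale_nonneg: "0 \<le> w \<Longrightarrow> 0 \<le> coord_scale w"
  using H by (simp add: coord_scale_def)

lemma trunc_mean_lower:
  assumes w: "0 < w" and u: "0 < u" "u \<le> 1"
  shows "u\<^sup>2 * exp (- (u powr (2 - expo s) * (4 * H) / w)\<^sup>2) / 8 \<le> trunc_mean w"
  by (rule trunc_mean_ge) (use w u H in auto)

lemma trunc_mean_pos: "0 < w \<Longrightarrow> 0 < trunc_mean w"
  using trunc_mean_lower[of w 1] by (smt (verit) divide_pos_pos exp_gt_zero mult_pos_pos zero_less_power)

lemma coord_scale_pos: "0 < w \<Longrightarrow> 0 < coord_scale w"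
  using H trunc_mean_pos[of w] by (simp add: coord_scale_def)

lemma coord_scale_mono: "\<lbrakk>0 \<le> w; w \<le> w'\<rbrakk> \<Longrightarrow> coord_scale w \<le> coord_scale w'"
  unfolding coord_scale_def using H expo_bounds[OF s] trunc_mean_nonneg
  by (intro mult_mono divide_right_mono powr_mono2 trunc_mean_mono mult_left_mono) auto

text \<open>Put e = alpha - 1 and a = 4H * u^(1-e) / w. The Gaussian tail gives 8 *
  \<open>trunc_mean w\<close> >= u^2 * exp(-a^2), so the logarithm of f over the scale is at most
  a^2 / 2. The weight cancels in f * a = 4u, which leaves 8u^2. Thus the logarithmic costs are
  charged to the Euclidean length of u.\<close>

lemma coord_scale_log:
  assumes w: "0 < w" and u: "0 < u" "u \<le> 1"
  defines "f \<equiv> w / H * u powr (expo s - 1)"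
  shows "f\<^sup>2 * ln (f / coord_scale w) \<le> 8 * u\<^sup>2"
proof -
  define \<epsilon> where "\<epsilon> = expo s - 1"
  have e: "0 \<le> \<epsilon>" "\<epsilon> \<le> 1" using expo_bounds[OF s] by (auto simp: \<epsilon>_def)
  define E where "E = trunc_mean w"
  have E: "0 < E" using trunc_mean_pos[OF w] by (simp add: E_def)
  define a where "a = u powr (1 - \<epsilon>) * (4 * H) / w"
  have "u\<^sup>2 * exp (- a\<^sup>2) \<le> 8 * E"
    using trunc_mean_lower[OF w u] by (simp add: E_def a_def \<epsilon>_def)
  then have "ln (u\<^sup>2 * exp (- a\<^sup>2)) \<le> ln (8 * E)" using u E by (subst ln_le_cancel_iff) auto
  then have lnE: "ln (u\<^sup>2) - ln (8 * E) \<le> a\<^sup>2" using u by (simp add: ln_mult)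
  have f: "f = w / H * u powr \<epsilon>" by (simp add: f_def \<epsilon>_def)
  have "f / coord_scale w = u powr \<epsilon> / (8 * E) powr (\<epsilon> / 2)"
    using w H by (simp add: f coord_scale_def E_def \<epsilon>_def)
  then have "ln (f / coord_scale w) = \<epsilon> * ln u - \<epsilon> / 2 * ln (8 * E)"
    using u E by (simp add: ln_div)
  also have "\<dots> = \<epsilon> / 2 * (ln (u\<^sup>2) - ln (8 * E))" using u by (simp add: ln_realpow right_diff_distrib)
  also have "\<dots> \<le> \<epsilon> / 2 * a\<^sup>2" by (intro mult_left_mono lnE) (use e in simp)
  also have "\<dots> \<le> 1 / 2 * a\<^sup>2" using e by (intro mult_right_mono) auto
  finally have "f\<^sup>2 * ln (f / coord_scale w) \<le> f\<^sup>2 * (1 / 2 * a\<^sup>2)" by (intro mult_left_mono) auto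
  also have "\<dots> = 1 / 2 * (f * a)\<^sup>2" by (simp add: power_mult_distrib)
  also have "f * a = 4 * (u powr \<epsilon> * u powr (1 - \<epsilon>))" using w H by (simp add: f a_def)
  also have "u powr \<epsilon> * u powr (1 - \<epsilon>) = u" using u by (simp flip: powr_add)
  finally show ?thesis by (simp add: power_mult_distrib)
qed

text \<open>Makes the scales square-summable. With y = w / (8H) <= 1, choose u so that u^(1-e) = y
  and evaluate the tail at 1: this gives y^2 <= (24E)^(1-e), where E is the truncated mean and 24 =
  8 * 3 uses exp(1) <= 3. The other factor of the squared scale is (8E)^e, and 64 * 24 =
  1536.\<close>

lemma coord_scale_sq_le:
  assumes w: "0 \<le> w" "w \<le> 8 * H"
  shows "(coord_scale w)\<^sup>2 \<le> 1536 * trunc_mean w"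
proof (cases "w = 0")
  case True
  then show ?thesis using trunc_mean_nonneg by (simp add: coord_scale_def)
next
  case False
  define \<epsilon> where "\<epsilon> = expo s - 1"
  have e: "0 \<le> \<epsilon>" "\<epsilon> \<le> 1" using expo_bounds[OF s] by (auto simp: \<epsilon>_def)
  define E where "E = trunc_mean w"
  have E: "0 < E" using trunc_mean_pos[of w] False w by (simp add: E_def)
  define y where "y = w / (8 * H)"
  have y: "0 < y" "y \<le> 1" using w False H by (auto simp: y_def)
  have y2: "y\<^sup>2 \<le> (24 * E) powr (1 - \<epsilon>)"
  \<comment> \<open>The case of infinite s, where no such u need exist; the right-hand side is then
    a power with exponent 0 of a positive number, hence 1.\<close>
  proof (cases "\<epsilon> = 1")
    case True
    then show ?thesis using y E by (simp add: power_le_one)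
  next
    case False
    define u where "u = y powr (1 / (1 - \<epsilon>))"
    have u: "0 < u" "u \<le> 1" using y e by (auto simp: u_def intro: powr_le1)
    have uy: "u powr (1 - \<epsilon>) = y" using False y by (simp add: u_def powr_powr)
    have "u\<^sup>2 * exp (- 1\<^sup>2) / 8 \<le> E" unfolding E_def
      by (rule trunc_mean_ge) (use u uy w H in \<open>auto simp: \<epsilon>_def y_def field_simps\<close>)
    moreover have "u\<^sup>2 * (1 / 3) \<le> u\<^sup>2 * exp (- 1\<^sup>2)"
      using exp_le by (intro mult_left_mono) (simp_all add: exp_minus field_simps)
    ultimately have "u\<^sup>2 \<le> 24 * E" by simp
    then have "(u\<^sup>2) powr (1 - \<epsilon>) \<le> (24 * E) powr (1 - \<epsilon>)" using e by (intro powr_mono2) auto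
    moreover have "(u\<^sup>2) powr (1 - \<epsilon>) = y\<^sup>2" 
      unfolding uy[symmetric] using u by (simp add: powr_powr mult.commute flip: powr_numeral)
    ultimately show ?thesis by simp
  qed
  have "(coord_scale w)\<^sup>2 = 64 * y\<^sup>2 * ((8 * E) powr (\<epsilon> / 2))\<^sup>2"
    using H by (simp add: coord_scale_def y_def E_def \<epsilon>_def power_mult_distrib power_divide)
  also have "((8 * E) powr (\<epsilon> / 2))\<^sup>2 = (8 * E) powr \<epsilon>" using E by (simp add: powr_power)
  also have "64 * y\<^sup>2 * (8 * E) powr \<epsilon> \<le> 64 * (24 * E) powr (1 - \<epsilon>) * (24 * E) powr \<epsilon>"
    using y2 E e by (intro mult_mono powr_mono2) auto
  also have "\<dots> = 1536 * E" using E by (simp add: mult.assoc flip: powr_add)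
  finally show ?thesis by (simp add: E_def)
qed

end

text \<open>One half of the hypotheses of the bound on \<open>\<gamma>\<^sub>2\<^sub>,\<^sub>2\<close>; the other half is the same statement
  with rows and columns exchanged.\<close>

locale column_bound =
  fixes m n :: nat and r s :: ereal and a :: "nat \<Rightarrow> nat \<Rightarrow> real" and H :: real
  assumes m: "0 < m" and n: "0 < n" and r: "2 \<le> r" and s: "2 \<le> s" and H: "0 < H"
    and a: "\<And>i j. \<lbrakk>i < m; j < n\<rbrakk> \<Longrightarrow> 0 \<le> a i j"
    and tail: "measure (gauss {..<m}) {g \<in> space (gauss {..<m}). 2 * H \<le> col_norm s m n a g} \<le> 1 / 4"
begin

abbreviation N :: "(nat \<Rightarrow> real) \<Rightarrow> real" where "N \<equiv> col_norm s m n a"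
abbreviation w :: "(nat \<Rightarrow> real) \<Rightarrow> nat \<Rightarrow> real" where "w \<equiv> row_wt r n a"
abbreviation y :: "real \<Rightarrow> real" where "y x \<equiv> rpow x (expo s - 1)"

lemma N_measurable [measurable]: "N \<in> borel_measurable (gauss {..<m})"
  using col_norm_measurable[OF s m n] by (simp add: measurable_cong_sets[OF sets_gauss refl])

sublocale sn: gauss_seminorm "{..<m}" N "2 * H"
proof
  interpret prob_space "gauss {..<m}" by (rule prob_space_gauss)
  show "finite {..<m}" by simp
  show "0 \<le> N x" for x by (rule col_norm_nonneg[OF s m n])
  show "N (\<lambda>i. x i + z i) \<le> N x + N z" for x z by (rule col_norm_triangle[OF s m n])
  show "N (\<lambda>i. c * x i) \<le> \<bar>c\<bar> * N x" for c x by (rule col_norm_cmult_le[OF s m n])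
  show "N x = N z" if "\<And>i. i \<in> {..<m} \<Longrightarrow> x i = z i" for x z by (rule col_norm_cong[OF s m n]) (use that in auto)
  show "N \<in> borel_measurable (Pi\<^sub>M {..<m} (\<lambda>_. borel))" by (rule col_norm_measurable[OF s m n])
  show "0 < 2 * H" using H by simp
  have "prob (space (gauss {..<m}) - {g \<in> space (gauss {..<m}). 2 * H \<le> N g}) = 1 - prob {g \<in> space (gauss {..<m}). 2 * H \<le> N g}"
    by (rule prob_compl) measurable
  also have "\<dots> \<ge> 1 / 2" using tail by simp
  finally have "1 / 2 \<le> prob (space (gauss {..<m}) - {g \<in> space (gauss {..<m}). 2 * H \<le> N g})" .
  also have "\<dots> \<le> prob {g \<in> space (gauss {..<m}). N g \<le> 2 * H}"
    by (intro finite_measure_mono) auto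
  finally show "1 / 2 \<le> prob {g \<in> space (gauss {..<m}). N g \<le> 2 * H}" .
qed

text \<open>An entry above 4H would force N g >= 2H whenever |g i| >= 1/2, an event of probability
  at least 1/2, against the bound 1/4.\<close>

lemma entry_le:
  assumes "i < m" "j < n"
  shows "a i j \<le> 4 * H"
proof (rule ccontr)
  assume c: "\<not> ?thesis"
  interpret prob_space "gauss {..<m}" by (rule prob_space_gauss)
  interpret S: prob_space std by (rule prob_space_std)
  have "ennreal (1 / 2) \<le> emeasure std {x. 1 / 2 \<le> \<bar>x\<bar>}"
  proof -
    have "S.prob {x. \<bar>x\<bar> < 1 / 2} \<le> 1 / 2" using std_small_ball unfolding S.emeasure_eq_measure by (subst (asm) ennreal_le_iff) auto
    moreover have "S.prob (space std - {x. \<bar>x\<bar> < 1 / 2}) = 1 - S.prob {x. \<bar>x\<bar> < 1 / 2}"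
      by (rule S.prob_compl) simp
    moreover have "space std - {x. \<bar>x\<bar> < 1 / 2} = {x. 1 / 2 \<le> \<bar>x\<bar>}" by auto
    ultimately have "1 / 2 \<le> S.prob {x. 1 / 2 \<le> \<bar>x\<bar>}" by simp
    then show ?thesis unfolding S.emeasure_eq_measure by (rule ennreal_leI)
  qed
  also have "\<dots> = (\<integral>\<^sup>+x. indicator {x. 1 / 2 \<le> \<bar>x\<bar>} x \<partial>std)" by simp
  also have "\<dots> = (\<integral>\<^sup>+g. indicator {x. 1 / 2 \<le> \<bar>x\<bar>} (g i) \<partial>gauss {..<m})"
    by (rule nn_integral_gauss_component[symmetric]) (use assms in auto)
  also have "\<dots> \<le> (\<integral>\<^sup>+g. indicator {g \<in> space (gauss {..<m}). 2 * H \<le> N g} g \<partial>gauss {..<m})"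
  proof (rule nn_integral_mono)
    fix g assume g: "g \<in> space (gauss {..<m})"
    have "2 * H \<le> N g" if "1 / 2 \<le> \<bar>g i\<bar>"
    proof -
      have "4 * H * (1 / 2) \<le> a i j * \<bar>g i\<bar>" using c that H by (intro mult_mono) auto
      also have "\<dots> \<le> N g" using col_norm_component[OF s m n assms, of a g] a[OF assms] by (simp add: abs_mult)
      finally show ?thesis by simp
    qed
    then show "indicator {x. 1 / 2 \<le> \<bar>x\<bar>} (g i) \<le> (indicator {g \<in> space (gauss {..<m}). 2 * H \<le> N g} g :: ennreal)"
      using g by (auto simp: indicator_def)
  qed
  also have "\<dots> = ennreal (prob {g \<in> space (gauss {..<m}). 2 * H \<le> N g})"
    by (subst nn_integral_indicator) (auto simp: emeasure_eq_measure)
  also have "\<dots> \<le> ennreal (1 / 4)" by (intro ennreal_leI tail)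
  finally have "(1 / 2 :: real) \<le> 1 / 4" by (subst (asm) ennreal_le_iff) auto
  then show False by simp
qed

lemma w_nonneg: "0 \<le> w v i" by (simp add: row_wt_def)

lemma w_le: "\<lbrakk>v \<in> B2plus n; i < m\<rbrakk> \<Longrightarrow> w v i \<le> 4 * H"
  using a entry_le H by (intro row_wt_le[OF s m n r]) auto

text \<open>If the truncated powers add up to at least 1 then the s-norm of (w g) is at least 2H,
  hence so is N g, which is rare; \<open>gauss_count_bound\<close> concludes. The weights are
  doubled because the reference weight of a coded coordinate can be twice the weight of the
  point.\<close>

lemma sum_trunc_mean_le:
  assumes v: "v \<in> B2plus n"
  shows "(\<Sum>i<m. trunc_mean s H (2 * w v i)) \<le> 4"
  unfolding trunc_mean_def[OF s H]
proof (rule gauss_count_bound)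
  interpret prob_space "gauss {..<m}" by (rule prob_space_gauss)
  have I: "finite {..<m}" "{..<m} \<noteq> {}" using m by auto
  have "2 * H \<le> N g" if g: "1 \<le> (\<Sum>i<m. trunc_pow s (2 * w v i * \<bar>g i\<bar> / (4 * H)))" for g
  proof -
    define x where "x = (\<lambda>i. w v i * \<bar>g i\<bar> / (2 * H))"
    have x: "2 * w v i * \<bar>g i\<bar> / (4 * H) = x i" for i by (simp add: x_def)
    have x0: "0 \<le> x i" for i using w_nonneg H by (simp add: x_def)
    have "1 \<le> lnorm s {..<m} x"
      using s
    proof (cases rule: exponent_cases)
      case 1
      obtain i where i: "i < m" "trunc_pow s (x i) \<noteq> 0"
        using g unfolding x by (metis lessThan_iff not_one_le_zero sum.neutral)
      then have "1 \<le> x i" using 1 by (auto simp: trunc_pow_def split: if_splits)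
      then show ?thesis using lnorm_component[OF s I, of i x] i(1) by simp
    next
      case (2 p)
      have "1 \<le> (\<Sum>i<m. \<bar>x i\<bar> powr p)"
        using g unfolding x by (rule order_trans[OF _ sum_mono]) (use x0 2 in \<open>simp add: trunc_pow_def\<close>)
      then have "1 powr (1 / p) \<le> lp p {..<m} x" unfolding lp_def using 2 by (intro powr_mono2) auto
      then show ?thesis using 2 by (simp add: lnorm_ereal)
    qed
    also have "lnorm s {..<m} x = lnorm s {..<m} (\<lambda>i. (1 / (2 * H)) * (w v i * g i))"
      by (rule lnorm_cong[OF s I]) (use H w_nonneg in \<open>simp add: x_def abs_mult\<close>)
    also have "\<dots> = (1 / (2 * H)) * lnorm s {..<m} (\<lambda>i. w v i * g i)"
      using H by (subst lnorm_cmult[OF s I]) simp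
    also have "\<dots> \<le> (1 / (2 * H)) * N g"
      using H by (intro mult_left_mono lnorm_row_wt_le[OF s m n r v]) auto
    finally show ?thesis using H by (simp add: field_simps)
  qed
  then have "prob {g \<in> space (gauss {..<m}). 1 \<le> (\<Sum>i<m. trunc_pow s (2 * w v i * \<bar>g i\<bar> / (4 * H)))}
     \<le> prob {g \<in> space (gauss {..<m}). 2 * H \<le> N g}"
    by (intro finite_measure_mono) auto
  then show "prob {g \<in> space (gauss {..<m}). 1 \<le> (\<Sum>i<m. trunc_pow s (2 * w v i * \<bar>g i\<bar> / (4 * H)))} \<le> 1 / 2"
    using tail by linarith
qed (auto simp: trunc_pow_bounds)

text \<open>Once the seminorm of v - v' is at most 8H / 2^(l+1), the weights differ by at most three
  times this, 12H / 2^l, which is half of \<open>thr l * H\<close>.\<close>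

definition thr :: "nat \<Rightarrow> real" where "thr l = 24 / 2 ^ l"

text \<open>A bound for the code length in terms of the weights of the point itself. The reference
  weights, which the code really uses, change from level to level and could not be summed.\<close>

definition coord_bnd :: "nat \<Rightarrow> (nat \<Rightarrow> real) \<Rightarrow> (nat \<Rightarrow> real) \<Rightarrow> real" where
  "coord_bnd l u v = 2 + 2 * (\<Sum>i<m. min 1 ((coord_scale s H (2 * w v i) / thr l) ^ 4)) +
     (\<Sum>i<m. let F = w v i * y (u i) / H in
        if thr l \<le> 2 * F then 144 * (u i)\<^sup>2 / F\<^sup>2 + 2 * F / thr l else 0)"

lemma thr_pos: "0 < thr l" by (simp add: thr_def)

text \<open>Here w1 is the reference weight and w0 that of the point; w1 <= 2 * w0 and w0 <= 3/2 *
  w1 since w1 is above the threshold. An active coordinate has G >= thr, so 2 * ln(1 /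
  \<open>\<delta>\<close>) is at most 8 * ln(G / scale), and \<open>coord_scale_log\<close> bounds
  G^2 times this by 64u^2. Passing from G to F costs 9/4, and 64 * 9/4 = 144.\<close>

lemma active_cost:
  assumes u: "0 \<le> u" "u \<le> 1" and close: "\<bar>w0 - w1\<bar> \<le> thr l * H / 2" and w1: "thr l * H \<le> w1" and w0: "0 \<le> w0"
    and act: "thr l \<le> w1 * y u / H"
  defines "F \<equiv> w0 * y u / H" and "\<delta> \<equiv> min 1 ((coord_scale s H w1 / thr l) ^ 4)"
  shows "thr l \<le> 2 * F" "2 * ln (1 / \<delta>) \<le> 144 * u\<^sup>2 / F\<^sup>2" "w1 * y u / (thr l * H) \<le> 2 * F / thr l"
proof -
  define G where "G = w1 * y u / H"
  have t: "0 < thr l" by (rule thr_pos)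
  have w: "0 < w1" "w1 \<le> 2 * w0" "w0 \<le> 3 / 2 * w1" using close w1 w0 mult_pos_pos[OF t H] unfolding abs_le_iff by linarith+
  have yu: "0 \<le> y u" by simp
  have G0: "thr l \<le> G" "0 < G" using act t by (auto simp: G_def)
  have GF: "G \<le> 2 * F" unfolding G_def F_def using w H yu by (simp add: divide_right_mono mult_right_mono flip: times_divide_eq_right mult.assoc)
  have FG: "F \<le> 3 / 2 * G" unfolding G_def F_def using w H yu by (simp add: divide_right_mono mult_right_mono flip: times_divide_eq_right mult.assoc)
  show "thr l \<le> 2 * F" using G0 GF by linarith
  have F0: "0 < F" using G0 GF by linarith
  show "w1 * y u / (thr l * H) \<le> 2 * F / thr l"
    using GF t by (simp add: G_def divide_right_mono mult.commute flip: divide_divide_eq_left)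
  show "2 * ln (1 / \<delta>) \<le> 144 * u\<^sup>2 / F\<^sup>2"
  proof (cases "thr l \<le> coord_scale s H w1")
    case True
    then have "1 \<le> (coord_scale s H w1 / thr l) ^ 4" using t by (intro one_le_power) (simp add: field_simps)
    then have "\<delta> = 1" by (simp add: \<delta>_def)
    then show ?thesis by simp
  next
    case False
    have sc: "0 < coord_scale s H w1" by (rule coord_scale_pos[OF s H w(1)])
    \<comment> \<open>For s = 2 the power of u is identically 1 and the scale is w1 / H, which is at
      least the threshold; this is excluded in the present case.\<close>
    have ne: "expo s \<noteq> 1"
    proof
      assume e: "expo s = 1"
      have "coord_scale s H w1 = w1 / H" using e trunc_mean_pos[OF s H w(1)] by (simp add: coord_scale_def[OF s H])
      moreover have "thr l \<le> w1 / H" using w1 H by (simp add: pos_le_divide_eq)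
      ultimately show False using False by simp
    qed
    have u0: "0 < u"
    proof (rule ccontr)
      assume "\<not> 0 < u"
      then have "u = 0" using u by simp
      then have "G = 0" using ne by (simp add: G_def rpow_def)
      then show False using G0 by simp
    qed
    have yp: "y u = u powr (expo s - 1)" using ne by (simp add: rpow_def)
    have "(coord_scale s H w1 / thr l) ^ 4 \<le> 1" using False t sc by (intro power_le_one) auto
    then have "\<delta> = (coord_scale s H w1 / thr l) ^ 4" by (simp add: \<delta>_def)
    then have "ln (1 / \<delta>) = ln ((thr l / coord_scale s H w1) ^ 4)" by (simp add: power_divide)
    also have "\<dots> = 4 * ln (thr l / coord_scale s H w1)" using t sc by (subst ln_realpow) auto
    also have "\<dots> \<le> 4 * ln (G / coord_scale s H w1)"
      using t sc G0 by (intro mult_left_mono ln_mono divide_right_mono) auto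
    finally have "G\<^sup>2 * ln (1 / \<delta>) \<le> 4 * (G\<^sup>2 * ln (G / coord_scale s H w1))"
      using mult_left_mono[of "ln (1 / \<delta>)" "4 * ln (G / coord_scale s H w1)" "G\<^sup>2"] by simp
    also have "\<dots> \<le> 4 * (8 * u\<^sup>2)"
      using coord_scale_log[OF s H w(1) u0 u(2)] by (simp add: G_def yp)
    finally have 1: "G\<^sup>2 * ln (1 / \<delta>) \<le> 32 * u\<^sup>2" by simp
    have "F\<^sup>2 \<le> (3 / 2 * G)\<^sup>2" using FG F0 by (intro power_mono) auto
    then have 2: "F\<^sup>2 \<le> 9 / 4 * G\<^sup>2" by (simp add: power_mult_distrib power_divide)
    have ln0: "0 \<le> ln (1 / \<delta>)" using sc t \<open>\<delta> = _\<close> by (simp add: \<open>(coord_scale s H w1 / thr l) ^ 4 \<le> 1\<close>)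
    have "F\<^sup>2 * (2 * ln (1 / \<delta>)) \<le> 9 / 4 * G\<^sup>2 * (2 * ln (1 / \<delta>))"
      using 2 ln0 by (intro mult_right_mono) auto
    also have "\<dots> = 9 / 2 * (G\<^sup>2 * ln (1 / \<delta>))" by simp
    also have "\<dots> \<le> 9 / 2 * (32 * u\<^sup>2)" by (intro mult_left_mono 1) simp
    also have "\<dots> = 144 * u\<^sup>2" by simp
    finally show ?thesis using F0 by (simp add: pos_le_divide_eq mult.commute)
  qed
qed

text \<open>One point of the cell supplies weights W that the decoder knows. Where W is below the
  threshold nothing is sent, because the powers lie between 0 and 1; elsewhere W times the power is
  rounded down to a multiple of \<open>thr l * H\<close>. In both cases replacing W by the true
  weight costs at most a factor 3/2.\<close>

lemma coord_split_code:
  assumes A: "A \<subseteq> Kset m n"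
    and close: "\<And>z z' i. \<lbrakk>z \<in> A; z' \<in> A; i < m\<rbrakk> \<Longrightarrow> \<bar>w (snd z) i - w (snd z') i\<bar> \<le> thr l * H / 2"
  shows "split_code A (\<lambda>z z'. \<forall>i<m. w (snd z) i * \<bar>y (fst z i) - y (fst z' i)\<bar> \<le> 3 / 2 * (thr l * H))
    (\<lambda>z. coord_bnd l (fst z) (snd z))"
proof (cases "A = {}")
  case True
  then show ?thesis by (intro split_codeI[where L = "\<lambda>_. 1" and key = "\<lambda>z. z"]) auto
next
  case False
  then obtain b where b: "b \<in> A" by auto
  define W where "W = w (snd b)"
  define I where "I = {i. i < m \<and> thr l * H \<le> W i}"
  define \<delta> where "\<delta> = (\<lambda>i. min 1 ((coord_scale s H (W i) / thr l) ^ 4))"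
  define q where "q = (\<lambda>(z :: (nat \<Rightarrow> real) \<times> (nat \<Rightarrow> real)) i. nat \<lfloor>W i * y (fst z i) / (thr l * H)\<rfloor>)"
  have tH: "0 < thr l * H" using thr_pos H by simp
  have W0: "0 \<le> W i" for i by (simp add: W_def w_nonneg)
  have I: "finite I" by (simp add: I_def)
  have clW: "\<bar>w (snd z) i - W i\<bar> \<le> thr l * H / 2" if "z \<in> A" "i < m" for z i
    using close[OF that(1) b that(2)] by (simp add: W_def)
  have fz: "0 \<le> fst z i" "fst z i \<le> 1" if "z \<in> A" "i < m" for z i
    using that A B2plusD[of "fst z" m] by (auto simp: Kset_def)
  have y01: "0 \<le> y (fst z i)" "y (fst z i) \<le> 1" if "z \<in> A" "i < m" for z i
    using fz[OF that] expo_bounds[OF s] by (auto intro: rpow_le_one)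
  show ?thesis
  proof (rule split_code_mono[OF coordinate_split_code[OF I, of \<delta> A q]])
    fix i assume "i \<in> I"
    then have "0 < W i" using tH by (simp add: I_def)
    then show "0 < \<delta> i" using coord_scale_pos[OF s H, of "W i"] thr_pos[of l] by (auto simp: \<delta>_def)
    show "\<delta> i \<le> 1" by (simp add: \<delta>_def)
  next
    fix z z' assume z: "z \<in> A" "z' \<in> A" and q: "\<forall>i\<in>I. q z i = q z' i"
    show "\<forall>i<m. w (snd z) i * \<bar>y (fst z i) - y (fst z' i)\<bar> \<le> 3 / 2 * (thr l * H)"
    proof (intro allI impI)
      fix i assume i: "i < m"
      let ?d = "\<bar>y (fst z i) - y (fst z' i)\<bar>"
      have cl: "w (snd z) i \<le> W i + thr l * H / 2" using clW[OF z(1) i] unfolding abs_le_iff by linarith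
      show "w (snd z) i * ?d \<le> 3 / 2 * (thr l * H)"
      proof (cases "i \<in> I")
        case True
        define X where "X = W i * y (fst z i) / (thr l * H)"
        define X' where "X' = W i * y (fst z' i) / (thr l * H)"
        have X0: "0 \<le> X" "0 \<le> X'" using W0 tH by (auto simp: X_def X'_def)
        have "nat \<lfloor>X\<rfloor> = nat \<lfloor>X'\<rfloor>" using q True by (simp add: q_def X_def X'_def)
        then have "\<lfloor>X\<rfloor> = \<lfloor>X'\<rfloor>" using X0 by (subst (asm) eq_nat_nat_iff) auto
        then have "\<bar>X - X'\<bar> \<le> 1" by linarith
        moreover have "X - X' = W i * (y (fst z i) - y (fst z' i)) / (thr l * H)"
          by (simp add: X_def X'_def right_diff_distrib diff_divide_distrib)
        ultimately have "W i * ?d / (thr l * H) \<le> 1" using W0[of i] thr_pos[of l] H by (simp add: abs_mult)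
        then have "W i * ?d \<le> thr l * H" using tH by (simp add: pos_divide_le_eq)
        moreover have "w (snd z) i * ?d \<le> 3 / 2 * W i * ?d"
          using cl True by (intro mult_right_mono) (auto simp: I_def)
        ultimately show ?thesis by simp
      next
        case False
        then have "w (snd z) i \<le> 3 / 2 * (thr l * H)" using cl i by (simp add: I_def)
        moreover have "?d \<le> 1" using y01[OF z(1) i] y01[OF z(2) i] by linarith
        ultimately have "w (snd z) i * ?d \<le> 3 / 2 * (thr l * H) * 1" using tH by (intro mult_mono) auto
        then show ?thesis by simp
      qed
    qed
  next
    fix z assume z: "z \<in> A"
    have Im: "I \<subseteq> {..<m}" by (auto simp: I_def)
    let ?F = "\<lambda>i. w (snd z) i * y (fst z i) / H"
    have "(\<Sum>i\<in>I. \<delta> i) \<le> (\<Sum>i\<in>I. min 1 ((coord_scale s H (2 * w (snd z) i) / thr l) ^ 4))"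
    proof (rule sum_mono)
      fix i assume i: "i \<in> I"
      then have "i < m" "thr l * H \<le> W i" by (simp_all add: I_def)
      then have "W i \<le> 2 * w (snd z) i" using clW[OF z, of i] unfolding abs_le_iff by linarith
      then have "coord_scale s H (W i) \<le> coord_scale s H (2 * w (snd z) i)" by (intro coord_scale_mono[OF s H] W0)
      then show "\<delta> i \<le> min 1 ((coord_scale s H (2 * w (snd z) i) / thr l) ^ 4)"
        unfolding \<delta>_def using thr_pos[of l] coord_scale_nonneg[OF s H W0]
        by (intro min.mono power_mono divide_right_mono divide_nonneg_nonneg) auto
    qed
    also have "\<dots> \<le> (\<Sum>i<m. min 1 ((coord_scale s H (2 * w (snd z) i) / thr l) ^ 4))"
      by (rule sum_mono2) (use Im in auto)
    finally have 1: "(\<Sum>i\<in>I. \<delta> i) \<le> (\<Sum>i<m. min 1 ((coord_scale s H (2 * w (snd z) i) / thr l) ^ 4))" .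
    have F0: "0 \<le> ?F i" for i using w_nonneg H by simp
    have nn: "0 \<le> (if c then 144 * (fst z i)\<^sup>2 / (?F i)\<^sup>2 + 2 * ?F i / thr l else 0)" for c i
    proof -
      have "0 \<le> 144 * (fst z i)\<^sup>2 / (?F i)\<^sup>2 + 2 * ?F i / thr l"
        by (intro add_nonneg_nonneg divide_nonneg_nonneg mult_nonneg_nonneg F0) (use thr_pos[of l] in auto)
      then show ?thesis by (cases c) (simp_all only: if_True if_False order_refl)
    qed
    have "(\<Sum>i\<in>I. if q z i = 0 then 0 else 2 * ln (1 / \<delta> i) + real (q z i))
      \<le> (\<Sum>i\<in>I. if thr l \<le> 2 * ?F i then 144 * (fst z i)\<^sup>2 / (?F i)\<^sup>2 + 2 * ?F i / thr l else 0)"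
    proof (rule sum_mono)
      fix i assume i: "i \<in> I"
      then have im: "i < m" and Wi: "thr l * H \<le> W i" by (auto simp: I_def)
      show "(if q z i = 0 then 0 else 2 * ln (1 / \<delta> i) + real (q z i))
        \<le> (if thr l \<le> 2 * ?F i then 144 * (fst z i)\<^sup>2 / (?F i)\<^sup>2 + 2 * ?F i / thr l else 0)"
      proof (cases "q z i = 0")
        case True
        show ?thesis unfolding if_P[OF True] by (rule nn)
      next
        case False
        define X where "X = W i * y (fst z i) / (thr l * H)"
        have X: "1 \<le> X" "real (q z i) \<le> X" 
        proof -
          have qX: "q z i = nat \<lfloor>X\<rfloor>" by (simp add: q_def X_def)
          show "1 \<le> X" using False unfolding qX by linarith
          then show "real (q z i) \<le> X" unfolding qX by linarith
        qed
        then have "thr l \<le> W i * y (fst z i) / H" using tH H thr_pos[of l] by (simp add: X_def field_simps)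
        from active_cost[OF fz[OF z im] clW[OF z im] Wi w_nonneg this]
        show ?thesis using False X unfolding \<delta>_def X_def by simp
      qed
    qed
    also have "\<dots> \<le> (\<Sum>i<m. if thr l \<le> 2 * ?F i then 144 * (fst z i)\<^sup>2 / (?F i)\<^sup>2 + 2 * ?F i / thr l else 0)"
      by (rule sum_mono2[OF _ Im nn]) simp
    finally show "2 + 2 * (\<Sum>i\<in>I. \<delta> i) + (\<Sum>i\<in>I. if q z i = 0 then 0 else 2 * ln (1 / \<delta> i) + real (q z i))
      \<le> coord_bnd l (fst z) (snd z)"
      using 1 by (simp add: coord_bnd_def Let_def)
  qed
qed

text \<open>The prior contributes the squared scales, an active coordinate contributes u^2 and F^2,
  and F^2 is bounded again by squared scale and u^2. The squared scales add up to at most 1536 * 4 =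
  6144, and 4 + 6144/72 + 3 + 6144/8 < 1000.\<close>

lemma coord_bnd_sum:
  assumes u: "u \<in> B2plus m" and v: "v \<in> B2plus n"
  shows "(\<Sum>l<K. coord_bnd l u v / 4 ^ l) \<le> 1000"
proof -
  define \<Omega> where "\<Omega> = (\<lambda>i. coord_scale s H (2 * w v i))"
  define F where "F = (\<lambda>i. w v i * y (u i) / H)"
  have O0: "0 \<le> \<Omega> i" for i unfolding \<Omega>_def by (intro coord_scale_nonneg[OF s H]) (simp add: w_nonneg)
  have F0: "0 \<le> F i" for i using w_nonneg H by (simp add: F_def)
  have u01: "0 \<le> u i" "u i \<le> 1" if "i < m" for i using B2plusD[OF u] that by auto
  have "(\<Sum>i<m. (\<Omega> i)\<^sup>2) \<le> (\<Sum>i<m. 1536 * trunc_mean s H (2 * w v i))"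
    unfolding \<Omega>_def
  proof (rule sum_mono)
    fix i assume "i \<in> {..<m}"
    then show "(coord_scale s H (2 * w v i))\<^sup>2 \<le> 1536 * trunc_mean s H (2 * w v i)"
      using w_le[OF v, of i] w_nonneg by (intro coord_scale_sq_le[OF s H]) auto
  qed
  also have "\<dots> \<le> 1536 * 4" unfolding sum_distrib_left[symmetric] by (intro mult_left_mono sum_trunc_mean_le v) simp
  finally have O: "(\<Sum>i<m. (\<Omega> i)\<^sup>2) \<le> 6144" by simp
  \<comment> \<open>Either F is comparable to the scale, or their ratio is at least 3 >= exp 1, the
    logarithm in \<open>coord_scale_log\<close> is at least 1, and F^2 <= 8u^2.\<close>
  have Fi: "(F i)\<^sup>2 \<le> 9 * (\<Omega> i)\<^sup>2 + 8 * (u i)\<^sup>2" if i: "i < m" for i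
  proof (cases "F i \<le> 3 * \<Omega> i")
    case True
    then have "(F i)\<^sup>2 \<le> (3 * \<Omega> i)\<^sup>2" using F0 by (intro power_mono) auto
    then show ?thesis by (simp add: power_mult_distrib add_increasing2)
  next
    case False
    then have Fp: "0 < F i" using O0[of i] by linarith
    then have wi: "0 < w v i" using w_nonneg[of v i] by (auto simp: F_def less_le)
    have sc: "0 < coord_scale s H (w v i)" "coord_scale s H (w v i) \<le> \<Omega> i"
      unfolding \<Omega>_def using wi by (auto intro!: coord_scale_pos[OF s H] coord_scale_mono[OF s H])
    have ne: "expo s \<noteq> 1"
    proof
      assume e: "expo s = 1"
      have "coord_scale s H (w v i) = w v i / H" using e trunc_mean_pos[OF s H wi] by (simp add: coord_scale_def[OF s H])
      then have "F i = coord_scale s H (w v i)" using e by (simp add: F_def rpow_def)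
      then show False using False sc O0[of i] by linarith
    qed
    have u0: "0 < u i" using Fp ne u01[OF i] by (auto simp: F_def rpow_def less_le)
    have yp: "y (u i) = u i powr (expo s - 1)" using ne by (simp add: rpow_def)
    have "3 * coord_scale s H (w v i) \<le> F i" using False sc by linarith
    then have "3 \<le> F i / coord_scale s H (w v i)" using sc by (simp add: pos_le_divide_eq)
    then have "exp 1 \<le> F i / coord_scale s H (w v i)" using exp_le by linarith
    then have "1 \<le> ln (F i / coord_scale s H (w v i))" using sc Fp by (subst ln_ge_iff) auto
    then have "(F i)\<^sup>2 * 1 \<le> (F i)\<^sup>2 * ln (F i / coord_scale s H (w v i))" by (intro mult_left_mono) auto
    also have "\<dots> \<le> 8 * (u i)\<^sup>2" using coord_scale_log[OF s H wi u0 u01(2)[OF i]] by (simp add: F_def yp)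
    finally show ?thesis using zero_le_power2[of "\<Omega> i"] by linarith
  qed
  have thr: "thr l \<le> 2 * x \<longleftrightarrow> 1 / 2 ^ l \<le> x / 12" for l x by (auto simp: thr_def field_simps)
  have S1: "(\<Sum>l<K. min 1 ((\<Omega> i / thr l) ^ 4) / 4 ^ l) \<le> (\<Omega> i)\<^sup>2 / 144" for i
    using sum_min_dyadic[of "\<Omega> i / 24" K] O0[of i] by (simp add: thr_def power_divide)
  define G where "G = (\<lambda>i l. if thr l \<le> 2 * F i then 144 * (u i)\<^sup>2 / (F i)\<^sup>2 + 2 * F i / thr l else 0)"
  have S2: "(\<Sum>l<K. G i l / 4 ^ l) \<le> 2 * (u i)\<^sup>2 + (F i)\<^sup>2 / 72" for i
  proof -
    have "G i l / 4 ^ l = 144 * (u i)\<^sup>2 / (F i)\<^sup>2 * (if 1 / 2 ^ l \<le> F i / 12 then 1 / 4 ^ l else 0)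
        + F i / 12 * (if 1 / 2 ^ l \<le> F i / 12 then 1 / 2 ^ l else 0)" for l
    proof -
      have four: "(4::real) ^ l = 2 ^ l * 2 ^ l" by (simp flip: power_mult_distrib)
      have e: "2 * F i / thr l / 4 ^ l = F i / 12 * (1 / 2 ^ l)" by (simp add: thr_def four)
      show ?thesis
      proof (cases "1 / 2 ^ l \<le> F i / 12")
        case True
        show ?thesis unfolding G_def thr if_P[OF True] add_divide_distrib e by (simp add: mult.commute)
      next
        case False
        show ?thesis unfolding G_def thr if_not_P[OF False] by simp
      qed
    qed
    then have "(\<Sum>l<K. G i l / 4 ^ l) = 144 * (u i)\<^sup>2 / (F i)\<^sup>2 * (\<Sum>l<K. if 1 / 2 ^ l \<le> F i / 12 then 1 / 4 ^ l else 0)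
        + F i / 12 * (\<Sum>l<K. if 1 / 2 ^ l \<le> F i / 12 then 1 / 2 ^ l else 0)"
      by (simp only: sum.distrib sum_distrib_left)
    also have "\<dots> \<le> 144 * (u i)\<^sup>2 / (F i)\<^sup>2 * (2 * (F i / 12)\<^sup>2) + F i / 12 * (2 * (F i / 12))"
      using F0[of i] by (intro add_mono mult_left_mono sum_small_dyadic sum_small_dyadic_sq) auto
    also have "\<dots> \<le> 2 * (u i)\<^sup>2 + (F i)\<^sup>2 / 72"
      by (cases "F i = 0") (auto simp: power_divide power2_eq_square)
    finally show ?thesis .
  qed
  have cb: "coord_bnd l u v = 2 + 2 * (\<Sum>i<m. min 1 ((\<Omega> i / thr l) ^ 4)) + (\<Sum>i<m. G i l)" for l
    by (simp only: coord_bnd_def Let_def \<Omega>_def F_def G_def)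
  have "(\<Sum>l<K. coord_bnd l u v / 4 ^ l) = 2 * (\<Sum>l<K. 1 / 4 ^ l) + 2 * (\<Sum>l<K. \<Sum>i<m. min 1 ((\<Omega> i / thr l) ^ 4) / 4 ^ l) + (\<Sum>l<K. \<Sum>i<m. G i l / 4 ^ l)"
    unfolding cb by (simp add: add_divide_distrib sum.distrib sum_distrib_left sum_divide_distrib)
  also have "\<dots> = 2 * (\<Sum>l<K. 1 / 4 ^ l) + 2 * (\<Sum>i<m. \<Sum>l<K. min 1 ((\<Omega> i / thr l) ^ 4) / 4 ^ l) + (\<Sum>i<m. \<Sum>l<K. G i l / 4 ^ l)"
    by (simp only: sum.swap[of _ "{..<m}" "{..<K}"])
  \<comment> \<open>Inserting \<open>Fi\<close> into \<open>S2\<close> gives 2u^2 + (9 * scale^2 +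
    8u^2) / 72, which is at most 3u^2 + scale^2 / 8.\<close>
  also have "\<dots> \<le> 2 * 2 + 2 * (\<Sum>i<m. (\<Omega> i)\<^sup>2 / 144) + (\<Sum>i<m. 3 * (u i)\<^sup>2 + (\<Omega> i)\<^sup>2 / 8)"
  proof (intro add_mono mult_left_mono sum_mono S1)
    have "(\<Sum>l<K. (1 / 4) ^ l) = (4 - 4 * (1 / 4) ^ K) / (3::real)" by (induction K) simp_all
    moreover have "0 \<le> (1 / 4 :: real) ^ K" by (rule zero_le_power) simp
    moreover have "(4 - 4 * x) / 3 \<le> 2" if "0 \<le> x" for x :: real using that by simp
    ultimately have "(\<Sum>l<K. (1 / 4) ^ l) \<le> (2::real)" by metis
    then show "(\<Sum>l<K. 1 / 4 ^ l) \<le> (2::real)" by (simp add: power_one_over)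
    fix i assume "i \<in> {..<m}"
    then show "(\<Sum>l<K. G i l / 4 ^ l) \<le> 3 * (u i)\<^sup>2 + (\<Omega> i)\<^sup>2 / 8"
      using S2[of i] Fi[of i, unfolded lessThan_iff[symmetric]] zero_le_power2[of "u i"] by linarith
  qed auto
  also have "\<dots> = 4 + (\<Sum>i<m. (\<Omega> i)\<^sup>2) / 72 + 3 * (\<Sum>i<m. (u i)\<^sup>2) + (\<Sum>i<m. (\<Omega> i)\<^sup>2) / 8"
    by (simp add: sum.distrib sum_distrib_left sum_divide_distrib)
  also have "\<dots> \<le> 1000" using O B2plusD(2)[OF u] by simp
  finally show ?thesis .
qed

end

section \<open>The bound on the chaining functional\<close>

lemma Vmat_swap: "Vmat r s a z i j = Umat s r (\<lambda>j i. a i j) (prod.swap z) j i"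
  by (simp add: Vmat_def Umat_def Let_def prod.case_eq_if)

lemma Kset_swap: "z \<in> Kset m n \<Longrightarrow> prod.swap z \<in> Kset n m"
  by (auto simp: Kset_def)

lemma zero_in_Kset: "(\<lambda>i\<in>{..<m}. 0, \<lambda>j\<in>{..<n}. 0) \<in> Kset m n"
  by (simp add: Kset_def B2plus_def L2_set_def)

lemma two_sqrt_two_le: "2 * sqrt 2 \<le> (3::real)"
proof -
  have "sqrt 2 \<le> (3 / 2 :: real)" by (rule real_le_lsqrt) (simp_all add: power2_eq_square)
  then show ?thesis by simp
qed

lemma rho_le:
  assumes r: "2 \<le> r" and s: "2 \<le> s" and m: "0 < m" and n: "0 < n"
    and z: "z \<in> Kset m n" "z' \<in> Kset m n"
    and u: "col_norm s m n a (\<lambda>i. fst z i - fst z' i) \<le> b"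
    and v: "col_norm r n m (\<lambda>j i. a i j) (\<lambda>j. snd z j - snd z' j) \<le> b"
    and cu: "\<And>i. i < m \<Longrightarrow> row_wt r n a (snd z) i * \<bar>rpow (fst z i) (expo s - 1) - rpow (fst z' i) (expo s - 1)\<bar> \<le> c"
    and cv: "\<And>j. j < n \<Longrightarrow> row_wt s m (\<lambda>j i. a i j) (fst z) j * \<bar>rpow (snd z j) (expo r - 1) - rpow (snd z' j) (expo r - 1)\<bar> \<le> c"
  shows "rho m n r s a z z' \<le> 4 * (c + 3 * b)"
proof -
  have b0: "0 \<le> b" using col_norm_nonneg[OF s m n, of a] u by (rule order_trans)
  note s2 = two_sqrt_two_le
  have b3: "2 * sqrt 2 * x \<le> 3 * b" if "x \<le> b" for x
  proof -
    have "2 * sqrt 2 * x \<le> 2 * sqrt 2 * b" using that by (intro mult_left_mono) auto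
    also have "\<dots> \<le> 3 * b" using s2 b0 by (rule mult_right_mono)
    finally show ?thesis .
  qed
  obtain u v u' v' where zz: "z = (u, v)" "z' = (u', v')" by (cases z, cases z') auto
  have K: "u \<in> B2plus m" "u' \<in> B2plus m" "v \<in> B2plus n" "v' \<in> B2plus n" using z by (auto simp: zz Kset_def)
  have "L2_set (\<lambda>j. Umat r s a z i j - Umat r s a z' i j) {..<n} \<le> 2 * (c + 3 * b)" if i: "i < m" for i
    using U_row_le[OF s r n m i K, of a] cu[OF i] b3[OF v] by (simp add: zz)
  then have "(MAX i\<in>{..<m}. L2_set (\<lambda>j. Umat r s a z i j - Umat r s a z' i j) {..<n}) \<le> 2 * (c + 3 * b)"
    using m by (intro Max.boundedI) auto
  moreover have "L2_set (\<lambda>i. Vmat r s a z i j - Vmat r s a z' i j) {..<m} \<le> 2 * (c + 3 * b)" if j: "j < n" for j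
    using U_row_le[OF r s m n j K(3,4,1,2), of "\<lambda>j i. a i j"] cv[OF j] b3[OF u] by (simp add: zz Vmat_swap)
  then have "(MAX j\<in>{..<n}. L2_set (\<lambda>i. Vmat r s a z i j - Vmat r s a z' i j) {..<m}) \<le> 2 * (c + 3 * b)"
    using n by (intro Max.boundedI) auto
  ultimately show ?thesis unfolding rho_def by linarith
qed

context column_bound
begin

lemma N_diff_le:
  assumes "u \<in> B2plus m" "u' \<in> B2plus m"
  shows "N (\<lambda>i. u i - u' i) \<le> 8 * H"
proof -
  have "N (\<lambda>i. u i - u' i) \<le> 4 * H * L2_set (\<lambda>i. u i - u' i) {..<m}"
    by (rule col_norm_le_L2[OF s m n]) (use a entry_le H in auto)
  also have "L2_set (\<lambda>i. u i - u' i) {..<m} \<le> L2_set u {..<m} + L2_set (\<lambda>i. - u' i) {..<m}"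
    using L2_set_triangle_ineq[of u "\<lambda>i. - u' i" "{..<m}"] by simp
  also have "\<dots> \<le> 1 + 1" using assms by (intro add_mono) (auto simp: B2plus_def L2_set_def)
  finally show ?thesis using H by simp
qed

end

locale two_sided_bound = X: column_bound m n r s a H + Y: column_bound n m s r "\<lambda>j i. a i j" H
  for m n r s a H
begin

text \<open>8H bounds the seminorm diameters of the two balls (\<open>N_diff_le\<close>). The error
  3/2 * \<open>thr l * H\<close> of the coordinate code is 36H / 2^l, that is 72H / 2^(l+1). The
  conjunctions are bracketed as \<open>split_code_comp\<close> produces them.\<close>

definition rel :: "nat \<Rightarrow> (nat \<Rightarrow> real) \<times> (nat \<Rightarrow> real) \<Rightarrow> (nat \<Rightarrow> real) \<times> (nat \<Rightarrow> real) \<Rightarrow> bool" where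
  "rel l z z' \<longleftrightarrow>
    (((X.N (\<lambda>i. fst z i - fst z' i) \<le> 8 * H / 2 ^ l \<and>
       Y.N (\<lambda>j. snd z j - snd z' j) \<le> 8 * H / 2 ^ l) \<and>
      (\<forall>i<m. X.w (snd z) i * \<bar>X.y (fst z i) - X.y (fst z' i)\<bar> \<le> 72 * H / 2 ^ l)) \<and>
      (\<forall>j<n. Y.w (fst z) j * \<bar>Y.y (snd z j) - Y.y (snd z' j)\<bar> \<le> 72 * H / 2 ^ l))"

text \<open>Three compositions of codes, each with its factor 2.\<close>

definition bnd :: "nat \<Rightarrow> (nat \<Rightarrow> real) \<times> (nat \<Rightarrow> real) \<Rightarrow> real" where
  "bnd l z = 2 * (2 * (2 * (X.sn.lin_bnd (8 * H) l (fst z) + Y.sn.lin_bnd (8 * H) l (snd z))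
     + X.coord_bnd l (fst z) (snd z)) + Y.coord_bnd l (snd z) (fst z))"

lemma wt_close:
  assumes "v \<in> B2plus n" "v' \<in> B2plus n" "Y.N (\<lambda>j. v j - v' j) \<le> 8 * H / 2 ^ Suc l" "i < m"
  shows "\<bar>X.w v i - X.w v' i\<bar> \<le> 24 / 2 ^ l * H / 2"
proof -
  note s2 = two_sqrt_two_le
  have "\<bar>X.w v i - X.w v' i\<bar> \<le> 2 * sqrt 2 * Y.N (\<lambda>j. v j - v' j)"
    by (rule row_wt_lipschitz[OF X.r X.n X.m assms(4,1,2)])
  also have "\<dots> \<le> 3 * (8 * H / 2 ^ Suc l)"
    using s2 assms(3) Y.sn.nonneg[of "\<lambda>j. v j - v' j"] by (intro mult_mono) auto
  finally show ?thesis by simp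
qed

end

text \<open>The assumptions are invariant under transposition; this instance supplies
  \<open>wt_close\<close> for the weights of the columns.\<close>

sublocale two_sided_bound \<subseteq> T: two_sided_bound n m s r "\<lambda>j i. a i j" H
  by unfold_locales

context two_sided_bound
begin

text \<open>Both seminorm codes come first: on their cells the weights of rows and of columns vary
  by at most half a threshold, as the coordinate codes require.\<close>

lemma step:
  assumes A: "A \<subseteq> Kset m n" and R: "\<forall>x\<in>A. \<forall>y\<in>A. rel l x y"
  shows "split_code A (rel (Suc l)) (bnd l)"
proof -
  have fs: "fst z \<in> B2plus m" "snd z \<in> B2plus n" if "z \<in> A" for z using that A by (auto simp: Kset_def)
  have 1: "split_code A (\<lambda>z z'. X.N (\<lambda>i. fst z i - fst z' i) \<le> 8 * H / 2 ^ Suc l) (\<lambda>z. X.sn.lin_bnd (8 * H) l (fst z))"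
    by (rule split_code_vimage[OF X.sn.linear_split_code_level]) (use R X.H in \<open>auto simp: rel_def\<close>)
  have 2: "split_code A' (\<lambda>z z'. Y.N (\<lambda>j. snd z j - snd z' j) \<le> 8 * H / 2 ^ Suc l) (\<lambda>z. Y.sn.lin_bnd (8 * H) l (snd z))" if "A' \<subseteq> A" for A'
  proof -
    have R': "\<forall>x\<in>A'. \<forall>y\<in>A'. rel l x y" using R that by blast
    show ?thesis
      by (rule split_code_vimage[OF Y.sn.linear_split_code_level]) (use R' X.H in \<open>auto simp: rel_def\<close>)
  qed
  note 12 = split_code_comp[OF 1 2]
  have 3: "split_code A' (\<lambda>z z'. \<forall>i<m. X.w (snd z) i * \<bar>X.y (fst z i) - X.y (fst z' i)\<bar> \<le> 72 * H / 2 ^ Suc l) (\<lambda>z. X.coord_bnd l (fst z) (snd z))"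
    if A': "A' \<subseteq> A" and R': "\<forall>z\<in>A'. \<forall>z'\<in>A'. X.N (\<lambda>i. fst z i - fst z' i) \<le> 8 * H / 2 ^ Suc l \<and> Y.N (\<lambda>j. snd z j - snd z' j) \<le> 8 * H / 2 ^ Suc l" for A'
  proof (rule split_code_mono[OF X.coord_split_code[of A' l]])
    show "A' \<subseteq> Kset m n" using A A' by auto
    fix z z' i assume z: "z \<in> A'" "z' \<in> A'" and i: "i < m"
    have "Y.N (\<lambda>j. snd z j - snd z' j) \<le> 8 * H / 2 ^ Suc l" using R' z by blast
    then show "\<bar>X.w (snd z) i - X.w (snd z') i\<bar> \<le> X.thr l * H / 2"
      unfolding X.thr_def by (intro wt_close fs(2) subsetD[OF A'] z i)
  qed (auto simp: X.thr_def)
  note 123 = split_code_comp[OF 12 3]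
  have 4: "split_code A' (\<lambda>z z'. \<forall>j<n. Y.w (fst z) j * \<bar>Y.y (snd z j) - Y.y (snd z' j)\<bar> \<le> 72 * H / 2 ^ Suc l) (\<lambda>z. Y.coord_bnd l (snd z) (fst z))"
    if A': "A' \<subseteq> A" and R': "\<forall>z\<in>A'. \<forall>z'\<in>A'. (X.N (\<lambda>i. fst z i - fst z' i) \<le> 8 * H / 2 ^ Suc l \<and> Y.N (\<lambda>j. snd z j - snd z' j) \<le> 8 * H / 2 ^ Suc l) \<and>
      (\<forall>i<m. X.w (snd z) i * \<bar>X.y (fst z i) - X.y (fst z' i)\<bar> \<le> 72 * H / 2 ^ Suc l)" for A'
  proof -
    have "split_code (prod.swap ` A') (\<lambda>z z'. \<forall>j<n. Y.w (snd z) j * \<bar>Y.y (fst z j) - Y.y (fst z' j)\<bar> \<le> 72 * H / 2 ^ Suc l) (\<lambda>z. Y.coord_bnd l (fst z) (snd z))"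
    proof (rule split_code_mono[OF Y.coord_split_code[of "prod.swap ` A'" l]])
      show "prod.swap ` A' \<subseteq> Kset n m" using A A' Kset_swap by blast
      fix z z' j assume z: "z \<in> prod.swap ` A'" "z' \<in> prod.swap ` A'" and j: "j < n"
      from z obtain x x' where x: "x \<in> A'" "x' \<in> A'" "z = prod.swap x" "z' = prod.swap x'" by auto
      have "X.N (\<lambda>i. fst x i - fst x' i) \<le> 8 * H / 2 ^ Suc l" using R' x(1,2) by blast
      then show "\<bar>Y.w (snd z) j - Y.w (snd z') j\<bar> \<le> Y.thr l * H / 2"
        unfolding Y.thr_def x(3,4) snd_swap by (intro T.wt_close fs(1) subsetD[OF A'] x(1,2) j)
    qed (auto simp: Y.thr_def)
    from split_code_vimage[OF this] show ?thesis by simp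
  qed
  show ?thesis
    by (rule split_code_mono[OF split_code_comp[OF 123 4]]) (auto simp: rel_def bnd_def)
qed

text \<open>Here 384 = 4 * (72 + 3 * 8) by \<open>rho_le\<close>. Each seminorm code costs 4 + 18432
  * (2H)^2 / (8H)^2 = 1156 in total, and 8 * 1156 + 8 * 1156 + 4 * 1000 + 2 * 1000 <= 25000.\<close>

lemma gamma22_bound: "gamma22 (Kset m n) (rho m n r s a) \<le> ennreal (384 * H * sqrt (11 * 25000))"
proof (rule gamma22_le_split_code[where R = rel and bnd = bnd])
  show "Kset m n \<noteq> {}" using zero_in_Kset by blast
  show "0 \<le> 384 * H" using X.H by simp
  show "split_code A (rel (Suc l)) (bnd l)" if "A \<subseteq> Kset m n" "\<forall>x\<in>A. \<forall>y\<in>A. rel l x y" for l A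
    using that by (rule step)
  show "rel 0 z z'" if z: "z \<in> Kset m n" "z' \<in> Kset m n" for z z'
  proof -
    have K: "fst z \<in> B2plus m" "fst z' \<in> B2plus m" "snd z \<in> B2plus n" "snd z' \<in> B2plus n"
      using z by (auto simp: Kset_def)
    have y: "\<bar>rpow x e - rpow x' e\<bar> \<le> 1" if "0 \<le> x" "x \<le> 1" "0 \<le> x'" "x' \<le> 1" "0 \<le> e" for x x' e :: real
      using rpow_le_one[OF that(1,2,5)] rpow_le_one[OF that(3,4,5)] rpow_nonneg[of x e] rpow_nonneg[of x' e] by linarith
    have "X.w (snd z) i * \<bar>X.y (fst z i) - X.y (fst z' i)\<bar> \<le> 72 * H" if i: "i < m" for i
    proof -
      have "X.w (snd z) i * \<bar>X.y (fst z i) - X.y (fst z' i)\<bar> \<le> (4 * H) * 1"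
        using X.w_le[OF K(3) i] X.H B2plusD[OF K(1)] B2plusD[OF K(2)] i expo_bounds[OF X.s]
        by (intro mult_mono y) auto
      then show ?thesis using X.H by linarith
    qed
    moreover have "Y.w (fst z) j * \<bar>Y.y (snd z j) - Y.y (snd z' j)\<bar> \<le> 72 * H" if j: "j < n" for j
    proof -
      have "Y.w (fst z) j * \<bar>Y.y (snd z j) - Y.y (snd z' j)\<bar> \<le> (4 * H) * 1"
        using Y.w_le[OF K(1) j] X.H B2plusD[OF K(3)] B2plusD[OF K(4)] j expo_bounds[OF X.r]
        by (intro mult_mono y) auto
      then show ?thesis using X.H by linarith
    qed
    ultimately show ?thesis
      using X.N_diff_le[OF K(1,2)] Y.N_diff_le[OF K(3,4)] by (simp add: rel_def)
  qed
  show "rho m n r s a z z' \<le> 384 * H / 2 ^ l" if z: "z \<in> Kset m n" "z' \<in> Kset m n" "rel l z z'" for l z z'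
  proof -
    have "rho m n r s a z z' \<le> 4 * (72 * H / 2 ^ l + 3 * (8 * H / 2 ^ l))"
      by (rule rho_le[OF X.r X.s X.m X.n z(1,2)]) (use z(3) in \<open>auto simp: rel_def\<close>)
    also have "\<dots> = 384 * H / 2 ^ l" by (simp add: field_simps)
    finally show ?thesis .
  qed
  show "(\<Sum>l<K. bnd l z / 4 ^ l) \<le> 25000" if z: "z \<in> Kset m n" for z K
  proof -
    have Kz: "fst z \<in> B2plus m" "snd z \<in> B2plus n" using z by (auto simp: Kset_def)
    have "18432 * (2 * H)\<^sup>2 / (8 * H)\<^sup>2 = 1152" using X.H by (simp add: power2_eq_square)
    then have lin: "(\<Sum>l<K. X.sn.lin_bnd (8 * H) l (fst z) / 4 ^ l) \<le> 1156" "(\<Sum>l<K. Y.sn.lin_bnd (8 * H) l (snd z) / 4 ^ l) \<le> 1156"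
      using X.sn.lin_bnd_sum[of "fst z" "8 * H" K] Y.sn.lin_bnd_sum[of "snd z" "8 * H" K] X.H B2plusD(2)[OF Kz(1)] B2plusD(2)[OF Kz(2)]
      by (simp_all add: X.sn.sq_def Y.sn.sq_def)
    have "(\<Sum>l<K. bnd l z / 4 ^ l) = 8 * (\<Sum>l<K. X.sn.lin_bnd (8 * H) l (fst z) / 4 ^ l) + 8 * (\<Sum>l<K. Y.sn.lin_bnd (8 * H) l (snd z) / 4 ^ l)
      + 4 * (\<Sum>l<K. X.coord_bnd l (fst z) (snd z) / 4 ^ l) + 2 * (\<Sum>l<K. Y.coord_bnd l (snd z) (fst z) / 4 ^ l)"
      unfolding bnd_def sum_distrib_left sum.distrib[symmetric]
      by (intro sum.cong) (auto simp: field_simps)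
    also have "\<dots> \<le> 25000"
      using lin X.coord_bnd_sum[OF Kz, of K] Y.coord_bnd_sum[OF Kz(2,1), of K] by linarith
    finally show ?thesis .
  qed
qed

end

section \<open>From second moments to the tail hypothesis\<close>

lemma H_s_eq: "H_s m n s a = sqrt (\<integral>g. (col_norm s m n a g)\<^sup>2 \<partial>gauss {..<m})"
  by (simp add: H_s_def col_norm_def)

lemma H_r_eq: "H_r m n r a = H_s n m r (\<lambda>j i. a i j)"
  by (simp add: H_r_def H_s_def)

lemma gauss_sq_integrable:
  assumes "finite I" "i \<in> I"
  shows "integrable (gauss I) (\<lambda>g. (g i)\<^sup>2)"
proof (rule integrableI_nonneg)
  show "(\<lambda>g. (g i)\<^sup>2) \<in> borel_measurable (gauss I)"
    unfolding measurable_cong_sets[OF sets_gauss refl] using assms by measurable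
  show "(\<integral>\<^sup>+g. ennreal ((g i)\<^sup>2) \<partial>gauss I) < \<infinity>"
    using nn_integral_gauss_component[OF assms, of "\<lambda>x. ennreal (x\<^sup>2)"] std_second_moment_finite by simp
qed simp

lemma col_norm_sq_integrable:
  assumes "2 \<le> s" "0 < m" "0 < n"
  shows "integrable (gauss {..<m}) (\<lambda>g. (col_norm s m n a g)\<^sup>2)"
proof -
  define b where "b = (\<Sum>i<m. \<Sum>j<n. \<bar>a i j\<bar>)"
  have b0: "0 \<le> b" by (simp add: b_def sum_nonneg)
  have b: "\<bar>a i j\<bar> \<le> b" if "i < m" "j < n" for i j
  proof -
    have "\<bar>a i j\<bar> \<le> (\<Sum>j<n. \<bar>a i j\<bar>)" by (rule member_le_sum) (use that in auto)
    also have "\<dots> \<le> b" unfolding b_def by (rule member_le_sum) (use that in \<open>auto intro: sum_nonneg\<close>)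
    finally show ?thesis .
  qed
  have meas: "col_norm s m n a \<in> borel_measurable (gauss {..<m})"
    using col_norm_measurable[OF assms] by (simp add: measurable_cong_sets[OF sets_gauss refl])
  show ?thesis
  proof (rule Bochner_Integration.integrable_bound)
    show "integrable (gauss {..<m}) (\<lambda>g. b\<^sup>2 * (\<Sum>i<m. (g i)\<^sup>2))"
      by (intro integrable_mult_right Bochner_Integration.integrable_sum gauss_sq_integrable) auto
    show "(\<lambda>g. (col_norm s m n a g)\<^sup>2) \<in> borel_measurable (gauss {..<m})" using meas by simp
    show "AE g in gauss {..<m}. norm ((col_norm s m n a g)\<^sup>2) \<le> norm (b\<^sup>2 * (\<Sum>i<m. (g i)\<^sup>2))"
    proof (rule AE_I2)
      fix g
      have "(col_norm s m n a g)\<^sup>2 \<le> (b * L2_set g {..<m})\<^sup>2"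
        by (intro power_mono col_norm_le_L2[OF assms] col_norm_nonneg[OF assms]) (use b b0 in auto)
      then show "norm ((col_norm s m n a g)\<^sup>2) \<le> norm (b\<^sup>2 * (\<Sum>i<m. (g i)\<^sup>2))"
        by (simp add: power_mult_distrib L2_set_def sum_nonneg)
    qed
  qed
qed

lemma col_norm_tail:
  assumes "2 \<le> s" "0 < m" "0 < n" and H: "0 < H" "H_s m n s a \<le> H"
  shows "measure (gauss {..<m}) {g \<in> space (gauss {..<m}). 2 * H \<le> col_norm s m n a g} \<le> 1 / 4"
proof -
  interpret prob_space "gauss {..<m}" by (rule prob_space_gauss)
  have [measurable]: "col_norm s m n a \<in> borel_measurable (gauss {..<m})"
    using col_norm_measurable[OF assms(1-3)] by (simp add: measurable_cong_sets[OF sets_gauss refl])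
  define S where "S = {g \<in> space (gauss {..<m}). 2 * H \<le> col_norm s m n a g}"
  have S: "S \<in> sets (gauss {..<m})" unfolding S_def by measurable
  have "(2 * H)\<^sup>2 * prob S = (\<integral>g. (2 * H)\<^sup>2 * indicator S g \<partial>gauss {..<m})" using S by simp
  also have "\<dots> \<le> (\<integral>g. (col_norm s m n a g)\<^sup>2 \<partial>gauss {..<m})"
  proof (rule integral_mono[OF _ col_norm_sq_integrable[OF assms(1-3)]])
    show "integrable (gauss {..<m}) (\<lambda>g. (2 * H)\<^sup>2 * indicator S g :: real)"
      using S by (intro integrable_mult_right integrable_real_indicator) (auto simp: emeasure_eq_measure)
    show "(2 * H)\<^sup>2 * indicator S g \<le> (col_norm s m n a g)\<^sup>2" for g
      using H power_mono[of "2 * H" "col_norm s m n a g" 2] by (auto simp: indicator_def S_def)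
  qed
  also have "\<dots> = (H_s m n s a)\<^sup>2" by (simp add: H_s_eq)
  also have "\<dots> \<le> H\<^sup>2" using H by (intro power_mono) (auto simp: H_s_eq)
  finally have "H\<^sup>2 * (4 * prob S) \<le> H\<^sup>2 * 1" by (simp add: power_mult_distrib)
  then have "4 * prob S \<le> 1" using H by (subst (asm) mult_le_cancel_left_pos) auto
  then show ?thesis unfolding S_def by simp
qed

lemma H_s_nonneg: "0 \<le> H_s m n s a"
  by (simp add: H_s_eq)

text \<open>The locales need H > 0, while both moments vanish for the zero matrix. A slack e / c is
  therefore added to H; it contributes e to the bound and is then removed.\<close>

lemma gamma22_le_H:
  assumes r: "2 \<le> r" and s: "2 \<le> s" and m: "0 < m" and n: "0 < n"
    and a: "\<And>i j. \<lbrakk>i < m; j < n\<rbrakk> \<Longrightarrow> 0 \<le> a i j"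
  shows "gamma22 (Kset m n) (rho m n r s a) \<le> ennreal (384 * sqrt (11 * 25000) * (H_r m n r a + H_s m n s a))"
proof (rule ennreal_le_epsilon)
  fix e :: real assume e: "0 < e"
  define c :: real where "c = 384 * sqrt (11 * 25000)"
  have c: "0 < c" by (simp add: c_def)
  define H where "H = H_r m n r a + H_s m n s a + e / c"
  have Hr: "0 \<le> H_r m n r a" unfolding H_r_eq by (rule H_s_nonneg)
  have H: "0 < H" "H_s m n s a \<le> H" "H_r m n r a \<le> H"
    using Hr H_s_nonneg[of m n s a] divide_pos_pos[OF e c] unfolding H_def by linarith+
  interpret two_sided_bound m n r s a H
  proof
    show "measure (gauss {..<m}) {g \<in> space (gauss {..<m}). 2 * H \<le> col_norm s m n a g} \<le> 1 / 4"
      by (rule col_norm_tail[OF s m n H(1,2)])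
    show "measure (gauss {..<n}) {g \<in> space (gauss {..<n}). 2 * H \<le> col_norm r n m (\<lambda>j i. a i j) g} \<le> 1 / 4"
      by (rule col_norm_tail[OF r n m H(1)]) (use H(3) in \<open>simp add: H_r_eq\<close>)
  qed (use assms H in auto)
  have "gamma22 (Kset m n) (rho m n r s a) \<le> ennreal (384 * H * sqrt (11 * 25000))" by (rule gamma22_bound)
  also have "384 * H * sqrt (11 * 25000) = c * (H_r m n r a + H_s m n s a) + e"
  proof -
    have "384 * H * sqrt (11 * 25000) = c * H" by (simp add: c_def)
    also have "\<dots> = c * (H_r m n r a + H_s m n s a) + e" using c by (simp add: H_def distrib_left)
    finally show ?thesis .
  qed
  also have "ennreal \<dots> = ennreal (c * (H_r m n r a + H_s m n s a)) + ennreal e"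
    using c e Hr H_s_nonneg[of m n s a] by (intro ennreal_plus) auto
  finally show "gamma22 (Kset m n) (rho m n r s a) \<le> ennreal (384 * sqrt (11 * 25000) * (H_r m n r a + H_s m n s a)) + ennreal e"
    by (simp add: c_def)
qed

section \<open>The bound on the Gaussian moments\<close>

text \<open>Unlike \<open>powr_le_exp\<close> it keeps the 1, so that no factor 2^k appears when
  \<open>std_row_factor\<close> takes a k-th power.\<close>

lemma one_plus_powr_le_exp:
  fixes z q :: real
  assumes "0 \<le> z" "1 \<le> q"
  shows "1 + z powr q \<le> exp (q * z)"
proof (cases "z \<le> 1")
  case True
  have "z powr q \<le> z powr 1" using True assms by (intro powr_mono') auto
  then have "1 + z powr q \<le> 1 + z" using assms by simp
  also have "\<dots> \<le> 1 + q * z" using assms mult_right_mono[of 1 q z] by simp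
  also have "\<dots> \<le> exp (q * z)" by (rule exp_ge_add_one_self)
  finally show ?thesis .
next
  case False
  have "z powr q = exp (q * ln z)" using False by (simp add: powr_def)
  also have "\<dots> \<le> exp (q * (z - 1))" using False assms ln_le_minus_one[of z] by simp
  also have "\<dots> = exp (q * z) * exp (- q)" by (simp add: right_diff_distrib flip: exp_add)
  also have "\<dots> \<le> exp (q * z) * (1 / 2)"
  proof (rule mult_left_mono)
    have "2 \<le> exp q" using exp_ge_add_one_self[of q] assms by linarith
    then show "exp (- q) \<le> 1 / 2" by (simp add: exp_minus field_simps)
  qed simp
  finally have 1: "z powr q \<le> exp (q * z) * (1 / 2)" .
  have "1 * 1 \<le> q * z" using False assms by (intro mult_mono) auto
  then have "2 \<le> exp (q * z)" using exp_ge_add_one_self[of "q * z"] by linarith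
  then show ?thesis using 1 by simp
qed

lemma powr_le_exp:
  fixes z q :: real
  assumes "0 \<le> z" "0 \<le> q"
  shows "z powr q \<le> exp (q * z)"
proof (cases "z = 0")
  case False
  then have "ln z \<le> z" using assms ln_le_minus_one[of z] by simp
  then show ?thesis using False assms by (simp add: powr_def mult_left_mono)
qed simp

lemma one_plus_power_le:
  fixes x :: real
  assumes "0 \<le> x"
  shows "(1 + x) ^ k \<le> 1 + real k * x * (1 + x) ^ k"
proof (induction k)
  case (Suc k)
  have "(1 + x) ^ Suc k \<le> (1 + x) * (1 + real k * x * (1 + x) ^ k)" using Suc assms by (simp add: mult_left_mono)
  also have "\<dots> = 1 + x + real k * x * (1 + x) ^ Suc k" by (simp add: algebra_simps)
  also have "\<dots> \<le> 1 + x * (1 + x) ^ Suc k + real k * x * (1 + x) ^ Suc k"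
    using assms mult_left_mono[OF one_le_power[of "1 + x" "Suc k"], of x] by simp
  also have "\<dots> = 1 + real (Suc k) * x * (1 + x) ^ Suc k" by (simp add: algebra_simps)
  finally show ?case .
qed simp

lemma sum_le_prod_one_plus:
  fixes x :: "'i \<Rightarrow> real"
  assumes "finite I" "\<And>i. i \<in> I \<Longrightarrow> 0 \<le> x i"
  shows "1 + (\<Sum>i\<in>I. x i) \<le> (\<Prod>i\<in>I. 1 + x i)"
  using assms
proof (induction I)
  case (insert i I)
  have "0 \<le> (\<Sum>i\<in>I. x i)" using insert by (intro sum_nonneg) auto
  then have "1 + (x i + (\<Sum>i\<in>I. x i)) \<le> (1 + x i) * (1 + (\<Sum>i\<in>I. x i))"
    using insert by (simp add: algebra_simps)
  also have "\<dots> \<le> (1 + x i) * (\<Prod>i\<in>I. 1 + x i)" using insert by (intro mult_left_mono) auto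
  finally show ?case using insert by simp
qed simp

text \<open>The bound must be close to 1 when c is small, so that a product over many rows stays
  bounded. With Y = (c |x| / T)^p, the inequality (1 + Y)^k <= 1 + k Y (1 + Y)^k isolates one factor
  Y, estimated by B/4 * exp(x^2/8), while \<open>ck\<close> bounds the remaining power by
  exp(x^2/32). The Gaussian exponential moment then gives 1 + k B sqrt 2 / 4 <= exp(k B).\<close>

lemma std_row_factor:
  fixes c T p :: real and k :: nat
  assumes c: "0 \<le> c" and T: "0 < T" and p: "2 \<le> p" and k: "1 \<le> k" and ck: "4 * sqrt (real k * p) * c \<le> T"
  shows "(\<integral>\<^sup>+x. ennreal ((1 + (c * \<bar>x\<bar> / T) powr p) ^ k) \<partial>std) \<le> ennreal (exp (real k * (4 * sqrt p * c / T) powr p))"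
proof -
  interpret prob_space std by (rule prob_space_std)
  define B where "B = (4 * sqrt p * c / T) powr p"
  have ee: "ennreal (1 + A * e) = 1 + ennreal A * ennreal e" if "0 \<le> A" "0 \<le> e" for A e :: real
    using that by (simp add: ennreal_plus ennreal_mult)
  have kp: "0 < real k * p" using k p by simp
  have pt: "(1 + (c * \<bar>x\<bar> / T) powr p) ^ k \<le> 1 + real k * B / 4 * exp (x\<^sup>2 / 4)" for x
  proof -
    define Y where "Y = (c * \<bar>x\<bar> / T) powr p"
    have Y0: "0 \<le> Y" by (simp add: Y_def)
    have sq: "t powr p = (t\<^sup>2) powr (p / 2)" if "0 \<le> t" for t :: real
      using that by (simp add: powr_powr flip: powr_numeral)
    have "c / T \<le> 1 / (4 * sqrt (real k * p))" using ck T kp by (simp add: field_simps)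
    then have "c / T * \<bar>x\<bar> \<le> 1 / (4 * sqrt (real k * p)) * \<bar>x\<bar>" by (rule mult_right_mono) simp
    then have "Y \<le> (\<bar>x\<bar> / (4 * sqrt (real k * p))) powr p"
      unfolding Y_def using c T p by (intro powr_mono2) auto
    also have "\<dots> = ((\<bar>x\<bar> / (4 * sqrt (real k * p)))\<^sup>2) powr (p / 2)" using kp by (intro sq) auto
    also have "(\<bar>x\<bar> / (4 * sqrt (real k * p)))\<^sup>2 = x\<^sup>2 / (16 * (real k * p))"
      using kp by (simp add: power_divide power_mult_distrib)
    finally have "1 + Y \<le> 1 + (x\<^sup>2 / (16 * (real k * p))) powr (p / 2)" by simp
    also have "\<dots> \<le> exp (p / 2 * (x\<^sup>2 / (16 * (real k * p))))"
      using kp p by (intro one_plus_powr_le_exp) auto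
    finally have "(1 + Y) ^ k \<le> exp (p / 2 * (x\<^sup>2 / (16 * (real k * p)))) ^ k" using Y0 by (intro power_mono) auto
    also have "\<dots> = exp (x\<^sup>2 / 32)" using kp p k by (simp flip: exp_of_nat_mult)
    finally have 1: "(1 + Y) ^ k \<le> exp (x\<^sup>2 / 32)" .
    have "Y = (4 * sqrt p * c / T * (\<bar>x\<bar> / (4 * sqrt p))) powr p" using p by (simp add: Y_def)
    also have "\<dots> = B * (\<bar>x\<bar> / (4 * sqrt p)) powr p" unfolding B_def by (rule powr_mult)
    also have "(\<bar>x\<bar> / (4 * sqrt p)) powr p = ((\<bar>x\<bar> / (4 * sqrt p))\<^sup>2) powr (p / 2)" using p by (intro sq) auto
    also have "(\<bar>x\<bar> / (4 * sqrt p))\<^sup>2 = 1 / 4 * (x\<^sup>2 / (4 * p))"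
      using p by (simp add: power_divide power_mult_distrib)
    also have "(1 / 4 * (x\<^sup>2 / (4 * p))) powr (p / 2) = (1 / 4) powr (p / 2) * (x\<^sup>2 / (4 * p)) powr (p / 2)" by (rule powr_mult)
    also have "\<dots> \<le> (1 / 4) powr 1 * exp (p / 2 * (x\<^sup>2 / (4 * p)))"
      using p by (intro mult_mono powr_mono' powr_le_exp) auto
    also have "p / 2 * (x\<^sup>2 / (4 * p)) = x\<^sup>2 / 8" using p by simp
    finally have 2: "Y \<le> B * (1 / 4 * exp (x\<^sup>2 / 8))" by (simp add: B_def mult_left_mono)
    have "(1 + Y) ^ k \<le> 1 + real k * Y * (1 + Y) ^ k" by (rule one_plus_power_le[OF Y0])
    also have "\<dots> \<le> 1 + real k * (B * (1 / 4 * exp (x\<^sup>2 / 8))) * exp (x\<^sup>2 / 32)"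
      using 1 2 Y0 by (intro add_left_mono mult_mono) (auto simp: B_def)
    also have "\<dots> = 1 + real k * B / 4 * (exp (x\<^sup>2 / 8) * exp (x\<^sup>2 / 32))" by simp
    also have "\<dots> = 1 + real k * B / 4 * exp (x\<^sup>2 / 8 + x\<^sup>2 / 32)" by (simp only: exp_add)
    also have "\<dots> \<le> 1 + real k * B / 4 * exp (x\<^sup>2 / 4)"
      by (intro add_left_mono mult_left_mono) (auto simp: B_def)
    finally show ?thesis by (simp add: Y_def)
  qed
  have "(\<integral>\<^sup>+x. ennreal ((1 + (c * \<bar>x\<bar> / T) powr p) ^ k) \<partial>std) \<le> (\<integral>\<^sup>+x. 1 + ennreal (real k * B / 4) * ennreal (exp (x\<^sup>2 / 4)) \<partial>std)"
  proof (rule nn_integral_mono)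
    fix x
    have "ennreal ((1 + (c * \<bar>x\<bar> / T) powr p) ^ k) \<le> ennreal (1 + real k * B / 4 * exp (x\<^sup>2 / 4))"
      by (intro ennreal_leI pt)
    also have "\<dots> = 1 + ennreal (real k * B / 4) * ennreal (exp (x\<^sup>2 / 4))"
      by (intro ee) (auto simp: B_def)
    finally show "ennreal ((1 + (c * \<bar>x\<bar> / T) powr p) ^ k) \<le> 1 + ennreal (real k * B / 4) * ennreal (exp (x\<^sup>2 / 4))" .
  qed
  also have "\<dots> = 1 + ennreal (real k * B / 4) * ennreal (sqrt 2)"
    by (subst nn_integral_add) (auto simp: nn_integral_cmult std_exp_moment emeasure_space_1[simplified])
  also have "\<dots> = ennreal (1 + real k * B / 4 * sqrt 2)"
    by (intro ee[symmetric]) (auto simp: B_def)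
  also have "\<dots> \<le> ennreal (exp (real k * B))"
  proof (rule ennreal_leI)
    have "real k * B * (sqrt 2 / 4) \<le> real k * B * 1" using two_sqrt_two_le by (intro mult_left_mono) (auto simp: B_def)
    then have "1 + real k * B / 4 * sqrt 2 \<le> 1 + real k * B" by simp
    then show "1 + real k * B / 4 * sqrt 2 \<le> exp (real k * B)" using exp_ge_add_one_self[of "real k * B"] by linarith
  qed
  finally show ?thesis by (simp add: B_def)
qed

text \<open>The p k-th power of the norm is the k-th power of a sum of independent terms Y i, which
  is at most the product of the (1 + Y i)^k. Independence factorises the expectation, and
  \<open>cp\<close> says that the resulting exponents add up to at most k.\<close>

lemma row_moment:
  fixes c :: "'i \<Rightarrow> real"
  assumes I: "finite I" and c: "\<And>i. i \<in> I \<Longrightarrow> 0 \<le> c i" and T: "0 < T" and p: "2 \<le> p" and k: "1 \<le> k"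
    and ck: "\<And>i. i \<in> I \<Longrightarrow> 4 * sqrt (real k * p) * c i \<le> T" and cp: "4 * sqrt p * lp p I c \<le> T"
  shows "(\<integral>\<^sup>+g. ennreal ((lp p I (\<lambda>i. c i * g i) / T) powr (p * real k)) \<partial>gauss I) \<le> ennreal (exp (real k))"
proof -
  define Y where "Y = (\<lambda>i x. (c i * \<bar>x\<bar> / T) powr p)"
  have Y0: "0 \<le> Y i x" for i x by (simp add: Y_def)
  have pt: "(lp p I (\<lambda>i. c i * g i) / T) powr (p * real k) \<le> (\<Prod>i\<in>I. (1 + Y i (g i)) ^ k)" for g
  proof -
    have "(lp p I (\<lambda>i. c i * g i) / T) powr p = (\<Sum>i\<in>I. \<bar>c i * g i\<bar> powr p) / T powr p"
      using p by (simp add: powr_divide lp_powr)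
    also have "\<dots> = (\<Sum>i\<in>I. Y i (g i))"
      unfolding sum_divide_distrib Y_def using c T by (intro sum.cong) (auto simp: powr_divide abs_mult)
    finally have e: "(lp p I (\<lambda>i. c i * g i) / T) powr p = (\<Sum>i\<in>I. Y i (g i))" .
    have "(lp p I (\<lambda>i. c i * g i) / T) powr (p * real k) = (\<Sum>i\<in>I. Y i (g i)) ^ k"
      unfolding powr_powr[symmetric] e using k by (intro powr_realpow') (auto intro: sum_nonneg Y0)
    also have "\<dots> \<le> (\<Prod>i\<in>I. 1 + Y i (g i)) ^ k"
      using sum_le_prod_one_plus[OF I, of "\<lambda>i. Y i (g i)"] Y0 by (intro power_mono sum_nonneg) auto
    finally show ?thesis by (simp add: prod_power_distrib)
  qed
  have "(\<integral>\<^sup>+g. ennreal ((lp p I (\<lambda>i. c i * g i) / T) powr (p * real k)) \<partial>gauss I)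
     \<le> (\<integral>\<^sup>+g. (\<Prod>i\<in>I. ennreal ((1 + Y i (g i)) ^ k)) \<partial>gauss I)"
  proof (rule nn_integral_mono)
    fix g
    have "(\<Prod>i\<in>I. ennreal ((1 + Y i (g i)) ^ k)) = ennreal (\<Prod>i\<in>I. (1 + Y i (g i)) ^ k)"
      using Y0 by (intro prod_ennreal) auto
    then show "ennreal ((lp p I (\<lambda>i. c i * g i) / T) powr (p * real k)) \<le> (\<Prod>i\<in>I. ennreal ((1 + Y i (g i)) ^ k))"
      using pt[of g] by (simp add: ennreal_leI)
  qed
  also have "\<dots> = (\<Prod>i\<in>I. \<integral>\<^sup>+x. ennreal ((1 + Y i x) ^ k) \<partial>std)"
    by (rule nn_integral_gauss_prod[OF I]) (simp add: Y_def)
  also have "\<dots> \<le> (\<Prod>i\<in>I. ennreal (exp (real k * (4 * sqrt p * c i / T) powr p)))"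
    unfolding Y_def by (intro prod_mono_ennreal std_row_factor c T p k ck)
  also have "\<dots> = ennreal (exp (real k * (\<Sum>i\<in>I. (4 * sqrt p * c i / T) powr p)))"
    using I by (simp add: prod_ennreal exp_sum sum_distrib_left)
  also have "\<dots> \<le> ennreal (exp (real k))"
  proof (rule ennreal_leI)
    have "(\<Sum>i\<in>I. (4 * sqrt p * c i / T) powr p) = (4 * sqrt p / T) powr p * (\<Sum>i\<in>I. \<bar>c i\<bar> powr p)"
      unfolding sum_distrib_left using c T p by (intro sum.cong) (auto simp: powr_mult[symmetric])
    also have "\<dots> = (4 * sqrt p / T * lp p I c) powr p"
      using p by (subst powr_mult, subst lp_powr) auto
    also have "\<dots> \<le> 1" using cp T p by (intro powr_le1) (auto simp: abs_mult field_simps)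
    finally have "real k * (\<Sum>i\<in>I. (4 * sqrt p * c i / T) powr p) \<le> real k * 1" by (intro mult_left_mono) auto
    then show "exp (real k * (\<Sum>i\<in>I. (4 * sqrt p * c i / T) powr p)) \<le> exp (real k)" by simp
  qed
  finally show ?thesis .
qed

lemma exp_two_le: "exp (2::real) \<le> 9"
proof -
  have "exp (2::real) = exp 1 * exp 1" by (simp flip: exp_add)
  also have "\<dots> \<le> 3 * 3" using exp_le by (intro mult_mono) auto
  finally show ?thesis by simp
qed

text \<open>Each column is raised to its own power \<open>p k\<^sub>j\<close>, of order \<open>\<tau>\<^sup>2 / b\<^sub>j\<^sup>2\<close>, so that the
  union bound over the columns costs only a constant.\<close>

lemma max_column_moment:
  fixes a :: "nat \<Rightarrow> nat \<Rightarrow> real"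
  assumes m: "0 < m" and n: "0 < n" and p: "2 \<le> p" and tau: "0 < \<tau>"
    and a: "\<And>i j. \<lbrakk>i < m; j < n\<rbrakk> \<Longrightarrow> 0 \<le> a i j"
    and b: "\<And>i j. \<lbrakk>i < m; j < n\<rbrakk> \<Longrightarrow> a i j \<le> b j" "\<And>j. j < n \<Longrightarrow> 0 \<le> b j"
    and D: "\<And>j. j < n \<Longrightarrow> lp p {..<m} (\<lambda>i. a i j) \<le> D" "\<And>j. j < n \<Longrightarrow> b j \<le> D"
    and small: "(\<Sum>j | j < n \<and> 0 < b j. exp (- \<tau>\<^sup>2 / (b j)\<^sup>2)) \<le> 32"
  shows "H_s m n (ereal p) a \<le> 432 * (sqrt p * D + \<tau>)"
proof -
  define T where "T = 8 * (sqrt p * D + \<tau>)"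
  \<comment> \<open>Since 9 >= exp 2, enlarging T to 9T gains exp(-2 p k) in the moment of order p
    k. This beats exp k and still leaves exp(-p k).\<close>
  define T' where "T' = 9 * T"
  have D0: "0 \<le> D" using b(2) D(2) n by (meson order_trans)
  have T: "0 < T" using tau D0 p by (simp add: T_def add_nonneg_pos)
  have pD: "0 \<le> sqrt p * D" using D0 p by simp
  have eight: "4 * x \<le> 8 * (y + t)" if "x \<le> t + y" "0 \<le> y" "0 < t" for x y t :: real
  proof -
    have "4 * x \<le> 4 * (t + y)" by (rule mult_left_mono[OF that(1)]) simp
    also have "\<dots> \<le> 8 * (y + t)" using that(2,3) by (simp add: distrib_left)
    finally show ?thesis .
  qed
  define J where "J = {j. j < n \<and> 0 < b j}"
  \<comment> \<open>Rounded up so that p k >= tau^2 / b^2, which gives the decay; at least 1 so that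
    the order p k is at least 2 and dominates the square in \<open>H_s\<close>.\<close>
  define k where "k = (\<lambda>j. max 1 (nat \<lceil>\<tau>\<^sup>2 / (p * (b j)\<^sup>2)\<rceil>))"
  define X where "X = (\<lambda>j g. lp p {..<m} (\<lambda>i. a i j * g i))"
  have s: "2 \<le> ereal p" using p by simp
  have kj: "1 \<le> k j" "\<tau>\<^sup>2 / (b j)\<^sup>2 \<le> p * real (k j)" "4 * sqrt (real (k j) * p) * b j \<le> T" if j: "j \<in> J" for j
  proof -
    have bj: "0 < b j" "j < n" using j by (auto simp: J_def)
    show k1: "1 \<le> k j" by (simp add: k_def)
    have q0: "0 \<le> \<tau>\<^sup>2 / (p * (b j)\<^sup>2)" using p by simp
    have k2: "\<tau>\<^sup>2 / (p * (b j)\<^sup>2) \<le> real (k j)" unfolding k_def by linarith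
    have k3: "real (k j) \<le> \<tau>\<^sup>2 / (p * (b j)\<^sup>2) + 1" unfolding k_def using q0 by linarith
    have "p * (\<tau>\<^sup>2 / (p * (b j)\<^sup>2)) \<le> p * real (k j)" by (intro mult_left_mono k2) (use p in simp)
    then show "\<tau>\<^sup>2 / (b j)\<^sup>2 \<le> p * real (k j)" using p by simp
    have "real (k j) * p * (b j)\<^sup>2 \<le> (\<tau>\<^sup>2 / (p * (b j)\<^sup>2) + 1) * p * (b j)\<^sup>2"
      using p by (intro mult_right_mono k3) auto
    also have "\<dots> = \<tau>\<^sup>2 + p * (b j)\<^sup>2" using p bj by (simp add: distrib_right)
    also have "\<dots> \<le> (\<tau> + sqrt p * b j)\<^sup>2" using p bj tau by (simp add: power2_sum power_mult_distrib)
    finally have "sqrt (real (k j) * p * (b j)\<^sup>2) \<le> \<tau> + sqrt p * b j"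
      using bj tau p by (intro real_le_lsqrt) auto
    then have "sqrt (real (k j) * p) * b j \<le> \<tau> + sqrt p * b j" using bj by (simp add: real_sqrt_mult)
    also have "\<dots> \<le> \<tau> + sqrt p * D" using D(2)[OF bj(2)] p by (intro add_left_mono mult_left_mono) auto
    finally have "4 * (sqrt (real (k j) * p) * b j) \<le> T" using pD tau unfolding T_def by (rule eight)
    then show "4 * sqrt (real (k j) * p) * b j \<le> T" by (simp add: mult.assoc)
  qed
  have mom: "(\<integral>\<^sup>+g. ennreal ((X j g / T') powr (p * real (k j))) \<partial>gauss {..<m}) \<le> ennreal (exp (- \<tau>\<^sup>2 / (b j)\<^sup>2))" if j: "j \<in> J" for j
  proof -
    have jn: "j < n" using j by (simp add: J_def)
    have p0: "0 \<le> p * real (k j)" using p by simp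
    have kp: "real (k j) \<le> p * real (k j)" using p mult_right_mono[of 1 p "real (k j)"] by simp
    have e: "(X j g / T') powr (p * real (k j)) \<le> exp (- 2 * (p * real (k j))) * (X j g / T) powr (p * real (k j))" for g
    proof -
      have "(X j g / T') powr (p * real (k j)) = (1 / 9) powr (p * real (k j)) * (X j g / T) powr (p * real (k j))"
        by (simp add: T'_def powr_mult[symmetric])
      also have "(1 / 9 :: real) powr (p * real (k j)) \<le> exp (- 2) powr (p * real (k j))"
        using exp_two_le p0 by (intro powr_mono2) (auto simp: exp_minus field_simps)
      also have "exp (- 2 :: real) powr (p * real (k j)) = exp (- 2 * (p * real (k j)))" by (simp add: powr_def)
      finally show ?thesis by (simp add: mult_right_mono)
    qed
    have "(\<integral>\<^sup>+g. ennreal ((X j g / T') powr (p * real (k j))) \<partial>gauss {..<m})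
       \<le> (\<integral>\<^sup>+g. ennreal (exp (- 2 * (p * real (k j)))) * ennreal ((X j g / T) powr (p * real (k j))) \<partial>gauss {..<m})"
    proof (rule nn_integral_mono)
      fix g
      have "ennreal ((X j g / T') powr (p * real (k j))) \<le> ennreal (exp (- 2 * (p * real (k j))) * (X j g / T) powr (p * real (k j)))"
        by (intro ennreal_leI e)
      also have "\<dots> = ennreal (exp (- 2 * (p * real (k j)))) * ennreal ((X j g / T) powr (p * real (k j)))"
        by (rule ennreal_mult) auto
      finally show "ennreal ((X j g / T') powr (p * real (k j))) \<le> ennreal (exp (- 2 * (p * real (k j)))) * ennreal ((X j g / T) powr (p * real (k j)))" .
    qed
    also have "\<dots> = ennreal (exp (- 2 * (p * real (k j)))) * (\<integral>\<^sup>+g. ennreal ((X j g / T) powr (p * real (k j))) \<partial>gauss {..<m})"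
    proof (rule nn_integral_cmult)
      have "(\<lambda>g. lnorm (ereal p) {..<m} (\<lambda>i. a i j * g i)) \<in> borel_measurable (gauss {..<m})"
        unfolding measurable_cong_sets[OF sets_gauss refl] by (rule lnorm_measurable[OF s]) (use m in auto)
      then show "(\<lambda>g. ennreal ((X j g / T) powr (p * real (k j)))) \<in> borel_measurable (gauss {..<m})"
        unfolding X_def lnorm_ereal by measurable
    qed
    also have "\<dots> \<le> ennreal (exp (- 2 * (p * real (k j)))) * ennreal (exp (real (k j)))"
    proof (rule mult_left_mono)
      show "(\<integral>\<^sup>+g. ennreal ((X j g / T) powr (p * real (k j))) \<partial>gauss {..<m}) \<le> ennreal (exp (real (k j)))"
        unfolding X_def
      proof (rule row_moment)
        show "4 * sqrt (real (k j) * p) * a i j \<le> T" if "i \<in> {..<m}" for i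
        proof -
          have "4 * sqrt (real (k j) * p) * a i j \<le> 4 * sqrt (real (k j) * p) * b j"
            using b(1)[of i j] that jn p by (intro mult_left_mono) auto
          then show ?thesis using kj(3)[OF j] by linarith
        qed
        have "4 * sqrt p * lp p {..<m} (\<lambda>i. a i j) \<le> 4 * sqrt p * D" using D(1)[OF jn] p by (intro mult_left_mono) auto
        also have "\<dots> = 4 * (sqrt p * D)" by simp
        also have "\<dots> \<le> T" unfolding T_def by (rule eight[OF _ pD tau]) (use tau in simp)
        finally show "4 * sqrt p * lp p {..<m} (\<lambda>i. a i j) \<le> T" .
      qed (use a jn T p kj(1)[OF j] in auto)
    qed simp
    also have "\<dots> = ennreal (exp (real (k j) - 2 * (p * real (k j))))" by (simp add: exp_diff exp_minus field_simps flip: ennreal_mult)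
    also have "\<dots> \<le> ennreal (exp (- \<tau>\<^sup>2 / (b j)\<^sup>2))"
      using kj(2)[OF j] kp by (intro ennreal_leI) simp
    finally show ?thesis .
  qed
  \<comment> \<open>A maximum exceeding T' is attained in a column whose own power, of order at
    least 2, exceeds the square. Such a column has b > 0, as the others vanish identically.\<close>
  have pt: "(col_norm (ereal p) m n a g)\<^sup>2 \<le> T'\<^sup>2 * (1 + (\<Sum>j\<in>J. (X j g / T') powr (p * real (k j))))" for g
  proof -
    have "col_norm (ereal p) m n a g = Max ((\<lambda>j. X j g) ` {..<n})"
      by (simp add: col_norm_def lnorm_ereal X_def)
    also have "\<dots> \<in> (\<lambda>j. X j g) ` {..<n}" by (rule Max_in) (use n in auto)
    finally have "col_norm (ereal p) m n a g \<in> (\<lambda>j. X j g) ` {..<n}" .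
    then obtain j where j: "col_norm (ereal p) m n a g = X j g" "j < n" by auto
    have T'0: "0 < T'" using T by (simp add: T'_def)
    have s0: "0 \<le> (\<Sum>j\<in>J. (X j g / T') powr (p * real (k j)))" by (intro sum_nonneg) auto
    have X0: "0 \<le> X j g" by (simp add: X_def)
    have "(X j g / T')\<^sup>2 \<le> 1 + (\<Sum>j\<in>J. (X j g / T') powr (p * real (k j)))"
    proof (cases "X j g / T' \<le> 1")
      case True
      then have "(X j g / T')\<^sup>2 \<le> 1" using X0 T'0 by (intro power_le_one) auto
      then show ?thesis using s0 by linarith
    next
      case False
      have "j \<in> J"
      proof (rule ccontr)
        assume "j \<notin> J"
        then have "b j = 0" using j b(2)[OF j(2)] by (auto simp: J_def)
        then have "a i j = 0" if "i < m" for i using a[OF that j(2)] b(1)[OF that j(2)] by simp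
        then have "X j g = 0" using p by (simp add: X_def lp_def)
        then show False using False by simp
      qed
      have "2 * 1 \<le> p * real (k j)" using p kj(1)[OF \<open>j \<in> J\<close>] by (intro mult_mono) auto
      then have "(X j g / T') powr 2 \<le> (X j g / T') powr (p * real (k j))" using False by (intro powr_mono) auto
      also have "\<dots> \<le> (\<Sum>j\<in>J. (X j g / T') powr (p * real (k j)))"
        by (rule member_le_sum[OF \<open>j \<in> J\<close>]) (auto simp: J_def)
      finally show ?thesis using X0 T'0 by simp
    qed
    then have "T'\<^sup>2 * (X j g / T')\<^sup>2 \<le> T'\<^sup>2 * (1 + (\<Sum>j\<in>J. (X j g / T') powr (p * real (k j))))"
      by (intro mult_left_mono) auto
    then show ?thesis unfolding j(1) using T'0 by (simp add: power_divide)
  qed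
  interpret prob_space "gauss {..<m}" by (rule prob_space_gauss)
  have Xm: "(\<lambda>g. (X j g / T') powr (p * real (k j))) \<in> borel_measurable (gauss {..<m})" for j
  proof -
    have "(\<lambda>g. lnorm (ereal p) {..<m} (\<lambda>i. a i j * g i)) \<in> borel_measurable (gauss {..<m})"
      unfolding measurable_cong_sets[OF sets_gauss refl] by (rule lnorm_measurable[OF s]) (use m in auto)
    then show ?thesis unfolding X_def lnorm_ereal by measurable
  qed
  have "(\<integral>\<^sup>+g. ennreal ((col_norm (ereal p) m n a g)\<^sup>2) \<partial>gauss {..<m})
    \<le> (\<integral>\<^sup>+g. ennreal (T'\<^sup>2) * (1 + (\<Sum>j\<in>J. ennreal ((X j g / T') powr (p * real (k j))))) \<partial>gauss {..<m})"
  proof (rule nn_integral_mono)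
    fix g
    have "ennreal ((col_norm (ereal p) m n a g)\<^sup>2) \<le> ennreal (T'\<^sup>2 * (1 + (\<Sum>j\<in>J. (X j g / T') powr (p * real (k j)))))"
      by (intro ennreal_leI pt)
    also have "\<dots> = ennreal (T'\<^sup>2) * (1 + (\<Sum>j\<in>J. ennreal ((X j g / T') powr (p * real (k j)))))"
      by (simp add: ennreal_mult sum_nonneg add_nonneg_nonneg flip: ennreal_1)
    finally show "ennreal ((col_norm (ereal p) m n a g)\<^sup>2) \<le> ennreal (T'\<^sup>2) * (1 + (\<Sum>j\<in>J. ennreal ((X j g / T') powr (p * real (k j)))))" .
  qed
  also have "\<dots> = ennreal (T'\<^sup>2) * (1 + (\<Sum>j\<in>J. \<integral>\<^sup>+g. ennreal ((X j g / T') powr (p * real (k j))) \<partial>gauss {..<m}))"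
  proof -
    have Ym: "(\<lambda>g. ennreal ((X j g / T') powr (p * real (k j)))) \<in> borel_measurable (gauss {..<m})" for j
      using Xm by measurable
    have Zm: "(\<lambda>g. \<Sum>j\<in>J. ennreal ((X j g / T') powr (p * real (k j)))) \<in> borel_measurable (gauss {..<m})"
      using Ym by measurable
    have "(\<integral>\<^sup>+g. 1 + (\<Sum>j\<in>J. ennreal ((X j g / T') powr (p * real (k j)))) \<partial>gauss {..<m})
       = (\<integral>\<^sup>+g. 1 \<partial>gauss {..<m}) + (\<integral>\<^sup>+g. (\<Sum>j\<in>J. ennreal ((X j g / T') powr (p * real (k j)))) \<partial>gauss {..<m})"
      by (rule nn_integral_add) (use Zm in auto)
    also have "(\<integral>\<^sup>+g. 1 \<partial>gauss {..<m}) = 1" by (simp add: emeasure_space_1)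
    also have "(\<integral>\<^sup>+g. (\<Sum>j\<in>J. ennreal ((X j g / T') powr (p * real (k j)))) \<partial>gauss {..<m})
       = (\<Sum>j\<in>J. \<integral>\<^sup>+g. ennreal ((X j g / T') powr (p * real (k j))) \<partial>gauss {..<m})"
      by (rule nn_integral_sum) (rule Ym)
    finally show ?thesis
      using Zm by (subst nn_integral_cmult) simp_all
  qed
  also have "\<dots> \<le> ennreal (T'\<^sup>2) * (1 + (\<Sum>j\<in>J. ennreal (exp (- \<tau>\<^sup>2 / (b j)\<^sup>2))))"
    by (intro mult_left_mono add_left_mono sum_mono mom) auto
  also have "\<dots> = ennreal (T'\<^sup>2 * (1 + (\<Sum>j\<in>J. exp (- \<tau>\<^sup>2 / (b j)\<^sup>2))))"
    by (simp add: ennreal_mult sum_nonneg add_nonneg_nonneg flip: ennreal_1)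
  \<comment> \<open>1 + 32 is rounded up to the square 36, and 6 * 9 * 8 = 432.\<close>
  also have "\<dots> \<le> ennreal (T'\<^sup>2 * 36)"
    using small by (intro ennreal_leI mult_left_mono) (auto simp: J_def)
  finally have "(\<integral>g. (col_norm (ereal p) m n a g)\<^sup>2 \<partial>gauss {..<m}) \<le> T'\<^sup>2 * 36"
    using col_norm_sq_integrable[OF s m n, of a] by (simp add: nn_integral_eq_integral)
  then have "H_s m n (ereal p) a \<le> sqrt (T'\<^sup>2 * 36)" unfolding H_s_eq by (rule real_sqrt_le_mono)
  also have "\<dots> = 432 * (sqrt p * D + \<tau>)" using T by (simp add: real_sqrt_mult T'_def T_def)
  finally show ?thesis .
qed

section \<open>Counting large entries by means of \<open>S_star\<close>\<close>

lemma S_star_integrable: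
  fixes m n :: nat and a :: "nat \<Rightarrow> nat \<Rightarrow> real"
  assumes m: "0 < m" and n: "0 < n"
  shows "integrable (gauss ({..<m} \<times> {..<n})) (\<lambda>g. MAX (i, j)\<in>{..<m} \<times> {..<n}. \<bar>a i j * g (i, j)\<bar> :: real)"
proof -
  let ?I = "{..<m} \<times> {..<n}"
  have I: "finite ?I" "?I \<noteq> {}" using m n by auto
  interpret prob_space "gauss ?I" by (rule prob_space_gauss)
  have comp: "(\<lambda>g. g x) \<in> borel_measurable (gauss ?I)" if "x \<in> ?I" for x
    unfolding measurable_cong_sets[OF sets_gauss refl] using that by measurable
  have meas: "(\<lambda>g. MAX x\<in>?I. \<bar>(case x of (i, j) \<Rightarrow> a i j) * g x\<bar>) \<in> borel_measurable (gauss ?I)"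
    by (rule borel_measurable_Max[OF I(1)]) (use comp in \<open>auto intro!: borel_measurable_abs borel_measurable_times\<close>)
  have eq: "(MAX (i, j)\<in>?I. \<bar>a i j * g (i, j)\<bar>) = (MAX x\<in>?I. \<bar>(case x of (i, j) \<Rightarrow> a i j) * g x\<bar>)" for g
    by (intro arg_cong[of _ _ Max] image_cong) auto
  show ?thesis
    unfolding eq
  proof (rule Bochner_Integration.integrable_bound)
    show "integrable (gauss ?I) (\<lambda>g. \<Sum>x\<in>?I. \<bar>case x of (i, j) \<Rightarrow> a i j\<bar> * (1 + (g x)\<^sup>2))"
      by (intro Bochner_Integration.integrable_sum integrable_mult_right Bochner_Integration.integrable_add gauss_sq_integrable) auto
    show "(\<lambda>g. MAX x\<in>?I. \<bar>(case x of (i, j) \<Rightarrow> a i j) * g x\<bar>) \<in> borel_measurable (gauss ?I)" by (rule meas)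
    show "AE g in gauss ?I. norm (MAX x\<in>?I. \<bar>(case x of (i, j) \<Rightarrow> a i j) * g x\<bar>) \<le> norm (\<Sum>x\<in>?I. \<bar>case x of (i, j) \<Rightarrow> a i j\<bar> * (1 + (g x)\<^sup>2))"
    proof (rule AE_I2)
      fix g :: "nat \<times> nat \<Rightarrow> real"
      let ?A = "\<lambda>x. case x of (i, j) \<Rightarrow> a i j"
      have s0: "0 \<le> (\<Sum>x\<in>?I. \<bar>?A x\<bar> * (1 + (g x)\<^sup>2))" by (intro sum_nonneg) auto
      have le: "\<bar>?A x * g x\<bar> \<le> (\<Sum>x\<in>?I. \<bar>?A x\<bar> * (1 + (g x)\<^sup>2))" if x: "x \<in> ?I" for x
      proof -
        have "\<bar>g x\<bar> \<le> 1 + (g x)\<^sup>2" using sum_squares_bound[of 1 "\<bar>g x\<bar>"] by simp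
        then have "\<bar>?A x * g x\<bar> \<le> \<bar>?A x\<bar> * (1 + (g x)\<^sup>2)" unfolding abs_mult by (intro mult_left_mono) auto
        also have "\<dots> \<le> (\<Sum>x\<in>?I. \<bar>?A x\<bar> * (1 + (g x)\<^sup>2))" by (rule member_le_sum[OF x]) (use I in auto)
        finally show ?thesis .
      qed
      have "(MAX x\<in>?I. \<bar>?A x * g x\<bar>) \<le> (\<Sum>x\<in>?I. \<bar>?A x\<bar> * (1 + (g x)\<^sup>2))"
        using I le by (intro Max.boundedI) auto
      moreover have "0 \<le> (MAX x\<in>?I. \<bar>?A x * g x\<bar>)"
        using Max_in[of "(\<lambda>x. \<bar>?A x * g x\<bar>) ` ?I"] I by fastforce
      ultimately show "norm (MAX x\<in>?I. \<bar>?A x * g x\<bar>) \<le> norm (\<Sum>x\<in>?I. \<bar>?A x\<bar> * (1 + (g x)\<^sup>2))"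
        using s0 by simp
    qed
  qed
qed

lemma S_star_nonneg:
  assumes m: "0 < m" and n: "0 < n"
  shows "0 \<le> S_star m n a"
  unfolding S_star_def
proof (rule Bochner_Integration.integral_nonneg)
  fix g
  have "\<bar>a 0 0 * g (0, 0)\<bar> \<le> (MAX (i, j)\<in>{..<m} \<times> {..<n}. \<bar>a i j * g (i, j)\<bar>)"
    by (rule Max_ge[OF finite_imageI[OF finite_cartesian_product[OF finite_lessThan finite_lessThan]]])
       (rule image_eqI[of _ _ "(0, 0)"], use m n in auto)
  then show "0 \<le> (MAX (i, j)\<in>{..<m} \<times> {..<n}. \<bar>a i j * g (i, j)\<bar>)" by linarith
qed

text \<open>By Markov's inequality the maximum exceeds tau with probability at most 1/2, so
  \<open>gauss_count_bound\<close> bounds the sum of the probabilities of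
  \<open>a i j * |g| >= \<tau>\<close> by 4. The Gaussian tail bounds each from below by exp(-tau^2
  / a^2) / 8, and 32 = 8 * 4.\<close>

lemma S_star_count:
  assumes m: "0 < m" and n: "0 < n" and tau: "0 < \<tau>" "2 * S_star m n a \<le> \<tau>"
    and P: "P \<subseteq> {..<m} \<times> {..<n}" "\<And>i j. (i, j) \<in> P \<Longrightarrow> 0 < a i j"
  shows "(\<Sum>(i, j)\<in>P. exp (- \<tau>\<^sup>2 / (a i j)\<^sup>2)) \<le> 32"
proof -
  let ?I = "{..<m} \<times> {..<n}"
  have I: "finite ?I" by simp
  have fP: "finite P" by (rule finite_subset[OF P(1) I])
  interpret prob_space "gauss ?I" by (rule prob_space_gauss)
  interpret S: prob_space std by (rule prob_space_std)
  define A where "A = (\<lambda>x. case x of (i, j) \<Rightarrow> a i j)"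
  define \<psi> where "\<psi> = (\<lambda>x t. if x \<in> P \<and> \<tau> \<le> A x * \<bar>t\<bar> then 1 else 0 :: real)"
  define M where "M = (\<lambda>g. MAX (i, j)\<in>?I. \<bar>a i j * g (i, j)\<bar> :: real)"
  have int: "integrable (gauss ?I) M" unfolding M_def by (rule S_star_integrable[OF m n])
  have M_ge: "\<bar>A x * g x\<bar> \<le> M g" if "x \<in> ?I" for x g
    unfolding M_def A_def 
    by (rule Max_ge[OF finite_imageI[OF I]]) (rule image_eqI[of _ _ x], use that in auto)
  have [measurable]: "M \<in> borel_measurable (gauss ?I)" using int by auto
  define S where "S = {g \<in> space (gauss ?I). \<tau> \<le> M g}"
  have S: "S \<in> sets (gauss ?I)" unfolding S_def by measurable
  have "\<tau> * prob S = (\<integral>g. \<tau> * indicator S g \<partial>gauss ?I)" using S by simp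
  also have "\<dots> \<le> (\<integral>g. M g \<partial>gauss ?I)"
  proof (rule integral_mono[OF _ int])
    show "integrable (gauss ?I) (\<lambda>g. \<tau> * indicator S g)"
      using S by (intro integrable_mult_right integrable_real_indicator) (auto simp: emeasure_eq_measure)
    have "(0, 0) \<in> ?I" using m n by simp
    then have "0 \<le> M g" for g using M_ge[of "(0, 0)" g] by linarith
    then show "\<tau> * indicator S g \<le> M g" for g by (auto simp: indicator_def S_def)
  qed
  also have "\<dots> = S_star m n a" by (simp add: S_star_def M_def)
  finally have "2 * (\<tau> * prob S) \<le> 2 * S_star m n a" by simp
  also have "\<dots> \<le> 2 * (\<tau> * (1 / 2))" using tau by simp
  finally have "\<tau> * prob S \<le> \<tau> * (1 / 2)" by simp
  then have pS: "prob S \<le> 1 / 2" using tau by (subst (asm) mult_le_cancel_left_pos) auto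
  have "(\<Sum>x\<in>?I. \<integral>t. \<psi> x t \<partial>std) \<le> 4"
  proof (rule gauss_count_bound[OF I])
    show "\<psi> x \<in> borel_measurable borel" for x unfolding \<psi>_def by measurable
    have "{g \<in> space (gauss ?I). 1 \<le> (\<Sum>x\<in>?I. \<psi> x (g x))} \<subseteq> S"
    proof
      fix g assume g: "g \<in> {g \<in> space (gauss ?I). 1 \<le> (\<Sum>x\<in>?I. \<psi> x (g x))}"
      then obtain x where x: "x \<in> ?I" "\<psi> x (g x) \<noteq> 0"
        by (metis (mono_tags, lifting) mem_Collect_eq not_one_le_zero sum.neutral)
      then have "\<tau> \<le> A x * \<bar>g x\<bar>" by (auto simp: \<psi>_def split: if_splits)
      also have "\<dots> \<le> \<bar>A x * g x\<bar>" by (simp add: abs_mult mult_right_mono)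
      also have "\<dots> \<le> M g" by (rule M_ge[OF x(1)])
      finally show "g \<in> S" using g by (simp add: S_def)
    qed
    then show "prob {g \<in> space (gauss ?I). 1 \<le> (\<Sum>x\<in>?I. \<psi> x (g x))} \<le> 1 / 2"
      using finite_measure_mono[OF _ S] pS by (meson order_trans)
  qed (auto simp: \<psi>_def)
  moreover have "(\<Sum>x\<in>P. exp (- \<tau>\<^sup>2 / (A x)\<^sup>2) / 8) \<le> (\<Sum>x\<in>P. \<integral>t. \<psi> x t \<partial>std)"
  proof (rule sum_mono)
    fix x assume x: "x \<in> P"
    then have Ax: "0 < A x" using P(2) by (cases x) (auto simp: A_def)
    have "exp (- (\<tau> / A x)\<^sup>2) / 8 \<le> S.prob {t. \<tau> / A x \<le> \<bar>t\<bar>}"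
      using std_tail_lower[of "\<tau> / A x"] tau Ax by (simp add: S.emeasure_eq_measure)
    also have "\<dots> = (\<integral>t. \<psi> x t \<partial>std)"
    proof -
      have "\<psi> x = indicator {t. \<tau> / A x \<le> \<bar>t\<bar>}"
        using x Ax by (auto simp: \<psi>_def fun_eq_iff indicator_def pos_divide_le_eq mult.commute)
      then show ?thesis by simp
    qed
    finally show "exp (- \<tau>\<^sup>2 / (A x)\<^sup>2) / 8 \<le> (\<integral>t. \<psi> x t \<partial>std)" by (simp add: power_divide)
  qed
  moreover have "(\<Sum>x\<in>P. \<integral>t. \<psi> x t \<partial>std) \<le> (\<Sum>x\<in>?I. \<integral>t. \<psi> x t \<partial>std)"
    by (rule sum_mono2[OF I P(1)]) (auto simp: \<psi>_def intro!: Bochner_Integration.integral_nonneg)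
  ultimately have "(\<Sum>x\<in>P. exp (- \<tau>\<^sup>2 / (A x)\<^sup>2) / 8) \<le> 4" by linarith
  then have "(\<Sum>x\<in>P. exp (- \<tau>\<^sup>2 / (A x)\<^sup>2)) \<le> 32" by (simp flip: sum_divide_distrib)
  then show ?thesis by (simp add: A_def case_prod_unfold)
qed

lemma H_s_mono_exponent:
  assumes s: "2 \<le> s" and p: "2 \<le> p" "ereal p \<le> s" and m: "0 < m" and n: "0 < n"
  shows "H_s m n s a \<le> H_s m n (ereal p) a"
proof -
  have p2: "2 \<le> ereal p" using p by simp
  have I: "finite {..<m}" "{..<m} \<noteq> {}" using m by auto
  have "col_norm s m n a g \<le> col_norm (ereal p) m n a g" for g
  proof (rule col_norm_leI[OF s m n])
    fix j assume j: "j < n"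
    have "lnorm s {..<m} (\<lambda>i. a i j * g i) \<le> lnorm (ereal p) {..<m} (\<lambda>i. a i j * g i)"
      using lnorm_le_lp[OF s I, of p] p by (simp add: lnorm_ereal)
    also have "\<dots> \<le> col_norm (ereal p) m n a g" by (rule col_norm_ge[OF p2 m n j])
    finally show "lnorm s {..<m} (\<lambda>i. a i j * g i) \<le> col_norm (ereal p) m n a g" .
  qed
  then show ?thesis
    unfolding H_s_eq
    by (intro real_sqrt_le_mono integral_mono col_norm_sq_integrable s p2 m n power_mono col_norm_nonneg) auto
qed

text \<open>For \<open>s > Log m\<close> the norm \<open>l\<^sub>s\<close> is replaced by \<open>l\<^sub>p\<close> with \<open>p\<close> of order \<open>Log m\<close>,
  which is equivalent to the maximum norm.\<close>

lemma H_s_le: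
  assumes m: "0 < m" and n: "0 < n" and s: "2 \<le> s" and tau: "0 < \<tau>"
    and a: "\<And>i j. \<lbrakk>i < m; j < n\<rbrakk> \<Longrightarrow> 0 \<le> a i j"
    and small: "\<And>f. \<forall>j<n. f j < m \<Longrightarrow> (\<Sum>j | j < n \<and> 0 < a (f j) j. exp (- \<tau>\<^sup>2 / (a (f j) j)\<^sup>2)) \<le> 32"
  shows "H_s m n s a \<le> 2592 * (sqrt (real_of_ereal (min s (ereal (Log1 m)))) * D_s m n s a + \<tau>)"
proof -
  have I: "finite {..<m}" "{..<m} \<noteq> {}" using m by auto
  define D where "D = D_s m n s a"
  have Dj: "lnorm s {..<m} (\<lambda>i. a i j) \<le> D" if "j < n" for j
    unfolding D_def D_s_def by (rule Max_ge) (use that in auto)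
  have D0: "0 \<le> D" using Dj[OF n] lnorm_nonneg[OF s I] by (meson order_trans)
  have aD: "a i j \<le> D" if "i < m" "j < n" for i j
    using lnorm_component[OF s I, of i "\<lambda>i. a i j"] Dj[OF that(2)] that by simp
  \<comment> \<open>A largest entry of each column serves as its b j. The chosen positions are
    distinct pairs, so \<open>S_star\<close> controls them all together.\<close>
  have "\<exists>i<m. \<forall>i'<m. a i' j \<le> a i j" for j
  proof -
    have "Max ((\<lambda>i. a i j) ` {..<m}) \<in> (\<lambda>i. a i j) ` {..<m}" by (rule Max_in) (use I in auto)
    then obtain i where "Max ((\<lambda>i. a i j) ` {..<m}) = a i j" "i \<in> {..<m}" by (rule imageE)
    moreover have "a i' j \<le> Max ((\<lambda>i. a i j) ` {..<m})" if "i' < m" for i' by (rule Max_ge) (use that in auto)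
    ultimately show ?thesis by auto
  qed
  then obtain f where f: "\<And>j. f j < m" "\<And>j i. i < m \<Longrightarrow> a i j \<le> a (f j) j" by metis
  have sm: "(\<Sum>j | j < n \<and> 0 < a (f j) j. exp (- \<tau>\<^sup>2 / (a (f j) j)\<^sup>2)) \<le> 32" by (rule small) (use f in auto)
  have key: "H_s m n s a \<le> 432 * (sqrt p * D' + \<tau>)"
    if p: "2 \<le> p" "ereal p \<le> s" and D': "\<And>j. j < n \<Longrightarrow> lp p {..<m} (\<lambda>i. a i j) \<le> D'" "D \<le> D'" for p D'
  proof -
    have "H_s m n s a \<le> H_s m n (ereal p) a" by (rule H_s_mono_exponent[OF s p m n])
    also have "\<dots> \<le> 432 * (sqrt p * D' + \<tau>)"
    proof (rule max_column_moment[OF m n p(1) tau a])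
      show "a (f j) j \<le> D'" if "j < n" for j using aD[OF f(1)[of j] that] D'(2) by linarith
    qed (use f a D' sm in auto)
    finally show ?thesis .
  qed
  have L1: "1 \<le> Log1 m" by (simp add: Log1_def)
  show ?thesis
  proof (cases "s \<le> ereal (Log1 m)")
    case True
    then obtain p where p: "s = ereal p" "2 \<le> p" using s by (cases s) auto
    have "H_s m n s a \<le> 432 * (sqrt p * D + \<tau>)"
      by (rule key) (use p Dj in \<open>auto simp: lnorm_ereal\<close>)
    also have "\<dots> \<le> 2592 * (sqrt p * D + \<tau>)" using D0 tau p by (intro mult_right_mono) (auto intro!: add_nonneg_nonneg)
    finally show ?thesis using True p by (simp add: min_absorb1 D_def)
  next
    case False
    \<comment> \<open>With this p one has m^(1/p) <= exp 1 <= 3 and sqrt p <= 2 * sqrt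
      (\<open>Log1 m\<close>); the product 6 turns 432 into 2592.\<close>
    define p where "p = max 2 (Log1 m)"
    have p: "2 \<le> p" "ereal p \<le> s" using s False by (auto simp: p_def max_def)
    have "real m powr (1 / p) \<le> exp 1"
    proof -
      have "ln (real m) \<le> p" by (simp add: p_def Log1_def)
      then have "ln (real m) * (1 / p) \<le> 1" using p by (simp add: field_simps)
      then show ?thesis using m by (simp add: powr_def)
    qed
    then have m3: "real m powr (1 / p) \<le> 3" using exp_le by linarith
    have lpD: "lp p {..<m} (\<lambda>i. a i j) \<le> 3 * D" if j: "j < n" for j
    proof -
      have "lp p {..<m} (\<lambda>i. a i j) \<le> real (card {..<m}) powr (1 / p) * D"
        by (rule lp_card_bound) (use p D0 aD a j in auto)
      also have "\<dots> \<le> 3 * D" using m3 D0 by (simp add: mult_right_mono)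
      finally show ?thesis .
    qed
    have "H_s m n s a \<le> 432 * (sqrt p * (3 * D) + \<tau>)" by (rule key) (use p lpD D0 in auto)
    also have "\<dots> \<le> 432 * (2 * sqrt (Log1 m) * (3 * D) + \<tau>)"
    proof -
      have "sqrt p \<le> sqrt (4 * Log1 m)" using L1 by (intro real_sqrt_le_mono) (simp add: p_def)
      also have "\<dots> = 2 * sqrt (Log1 m)" by (simp add: real_sqrt_mult)
      finally have "sqrt p * (3 * D) \<le> 2 * sqrt (Log1 m) * (3 * D)" using D0 by (intro mult_right_mono) auto
      then show ?thesis by simp
    qed
    also have "\<dots> \<le> 2592 * (sqrt (Log1 m) * D + \<tau>)" using tau by simp
    finally show ?thesis using False by (simp add: min_absorb2 D_def)
  qed
qed

lemma H_le_Mbound: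
  assumes r: "2 \<le> r" and s: "2 \<le> s" and m: "0 < m" and n: "0 < n"
    and a: "\<And>i j. \<lbrakk>i < m; j < n\<rbrakk> \<Longrightarrow> 0 \<le> a i j"
  shows "H_r m n r a + H_s m n s a \<le> 10368 * Mbound m n r s a"
proof (rule field_le_epsilon)
  fix e :: real assume e: "0 < e"
  \<comment> \<open>The slack keeps tau positive when \<open>S_star\<close> is 0. In the final sum
    tau has coefficient 2 * 2592 = 5184, so the slack contributes exactly e.\<close>
  define \<tau> where "\<tau> = 2 * S_star m n a + e / 5184"
  have S0: "0 \<le> S_star m n a" by (rule S_star_nonneg[OF m n])
  have tau: "0 < \<tau>" "2 * S_star m n a \<le> \<tau>" using S0 e by (auto simp: \<tau>_def)
  define x where "x = sqrt (real_of_ereal (min s (ereal (Log1 m)))) * D_s m n s a"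
  define y where "y = sqrt (real_of_ereal (min r (ereal (Log1 n)))) * D_r m n r a"
  have nonneg: "0 \<le> sqrt (real_of_ereal (min t (ereal (Log1 d))))" if "2 \<le> t" for t d
  proof -
    have "0 \<le> Log1 d" by (simp add: Log1_def)
    then have "0 \<le> real_of_ereal (min t (ereal (Log1 d)))"
      using that by (cases t) (auto simp: min_def)
    then show ?thesis by simp
  qed
  have D0: "0 \<le> D_s d l t c" if "2 \<le> t" "0 < d" "0 < l" for d l t c
  proof -
    have "0 \<le> lnorm t {..<d} (\<lambda>i. c i 0)" by (rule lnorm_nonneg) (use that in auto)
    also have "\<dots> \<le> D_s d l t c" unfolding D_s_def by (rule Max_ge) (use that in auto)
    finally show ?thesis .
  qed
  have Dr: "D_r m n r a = D_s n m r (\<lambda>j i. a i j)" by (simp add: D_r_def D_s_def)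
  have xy: "0 \<le> x" "0 \<le> y"
    unfolding x_def y_def Dr by (intro mult_nonneg_nonneg nonneg D0 r s m n)+
  have "H_s m n s a \<le> 2592 * (x + \<tau>)"
    unfolding x_def
  proof (rule H_s_le[OF m n s tau(1) a])
    fix f :: "nat \<Rightarrow> nat" assume f: "\<forall>j<n. f j < m"
    let ?J = "{j. j < n \<and> 0 < a (f j) j}"
    have "(\<Sum>j\<in>?J. exp (- \<tau>\<^sup>2 / (a (f j) j)\<^sup>2)) = (\<Sum>(i, j)\<in>(\<lambda>j. (f j, j)) ` ?J. exp (- \<tau>\<^sup>2 / (a i j)\<^sup>2))"
      by (subst sum.reindex) (auto intro: inj_onI)
    also have "\<dots> \<le> 32" by (rule S_star_count[OF m n tau]) (use f in auto)
    finally show "(\<Sum>j\<in>?J. exp (- \<tau>\<^sup>2 / (a (f j) j)\<^sup>2)) \<le> 32" .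
  qed auto
  moreover have "H_r m n r a \<le> 2592 * (y + \<tau>)"
    unfolding y_def H_r_eq Dr
  proof (rule H_s_le[OF n m r tau(1)])
    fix f :: "nat \<Rightarrow> nat" assume f: "\<forall>i<m. f i < n"
    let ?J = "{i. i < m \<and> 0 < a i (f i)}"
    have "(\<Sum>i\<in>?J. exp (- \<tau>\<^sup>2 / (a i (f i))\<^sup>2)) = (\<Sum>(i, j)\<in>(\<lambda>i. (i, f i)) ` ?J. exp (- \<tau>\<^sup>2 / (a i j)\<^sup>2))"
      by (subst sum.reindex) (auto intro: inj_onI)
    also have "\<dots> \<le> 32" by (rule S_star_count[OF m n tau]) (use f in auto)
    finally show "(\<Sum>i\<in>?J. exp (- \<tau>\<^sup>2 / (a i (f i))\<^sup>2)) \<le> 32" .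
  qed (use a in auto)
  ultimately have "H_r m n r a + H_s m n s a \<le> 2592 * x + 2592 * y + 5184 * \<tau>" by (simp add: distrib_left)
  also have "\<dots> = 2592 * x + 2592 * y + 10368 * S_star m n a + e" by (simp add: \<tau>_def distrib_left)
  also have "\<dots> \<le> 10368 * (y + x + S_star m n a) + e" using xy by (simp add: distrib_left)
  finally show "H_r m n r a + H_s m n s a \<le> 10368 * Mbound m n r s a + e"
    by (simp add: Mbound_def x_def y_def)
qed

theorem proposition5p1:
  shows "\<exists>C::real. C > 0 \<and>
    (\<forall>(r::ereal) (s::ereal) (m::nat) (n::nat) (a :: nat \<Rightarrow> nat \<Rightarrow> real).
       2 \<le> r \<longrightarrow> 2 \<le> s \<longrightarrow> 0 < m \<longrightarrow> 0 < n \<longrightarrow>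
       (\<forall>i<m. \<forall>j<n. 0 \<le> a i j) \<longrightarrow>
         gamma22 (Kset m n) (rho m n r s a) \<le> ennreal (C * (H_r m n r a + H_s m n s a)) \<and>
         H_r m n r a + H_s m n s a \<le> C * Mbound m n r s a)"
proof -
  define C :: real where "C = 384 * sqrt (11 * 25000) + 10368"
  have C: "0 < C" by (simp add: C_def add_nonneg_pos)
  have "gamma22 (Kset m n) (rho m n r s a) \<le> ennreal (C * (H_r m n r a + H_s m n s a)) \<and>
      H_r m n r a + H_s m n s a \<le> C * Mbound m n r s a"
    if *: "2 \<le> r" "2 \<le> s" "0 < m" "0 < n" "\<forall>i<m. \<forall>j<n. 0 \<le> a i j" for r s m n a
  proof
    have a: "\<And>i j. \<lbrakk>i < m; j < n\<rbrakk> \<Longrightarrow> 0 \<le> a i j" using *(5) by blast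
    have H0: "0 \<le> H_r m n r a + H_s m n s a"
      unfolding H_r_eq by (intro add_nonneg_nonneg H_s_nonneg)
    have M: "H_r m n r a + H_s m n s a \<le> 10368 * Mbound m n r s a" by (rule H_le_Mbound[OF *(1-4) a])
    have "gamma22 (Kset m n) (rho m n r s a) \<le> ennreal (384 * sqrt (11 * 25000) * (H_r m n r a + H_s m n s a))"
      by (rule gamma22_le_H[OF *(1-4) a])
    also have "\<dots> \<le> ennreal (C * (H_r m n r a + H_s m n s a))"
      using H0 by (intro ennreal_leI mult_right_mono) (auto simp: C_def)
    finally show "gamma22 (Kset m n) (rho m n r s a) \<le> ennreal (C * (H_r m n r a + H_s m n s a))" .
    have "0 \<le> Mbound m n r s a" using H0 M by linarith
    then have "10368 * Mbound m n r s a \<le> C * Mbound m n r s a" by (intro mult_right_mono) (auto simp: C_def)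
    then show "H_r m n r a + H_s m n s a \<le> C * Mbound m n r s a" using M by linarith
  qed
  then show ?thesis using C by (intro exI[of _ C] conjI allI impI) blast+
qed

end
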